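(* With the objects defined in the context, let $T_N=P_NR_{\mathrm{cl}}Q_NBU_N:X_N\to X_N$ and $L_N:=\|P_NR_{\mathrm{cl}}Q_N\|_{\mathcal L(\mathcal X)}$, and let $y_r\in X_N$. If $$L_N\,\|B\|_{\mathcal L(\mathbb{R}^M,\mathcal X)}\,\|U_N\|_{\mathcal L(X_N,\mathbb{R}^M)}<1,$$ then $I+T_N$ is invertible on $X_N$, the equation $(I+T_N)y^\star=y_r$ admits a unique solution $y^\star\in X_N$, and the Picard iteration $y^{(\ell+1)}:=y_r-T_Ny^{(\ell)}$ converges geometrically to $y^\star$. Moreover, $$\|y^\star\|_{X_N}\le\frac{1}{1-\|T_N\|}\,\|y_r\|_{X_N}.$$
   Context: $\Omega\subset\mathbb{R}^3$ is a bounded connected $C^2$ domain, $\kappa_m>0$, $H=L^2(\Omega)$; $A_0=\kappa_m\Delta$ with homogeneous Neumann boundary condition, $D(A_0)=\{y\in H^2(\Omega):\partial_\nu y=0\}$; $\mathcal A=I-A_0$, $D(\mathcal A)=D(A_0)$; $\mathcal X=D(\mathcal A)'$ with norm $\|\eta\|_{\mathcal X}=\|\mathcal A^{-1}\eta\|_H$. $\{\varphi_k\}_{k\ge1}$ is an $L^2$-orthonormal basis of Neumann eigenfunctions of $-\Delta$ with eigenvalues $0=\lambda_1\le\lambda_2\le\cdots$; $X_N=\mathrm{span}\{\varphi_1,\dots,\varphi_N\}$, with the norm inherited from $\mathcal X$; $P_N$ is the spectral projector onto $X_N$ ($H$-orthogonal, extended to $\mathcal X$ by $P_N\eta=\sum_{k\le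 N}\langle\eta,\varphi_k\rangle\varphi_k$) and $Q_N=I-P_N$. For points $x_1,\dots,x_M\in\Omega$, $B:\mathbb{R}^M\to\mathcal X$, $Bu=\sum_ju_j\delta_{x_j}$. The closed-loop generator is $A_{\mathrm{cl}}z=A_0z-\lambda\sum_{j=1}^M(\mathcal A^{-1}z)(x_j)\delta_{x_j}$ with $\lambda>0$ such that the semigroup $S_{\mathrm{cl}}(t)=e^{tA_{\mathrm{cl}}}$ is exponentially stable on $(H^1(\Omega))'$ and extends to an exponentially stable semigroup on $\mathcal X$; $R_{\mathrm{cl}}:=\int_0^\infty S_{\mathrm{cl}}(t)\,dt$. $U_N:X_N\to\mathbb{R}^M$ is linear and satisfies $P_N(A_0y+BU_Ny)=0$ for all $y\in X_N$. $\|T_N\|$ denotes the norm in $\mathcal L(X_N)$. *)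

theory Defs
  imports "HOL-Analysis.Analysis"
begin

type_synonym pt = "real ^ 3"
type_synonym fn = "pt \<Rightarrow> real"

text \<open>Elements of \<open>D(A)'\<close> are functionals on functions. They are extended by \<open>0\<close>
  outside \<open>D(A)\<close>, so that equality of elements of \<open>D(A)'\<close> is equality in HOL.\<close>

type_synonym fnl = "fn \<Rightarrow> real"

definition partial :: "3 \<Rightarrow> fn \<Rightarrow> fn" where
  "partial i f x = frechet_derivative f (at x) (axis i 1)"

primrec Ck :: "nat \<Rightarrow> pt set \<Rightarrow> fn \<Rightarrow> bool" where
  "Ck 0 U f = continuous_on U f"
| "Ck (Suc k) U f = ((\<forall>x\<in>U. f differentiable (at x)) \<and> (\<forall>i. Ck k U (partial i f)))"

definition grad :: "fn \<Rightarrow> pt \<Rightarrow> pt" where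
  "grad f x = (\<chi> i. partial i f x)"

definition local_defining_function :: "pt set \<Rightarrow> pt \<Rightarrow> real \<Rightarrow> fn \<Rightarrow> bool" where
  "local_defining_function \<Omega> x r \<rho> \<longleftrightarrow>
     r > 0 \<and> Ck 2 (ball x r) \<rho> \<and> (\<forall>y\<in>ball x r. grad \<rho> y \<noteq> 0) \<and>
     \<Omega> \<inter> ball x r = {y \<in> ball x r. \<rho> y < 0}"

definition C2_domain :: "pt set \<Rightarrow> bool" where
  "C2_domain \<Omega> \<longleftrightarrow>
     \<Omega> \<noteq> {} \<and> open \<Omega> \<and> bounded \<Omega> \<and> connected \<Omega> \<and>
     (\<forall>x\<in>frontier \<Omega>. \<exists>r \<rho>. local_defining_function \<Omega> x r \<rho>)"

definition outward_normal :: "pt set \<Rightarrow> pt \<Rightarrow> pt" where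
  "outward_normal \<Omega> x =
     (THE n. \<exists>r \<rho>. local_defining_function \<Omega> x r \<rho> \<and> n = grad \<rho> x /\<^sub>R norm (grad \<rho> x))"

text \<open>Two-dimensional Hausdorff measure, normalised so that a flat unit disc has measure \<open>\<pi>\<close>.
  The outer measure is a metric outer measure, hence countably additive on Borel sets,
  so that \<^const>\<open>measure_of\<close> does not degenerate.\<close>

definition hausdorff2_pre :: "real \<Rightarrow> pt set \<Rightarrow> ennreal" where
  "hausdorff2_pre d A =
     (INF C \<in> {C :: nat \<Rightarrow> pt set. A \<subseteq> (\<Union>i. C i) \<and> (\<forall>i. bounded (C i) \<and> diameter (C i) \<le> d)}.
        \<Sum>i. ennreal (pi / 4 * (diameter (C i))\<^sup>2))"

definition hausdorff2 :: "pt measure" where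
  "hausdorff2 = measure_of UNIV (sets borel) (\<lambda>A. SUP d \<in> {0<..}. hausdorff2_pre d A)"

definition surface_measure :: "pt set \<Rightarrow> pt measure" where
  "surface_measure \<Omega> = restrict_space hausdorff2 (frontier \<Omega>)"

text \<open>Members of \<open>L\<^sup>2(\<Omega>)\<close> and of the Sobolev spaces are represented by functions on the whole
  space; values outside \<open>\<Omega>\<close> and on null sets are irrelevant.\<close>

definition L2 :: "pt set \<Rightarrow> fn set" where
  "L2 \<Omega> = {f. f \<in> borel_measurable (lebesgue_on \<Omega>) \<and> integrable (lebesgue_on \<Omega>) (\<lambda>x. (f x)\<^sup>2)}"

definition L2_ip :: "pt set \<Rightarrow> fn \<Rightarrow> fn \<Rightarrow> real" where
  "L2_ip \<Omega> f g = (LINT x|lebesgue_on \<Omega>. f x * g x)"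

definition L2_norm :: "pt set \<Rightarrow> fn \<Rightarrow> real" where
  "L2_norm \<Omega> f = sqrt (L2_ip \<Omega> f f)"

definition test_function :: "pt set \<Rightarrow> fn \<Rightarrow> bool" where
  "test_function \<Omega> \<psi> \<longleftrightarrow>
     (\<forall>k. Ck k UNIV \<psi>) \<and> compact (closure {x. \<psi> x \<noteq> 0}) \<and> closure {x. \<psi> x \<noteq> 0} \<subseteq> \<Omega>"

definition has_weak_partial :: "pt set \<Rightarrow> 3 \<Rightarrow> fn \<Rightarrow> fn \<Rightarrow> bool" where
  "has_weak_partial \<Omega> i u g \<longleftrightarrow> u \<in> L2 \<Omega> \<and> g \<in> L2 \<Omega> \<and>
     (\<forall>\<psi>. test_function \<Omega> \<psi> \<longrightarrow> L2_ip \<Omega> u (partial i \<psi>) = - L2_ip \<Omega> g \<psi>)"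

definition weak_partial :: "pt set \<Rightarrow> 3 \<Rightarrow> fn \<Rightarrow> fn" where
  "weak_partial \<Omega> i u = (SOME g. has_weak_partial \<Omega> i u g)"

definition H1 :: "pt set \<Rightarrow> fn set" where
  "H1 \<Omega> = {u \<in> L2 \<Omega>. \<forall>i. \<exists>g. has_weak_partial \<Omega> i u g}"

definition H1_norm :: "pt set \<Rightarrow> fn \<Rightarrow> real" where
  "H1_norm \<Omega> u = sqrt ((L2_norm \<Omega> u)\<^sup>2 + (\<Sum>i\<in>UNIV. (L2_norm \<Omega> (weak_partial \<Omega> i u))\<^sup>2))"

definition H2 :: "pt set \<Rightarrow> fn set" where
  "H2 \<Omega> = {u \<in> H1 \<Omega>. \<forall>i. weak_partial \<Omega> i u \<in> H1 \<Omega>}"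

text \<open>\<open>g\<close> is the boundary trace of \<open>u \<in> H\<^sup>1(\<Omega>)\<close>: the trace operator is the continuous extension to
  \<open>H\<^sup>1(\<Omega>)\<close>, with values in \<open>L\<^sup>2(\<partial>\<Omega>)\<close>, of the restriction of smooth functions to \<open>\<partial>\<Omega>\<close>.\<close>

definition has_trace :: "pt set \<Rightarrow> fn \<Rightarrow> fn \<Rightarrow> bool" where
  "has_trace \<Omega> u g \<longleftrightarrow> u \<in> H1 \<Omega> \<and> g \<in> borel_measurable (surface_measure \<Omega>) \<and>
     (\<exists>w. (\<forall>n::nat. (\<forall>k. Ck k UNIV (w n)) \<and> w n \<in> H1 \<Omega>) \<and>
          (\<lambda>n. H1_norm \<Omega> (\<lambda>x. w n x - u x)) \<longlonglongrightarrow> 0 \<and>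
          (\<lambda>n. \<integral>\<^sup>+x. ennreal ((w n x - g x)\<^sup>2) \<partial>surface_measure \<Omega>) \<longlonglongrightarrow> 0)"

definition neumann_bc :: "pt set \<Rightarrow> fn \<Rightarrow> bool" where
  "neumann_bc \<Omega> y \<longleftrightarrow>
     (\<exists>g :: 3 \<Rightarrow> fn. (\<forall>i. has_trace \<Omega> (weak_partial \<Omega> i y) (g i)) \<and>
        (AE x in surface_measure \<Omega>. (\<Sum>i\<in>UNIV. outward_normal \<Omega> x $ i * g i x) = 0))"

definition laplacian :: "pt set \<Rightarrow> fn \<Rightarrow> fn" where
  "laplacian \<Omega> y x = (\<Sum>i\<in>UNIV. weak_partial \<Omega> i (weak_partial \<Omega> i y) x)"

text \<open>\<open>D(A\<^sub>0) = D(A)\<close>; the operators are meant on this domain only.\<close>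

definition neumann_dom :: "pt set \<Rightarrow> fn set" where
  "neumann_dom \<Omega> = {y \<in> H2 \<Omega>. neumann_bc \<Omega> y}"

definition A0 :: "pt set \<Rightarrow> real \<Rightarrow> fn \<Rightarrow> fn" where
  "A0 \<Omega> \<kappa> y = (\<lambda>x. \<kappa> * laplacian \<Omega> y x)"

definition Aop :: "pt set \<Rightarrow> real \<Rightarrow> fn \<Rightarrow> fn" where
  "Aop \<Omega> \<kappa> y = (\<lambda>x. y x - A0 \<Omega> \<kappa> y x)"

text \<open>\<open>D(A)\<close> carries the norm \<open>\<parallel>A v\<parallel>\<close>, whose dual norm is \<open>\<parallel>A\<^sup>-\<^sup>1 \<eta>\<parallel>\<close>. The bound makes
  a functional insensitive to the choice of representatives.\<close>

definition Xsp :: "pt set \<Rightarrow> real \<Rightarrow> fnl set" where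
  "Xsp \<Omega> \<kappa> = {\<eta>. (\<forall>v. v \<notin> neumann_dom \<Omega> \<longrightarrow> \<eta> v = 0) \<and>
     (\<forall>v\<in>neumann_dom \<Omega>. \<forall>w\<in>neumann_dom \<Omega>. \<forall>a b.
        \<eta> (\<lambda>x. a * v x + b * w x) = a * \<eta> v + b * \<eta> w) \<and>
     (\<exists>C. \<forall>v\<in>neumann_dom \<Omega>. \<bar>\<eta> v\<bar> \<le> C * L2_norm \<Omega> (Aop \<Omega> \<kappa> v))}"

text \<open>The embedding of \<open>H = L\<^sup>2(\<Omega>)\<close> (pivot space) into \<open>D(A)'\<close>.\<close>

definition emb :: "pt set \<Rightarrow> fn \<Rightarrow> fnl" where
  "emb \<Omega> f = (\<lambda>v. if v \<in> neumann_dom \<Omega> then L2_ip \<Omega> f v else 0)"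

text \<open>\<open>A\<^sup>-\<^sup>1 : D(A)' \<rightarrow> H\<close> is the inverse of the extension by transposition \<open>H \<rightarrow> D(A)'\<close> of the
  self-adjoint operator \<open>A\<close>; on \<open>H\<close> it is the inverse of \<open>A\<close> itself. The value is a
  representative of an \<open>L\<^sup>2\<close> class.\<close>

definition Ainv :: "pt set \<Rightarrow> real \<Rightarrow> fnl \<Rightarrow> fn" where
  "Ainv \<Omega> \<kappa> \<eta> =
     (SOME h. h \<in> L2 \<Omega> \<and> (\<forall>v\<in>neumann_dom \<Omega>. \<eta> v = L2_ip \<Omega> h (Aop \<Omega> \<kappa> v)))"

definition Xnorm :: "pt set \<Rightarrow> real \<Rightarrow> fnl \<Rightarrow> real" where
  "Xnorm \<Omega> \<kappa> \<eta> = L2_norm \<Omega> (Ainv \<Omega> \<kappa> \<eta>)"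

text \<open>\<open>(H\<^sup>1(\<Omega>))'\<close> as a subspace of \<open>D(A)'\<close>: since \<open>D(A)\<close> is dense in \<open>H\<^sup>1(\<Omega>)\<close>, a bounded functional
  on \<open>H\<^sup>1(\<Omega>)\<close> and its norm are determined by the restriction to \<open>D(A)\<close>.\<close>

definition H1dual :: "pt set \<Rightarrow> real \<Rightarrow> fnl set" where
  "H1dual \<Omega> \<kappa> = {\<eta> \<in> Xsp \<Omega> \<kappa>. \<exists>C. \<forall>v\<in>neumann_dom \<Omega>. \<bar>\<eta> v\<bar> \<le> C * H1_norm \<Omega> v}"

definition H1dual_norm :: "pt set \<Rightarrow> fnl \<Rightarrow> real" where
  "H1dual_norm \<Omega> \<eta> = (SUP v \<in> neumann_dom \<Omega>. \<bar>\<eta> v\<bar> / H1_norm \<Omega> v)"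

text \<open>The value at \<open>x \<in> \<Omega>\<close> of the continuous representative (one exists for members of \<open>H\<^sup>2(\<Omega>)\<close>,
  the space dimension being 3).\<close>

definition pt_value :: "pt set \<Rightarrow> fn \<Rightarrow> pt \<Rightarrow> real" where
  "pt_value \<Omega> f x =
     (THE c. \<exists>g. continuous_on \<Omega> g \<and> (AE y in lebesgue_on \<Omega>. g y = f y) \<and> c = g x)"

definition delta :: "pt set \<Rightarrow> pt \<Rightarrow> fnl" where
  "delta \<Omega> x = (\<lambda>v. if v \<in> neumann_dom \<Omega> then pt_value \<Omega> v x else 0)"

definition Bop :: "pt set \<Rightarrow> ('m::finite \<Rightarrow> pt) \<Rightarrow> real ^ 'm \<Rightarrow> fnl" where
  "Bop \<Omega> xs u = (\<lambda>v. \<Sum>j\<in>UNIV. u $ j * delta \<Omega> (xs j) v)"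

text \<open>\<open>A\<^sub>0 z\<close> for \<open>z \<in> H\<close> is understood in \<open>D(A)'\<close>, by transposition.\<close>

definition Acl :: "pt set \<Rightarrow> real \<Rightarrow> real \<Rightarrow> ('m::finite \<Rightarrow> pt) \<Rightarrow> fn \<Rightarrow> fnl" where
  "Acl \<Omega> \<kappa> lam xs z = (\<lambda>v. if v \<in> neumann_dom \<Omega>
     then L2_ip \<Omega> z (A0 \<Omega> \<kappa> v)
          - lam * (\<Sum>j\<in>UNIV. pt_value \<Omega> (Ainv \<Omega> \<kappa> (emb \<Omega> z)) (xs j) * delta \<Omega> (xs j) v)
     else 0)"

definition lin_on :: "fnl set \<Rightarrow> (fnl \<Rightarrow> fnl) \<Rightarrow> bool" where
  "lin_on V T \<longleftrightarrow> (\<forall>\<eta>\<in>V. \<forall>\<zeta>\<in>V. \<forall>a b.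
     T (\<lambda>v. a * \<eta> v + b * \<zeta> v) = (\<lambda>v. a * T \<eta> v + b * T \<zeta> v))"

definition C0_semigroup :: "fnl set \<Rightarrow> (fnl \<Rightarrow> real) \<Rightarrow> (real \<Rightarrow> fnl \<Rightarrow> fnl) \<Rightarrow> bool" where
  "C0_semigroup V nrm S \<longleftrightarrow>
     (\<forall>t\<ge>0. S t ` V \<subseteq> V \<and> lin_on V (S t) \<and> (\<exists>C. \<forall>\<eta>\<in>V. nrm (S t \<eta>) \<le> C * nrm \<eta>)) \<and>
     (\<forall>\<eta>\<in>V. S 0 \<eta> = \<eta>) \<and>
     (\<forall>s\<ge>0. \<forall>t\<ge>0. \<forall>\<eta>\<in>V. S (s + t) \<eta> = S s (S t \<eta>)) \<and>
     (\<forall>\<eta>\<in>V. ((\<lambda>t. nrm (\<lambda>v. S t \<eta> v - \<eta> v)) \<longlongrightarrow> 0) (at_right 0))"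

definition generator ::
  "fnl set \<Rightarrow> (fnl \<Rightarrow> real) \<Rightarrow> (real \<Rightarrow> fnl \<Rightarrow> fnl) \<Rightarrow> (fnl \<times> fnl) set" where
  "generator V nrm S = {(\<eta>, \<zeta>). \<eta> \<in> V \<and> \<zeta> \<in> V \<and>
     ((\<lambda>h. nrm (\<lambda>v. (S h \<eta> v - \<eta> v) / h - \<zeta> v)) \<longlongrightarrow> 0) (at_right 0)}"

definition exp_stable :: "fnl set \<Rightarrow> (fnl \<Rightarrow> real) \<Rightarrow> (real \<Rightarrow> fnl \<Rightarrow> fnl) \<Rightarrow> bool" where
  "exp_stable V nrm S \<longleftrightarrow>
     (\<exists>K \<omega>. \<omega> > 0 \<and> (\<forall>t\<ge>0. \<forall>\<eta>\<in>V. nrm (S t \<eta>) \<le> K * exp (- \<omega> * t) * nrm \<eta>))"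

text \<open>\<open>S\<close> is the closed-loop semigroup on \<open>D(A)'\<close>, where the generator has domain \<open>H\<close>; it restricts
  to the closed-loop semigroup on \<open>(H\<^sup>1(\<Omega>))'\<close>, whose generator is the part of the former in that
  space. Both are exponentially stable.\<close>

definition closed_loop_semigroup ::
  "pt set \<Rightarrow> real \<Rightarrow> real \<Rightarrow> ('m::finite \<Rightarrow> pt) \<Rightarrow> (real \<Rightarrow> fnl \<Rightarrow> fnl) \<Rightarrow> bool" where
  "closed_loop_semigroup \<Omega> \<kappa> lam xs S \<longleftrightarrow>
     C0_semigroup (H1dual \<Omega> \<kappa>) (H1dual_norm \<Omega>) S \<and>
     generator (H1dual \<Omega> \<kappa>) (H1dual_norm \<Omega>) S =
       {(emb \<Omega> z, Acl \<Omega> \<kappa> lam xs z) | z. z \<in> L2 \<Omega> \<and> Acl \<Omega> \<kappa> lam xs z \<in> H1dual \<Omega> \<kappa>} \<and>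
     exp_stable (H1dual \<Omega> \<kappa>) (H1dual_norm \<Omega>) S \<and>
     C0_semigroup (Xsp \<Omega> \<kappa>) (Xnorm \<Omega> \<kappa>) S \<and>
     generator (Xsp \<Omega> \<kappa>) (Xnorm \<Omega> \<kappa>) S =
       {(emb \<Omega> z, Acl \<Omega> \<kappa> lam xs z) | z. z \<in> L2 \<Omega>} \<and>
     exp_stable (Xsp \<Omega> \<kappa>) (Xnorm \<Omega> \<kappa>) S"

text \<open>\<open>\<integral>\<^sub>0\<^sup>\<infinity> S(t) \<eta> dt\<close>; the integral of a curve in the dual space \<open>D(A)'\<close> is evaluated on each
  element of \<open>D(A)\<close>.\<close>

definition Rcl :: "(real \<Rightarrow> fnl \<Rightarrow> fnl) \<Rightarrow> fnl \<Rightarrow> fnl" where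
  "Rcl S \<eta> = (\<lambda>v. LINT t:{0..}|lborel. S t \<eta> v)"

definition neumann_eigenbasis :: "pt set \<Rightarrow> (nat \<Rightarrow> real) \<Rightarrow> (nat \<Rightarrow> fn) \<Rightarrow> bool" where
  "neumann_eigenbasis \<Omega> ev \<phi> \<longleftrightarrow>
     ev 1 = 0 \<and> (\<forall>k\<ge>1. ev k \<le> ev (Suc k)) \<and>
     (\<forall>k\<ge>1. \<phi> k \<in> neumann_dom \<Omega> \<and>
        (AE x in lebesgue_on \<Omega>. - laplacian \<Omega> (\<phi> k) x = ev k * \<phi> k x)) \<and>
     (\<forall>k\<ge>1. \<forall>l\<ge>1. L2_ip \<Omega> (\<phi> k) (\<phi> l) = (if k = l then 1 else 0)) \<and>
     (\<forall>f\<in>L2 \<Omega>. (\<lambda>n. L2_norm \<Omega> (\<lambda>x. f x - (\<Sum>k=1..n. L2_ip \<Omega> f (\<phi> k) * \<phi> k x))) \<longlonglongrightarrow> 0)"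

definition mode_fns :: "(nat \<Rightarrow> fn) \<Rightarrow> nat \<Rightarrow> fn set" where
  "mode_fns \<phi> N = {(\<lambda>x. \<Sum>k=1..N. c k * \<phi> k x) | c. True}"

definition XN :: "pt set \<Rightarrow> (nat \<Rightarrow> fn) \<Rightarrow> nat \<Rightarrow> fnl set" where
  "XN \<Omega> \<phi> N = emb \<Omega> ` mode_fns \<phi> N"

definition PN :: "pt set \<Rightarrow> (nat \<Rightarrow> fn) \<Rightarrow> nat \<Rightarrow> fnl \<Rightarrow> fnl" where
  "PN \<Omega> \<phi> N \<eta> = (\<lambda>v. \<Sum>k=1..N. \<eta> (\<phi> k) * emb \<Omega> (\<phi> k) v)"

definition QN :: "pt set \<Rightarrow> (nat \<Rightarrow> fn) \<Rightarrow> nat \<Rightarrow> fnl \<Rightarrow> fnl" where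
  "QN \<Omega> \<phi> N \<eta> = (\<lambda>v. \<eta> v - PN \<Omega> \<phi> N \<eta> v)"

text \<open>Analogue of \<^const>\<open>onorm\<close> for a space given by a carrier and a norm function.\<close>

definition opnorm :: "'a set \<Rightarrow> ('a \<Rightarrow> real) \<Rightarrow> ('b \<Rightarrow> real) \<Rightarrow> ('a \<Rightarrow> 'b) \<Rightarrow> real" where
  "opnorm V nrmV nrmW T = (SUP v\<in>V. nrmW (T v) / nrmV v)"

definition TN :: "pt set \<Rightarrow> (nat \<Rightarrow> fn) \<Rightarrow> nat \<Rightarrow> ('m::finite \<Rightarrow> pt) \<Rightarrow>
    (real \<Rightarrow> fnl \<Rightarrow> fnl) \<Rightarrow> (fnl \<Rightarrow> real ^ 'm) \<Rightarrow> fnl \<Rightarrow> fnl" where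
  "TN \<Omega> \<phi> N xs S U = PN \<Omega> \<phi> N \<circ> Rcl S \<circ> QN \<Omega> \<phi> N \<circ> Bop \<Omega> xs \<circ> U"

definition LN :: "pt set \<Rightarrow> real \<Rightarrow> (nat \<Rightarrow> fn) \<Rightarrow> nat \<Rightarrow> (real \<Rightarrow> fnl \<Rightarrow> fnl) \<Rightarrow> real" where
  "LN \<Omega> \<kappa> \<phi> N S =
     opnorm (Xsp \<Omega> \<kappa>) (Xnorm \<Omega> \<kappa>) (Xnorm \<Omega> \<kappa>) (PN \<Omega> \<phi> N \<circ> Rcl S \<circ> QN \<Omega> \<phi> N)"

end

theory Submission
  imports Defs
begin

text \<open>Once \<open>T\<^sub>N\<close> is a contraction of \<open>X\<^sub>N\<close>, everything follows from the Banach fixed point theorem. The work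
  lies in showing that the three operator norms in the smallness condition are finite (the supremum of
  an unbounded set is junk), so that their product really bounds \<open>\<parallel>T\<^sub>N\<parallel>\<close>. Elements of \<open>D(A)'\<close> are represented by \<open>L\<^sup>2\<close> functions through the
  eigenbasis, and \<open>R\<^sub>c\<^sub>l\<close> is bounded by exponential stability. Boundedness of \<open>B\<close> needs Dirac functionals
  to lie in \<open>D(A)'\<close>: instead of Sobolev embedding and elliptic regularity we use that \<open>A\<^sub>c\<^sub>l z \<in> D(A)'\<close> for
  every \<open>z \<in> L\<^sup>2\<close>, applied to \<open>z = A \<psi>\<close> with a bump function \<open>\<psi>\<close> singling out one of the points.\<close>

section \<open>The space \<open>L\<^sup>2\<close>\<close>

text \<open>Two features of the encoding shape the work. Membership in \<open>Xsp\<close> already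
  contains a bound by the norm of \<open>Aop \<Omega> \<kappa> v\<close>, so placing a functional in
  that space is the same as proving it bounded; linear combinations of members known from the
  generator can therefore take the place of analytic estimates. On the other hand
  \<open>weak_partial\<close>, \<open>Ainv\<close> and \<open>pt_value\<close> are selected by
  \<open>SOME\<close> or \<open>THE\<close>, and each must be pinned down before use: weak
  derivatives by testing against bumps, \<open>Ainv\<close> by density of the range of
  \<open>Aop\<close> on eigenfunction sums, point values by continuity. A value of
  \<open>pt_value\<close> is accessible only where a continuous representative is at hand; test
  functions carry one by construction, and this is why the Dirac functionals are reached through
  them. The same density identifies \<open>Xnorm\<close> with the dual norm, so each estimate in the
  dual space can be made at one element of the domain at a time; for \<open>Rcl\<close> it becomes
  an estimate of a scalar integral.\<close>

lemma L2_measurable [measurable_dest]: "f \<in> L2 \<Omega> \<Longrightarrow> f \<in> borel_measurable (lebesgue_on \<Omega>)"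
  by (simp add: L2_def)

lemma L2_square_integrable: "f \<in> L2 \<Omega> \<Longrightarrow> integrable (lebesgue_on \<Omega>) (\<lambda>x. (f x)\<^sup>2)"
  by (simp add: L2_def)

lemma L2_mult_integrable:
  assumes f: "f \<in> L2 \<Omega>" and g: "g \<in> L2 \<Omega>"
  shows "integrable (lebesgue_on \<Omega>) (\<lambda>x. f x * g x)"
proof (rule Bochner_Integration.integrable_bound)
  show "integrable (lebesgue_on \<Omega>) (\<lambda>x. (f x)\<^sup>2 + (g x)\<^sup>2)"
    using f g by (intro Bochner_Integration.integrable_add L2_square_integrable)
  show "(\<lambda>x. f x * g x) \<in> borel_measurable (lebesgue_on \<Omega>)"
    using L2_measurable[OF f] L2_measurable[OF g] by measurable
  have "\<bar>a * b\<bar> \<le> a\<^sup>2 + b\<^sup>2" for a b :: real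
    using sum_squares_bound[of "\<bar>a\<bar>" "\<bar>b\<bar>"] by (auto simp: abs_mult intro: order_trans[OF _ sum_squares_bound[of "\<bar>a\<bar>" "\<bar>b\<bar>", simplified]])
  then show "AE x in lebesgue_on \<Omega>. norm (f x * g x) \<le> norm ((f x)\<^sup>2 + (g x)\<^sup>2)"
    by simp
qed

lemma L2_lincomb:
  assumes f: "f \<in> L2 \<Omega>" and g: "g \<in> L2 \<Omega>"
  shows "(\<lambda>x. a * f x + b * g x) \<in> L2 \<Omega>"
proof -
  have m: "(\<lambda>x. a * f x + b * g x) \<in> borel_measurable (lebesgue_on \<Omega>)"
    using L2_measurable[OF f] L2_measurable[OF g] by measurable
  have "integrable (lebesgue_on \<Omega>) (\<lambda>x. a\<^sup>2 * (f x)\<^sup>2 + b\<^sup>2 * (g x)\<^sup>2 + 2 * a * b * (f x * g x))"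
    using f g by (intro Bochner_Integration.integrable_add integrable_mult_right L2_square_integrable L2_mult_integrable)
  moreover have "(\<lambda>x. a\<^sup>2 * (f x)\<^sup>2 + b\<^sup>2 * (g x)\<^sup>2 + 2 * a * b * (f x * g x)) = (\<lambda>x. (a * f x + b * g x)\<^sup>2)"
    by (auto simp: power2_eq_square algebra_simps)
  ultimately show ?thesis using m by (simp add: L2_def)
qed

lemma L2_zero [simp]: "(\<lambda>x. 0) \<in> L2 \<Omega>"
  by (simp add: L2_def)

lemma L2_add: "f \<in> L2 \<Omega> \<Longrightarrow> g \<in> L2 \<Omega> \<Longrightarrow> (\<lambda>x. f x + g x) \<in> L2 \<Omega>"
  using L2_lincomb[of f \<Omega> g 1 1] by simp

lemma L2_diff: "f \<in> L2 \<Omega> \<Longrightarrow> g \<in> L2 \<Omega> \<Longrightarrow> (\<lambda>x. f x - g x) \<in> L2 \<Omega>"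
  using L2_lincomb[of f \<Omega> g 1 "-1"] by simp

lemma L2_cmult: "f \<in> L2 \<Omega> \<Longrightarrow> (\<lambda>x. a * f x) \<in> L2 \<Omega>"
  using L2_lincomb[of f \<Omega> f a 0] by simp

lemma L2_sum: "(\<And>i. i \<in> I \<Longrightarrow> f i \<in> L2 \<Omega>) \<Longrightarrow> (\<lambda>x. \<Sum>i\<in>I. f i x) \<in> L2 \<Omega>"
  by (induction I rule: infinite_finite_induct) (auto intro: L2_add)

lemma L2_ip_commute: "L2_ip \<Omega> f g = L2_ip \<Omega> g f"
  by (simp add: L2_ip_def mult.commute)

lemma L2_ip_lincomb_left:
  assumes "f \<in> L2 \<Omega>" "g \<in> L2 \<Omega>" "h \<in> L2 \<Omega>"
  shows "L2_ip \<Omega> (\<lambda>x. a * f x + b * g x) h = a * L2_ip \<Omega> f h + b * L2_ip \<Omega> g h"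
proof -
  have "L2_ip \<Omega> (\<lambda>x. a * f x + b * g x) h
      = (LINT x|lebesgue_on \<Omega>. a * (f x * h x) + b * (g x * h x))"
    by (simp add: L2_ip_def algebra_simps)
  also have "\<dots> = a * L2_ip \<Omega> f h + b * L2_ip \<Omega> g h"
    using L2_mult_integrable[OF assms(1,3)] L2_mult_integrable[OF assms(2,3)]
    by (simp add: L2_ip_def)
  finally show ?thesis .
qed

lemma L2_ip_lincomb_right:
  assumes "f \<in> L2 \<Omega>" "g \<in> L2 \<Omega>" "h \<in> L2 \<Omega>"
  shows "L2_ip \<Omega> h (\<lambda>x. a * f x + b * g x) = a * L2_ip \<Omega> h f + b * L2_ip \<Omega> h g"
  using L2_ip_lincomb_left[OF assms] by (simp add: L2_ip_commute)

lemma L2_ip_sum_left: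
  assumes "\<And>i. i \<in> I \<Longrightarrow> f i \<in> L2 \<Omega>" "h \<in> L2 \<Omega>"
  shows "L2_ip \<Omega> (\<lambda>x. \<Sum>i\<in>I. c i * f i x) h = (\<Sum>i\<in>I. c i * L2_ip \<Omega> (f i) h)"
  using assms
proof (induction I rule: infinite_finite_induct)
  case (insert i I)
  have "L2_ip \<Omega> (\<lambda>x. \<Sum>i\<in>insert i I. c i * f i x) h
      = L2_ip \<Omega> (\<lambda>x. c i * f i x + 1 * (\<Sum>i\<in>I. c i * f i x)) h"
    using insert.hyps by simp
  also have "\<dots> = c i * L2_ip \<Omega> (f i) h + 1 * L2_ip \<Omega> (\<lambda>x. \<Sum>i\<in>I. c i * f i x) h"
    using insert by (intro L2_ip_lincomb_left L2_sum L2_cmult) auto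
  finally show ?case using insert by simp
qed (auto simp: L2_ip_def)

lemma L2_ip_sum_right:
  assumes "\<And>i. i \<in> I \<Longrightarrow> f i \<in> L2 \<Omega>" "h \<in> L2 \<Omega>"
  shows "L2_ip \<Omega> h (\<lambda>x. \<Sum>i\<in>I. c i * f i x) = (\<Sum>i\<in>I. c i * L2_ip \<Omega> h (f i))"
  using L2_ip_sum_left[OF assms, where c = c] by (simp add: L2_ip_commute)

lemma L2_ip_cong_AE:
  assumes "f \<in> L2 \<Omega>" "f' \<in> L2 \<Omega>" "g \<in> L2 \<Omega>" "g' \<in> L2 \<Omega>"
    and "AE x in lebesgue_on \<Omega>. f x = f' x" "AE x in lebesgue_on \<Omega>. g x = g' x"
  shows "L2_ip \<Omega> f g = L2_ip \<Omega> f' g'"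
  unfolding L2_ip_def
proof (rule integral_cong_AE)
  show "AE x in lebesgue_on \<Omega>. f x * g x = f' x * g' x"
    using assms(5,6) by eventually_elim simp
qed (use L2_mult_integrable assms in blast)+

lemma L2_ip_self_nonneg: "0 \<le> L2_ip \<Omega> f f"
  unfolding L2_ip_def by (intro integral_nonneg_AE) simp

lemma L2_norm_nonneg [simp]: "0 \<le> L2_norm \<Omega> f"
  by (simp add: L2_norm_def L2_ip_self_nonneg)

lemma L2_norm_power2: "(L2_norm \<Omega> f)\<^sup>2 = L2_ip \<Omega> f f"
  by (simp add: L2_norm_def L2_ip_self_nonneg)

lemma L2_norm_cong_AE:
  assumes "f \<in> L2 \<Omega>" "g \<in> L2 \<Omega>" "AE x in lebesgue_on \<Omega>. f x = g x"
  shows "L2_norm \<Omega> f = L2_norm \<Omega> g"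
  unfolding L2_norm_def using L2_ip_cong_AE[OF assms(1,2) assms(1,2) assms(3,3)] by simp

lemma L2_ip_self_lincomb:
  assumes f: "f \<in> L2 \<Omega>" and g: "g \<in> L2 \<Omega>"
  shows "L2_ip \<Omega> (\<lambda>x. a * f x + b * g x) (\<lambda>x. a * f x + b * g x)
    = a\<^sup>2 * L2_ip \<Omega> f f + 2 * a * b * L2_ip \<Omega> f g + b\<^sup>2 * L2_ip \<Omega> g g"
proof -
  note l = L2_lincomb[OF f g, of a b]
  show ?thesis
    unfolding L2_ip_lincomb_left[OF f g l] L2_ip_lincomb_right[OF f g f] L2_ip_lincomb_right[OF f g g]
    by (simp add: L2_ip_commute[of \<Omega> g f] power2_eq_square algebra_simps)
qed

text \<open>The squared norm of \<open>a * f + b * g\<close> is a nonnegative quadratic form in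
  \<open>a\<close> and \<open>b\<close>; suitable values of \<open>a\<close> and \<open>b\<close>
  give the discriminant inequality.\<close>

lemma L2_Cauchy_Schwarz:
  assumes f: "f \<in> L2 \<Omega>" and g: "g \<in> L2 \<Omega>"
  shows "\<bar>L2_ip \<Omega> f g\<bar> \<le> L2_norm \<Omega> f * L2_norm \<Omega> g"
proof -
  define A B C where "A = L2_ip \<Omega> f f" and "B = L2_ip \<Omega> g g" and "C = L2_ip \<Omega> f g"
  have AB: "A \<ge> 0" "B \<ge> 0" by (simp_all add: A_def B_def L2_ip_self_nonneg)
  have q: "0 \<le> a\<^sup>2 * A + 2 * a * b * C + b\<^sup>2 * B" for a b
    using L2_ip_self_nonneg[of \<Omega> "\<lambda>x. a * f x + b * g x"] L2_ip_self_lincomb[OF f g, of a b]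
    by (simp add: A_def B_def C_def)
  have "C\<^sup>2 \<le> A * B"
  proof (cases "B = 0")
    case True
    have "C = 0"
    proof (rule ccontr)
      assume "C \<noteq> 0"
      \<comment> \<open>With \<open>B = 0\<close> the form is affine in \<open>b\<close>; this
        \<open>b\<close>, taken with \<open>a = 1\<close>, makes it equal to
        \<open>-1\<close>.\<close>
      then have "2 * (- (A + 1) / (2 * C)) * C = - (A + 1)" by simp
      with q[of 1 "- (A + 1) / (2 * C)"] True show False by simp
    qed
    with True show ?thesis by simp
  next
    case False
    with AB have "B > 0" by simp
    \<comment> \<open>The choice \<open>a = B\<close>, \<open>b = - C\<close> turns the form into
      exactly this product.\<close>
    have "0 \<le> B * (A * B - C\<^sup>2)"
      using q[of B "- C"] by (simp add: power2_eq_square algebra_simps)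
    with \<open>B > 0\<close> show ?thesis by (simp add: zero_le_mult_iff)
  qed
  then have "sqrt (C\<^sup>2) \<le> sqrt (A * B)" by (rule real_sqrt_le_mono)
  then show ?thesis by (simp add: A_def B_def C_def L2_norm_def real_sqrt_mult)
qed

lemma L2_norm_cmult: "L2_norm \<Omega> (\<lambda>x. a * f x) = \<bar>a\<bar> * L2_norm \<Omega> f"
proof -
  have "L2_ip \<Omega> (\<lambda>x. a * f x) (\<lambda>x. a * f x) = a\<^sup>2 * L2_ip \<Omega> f f"
    unfolding L2_ip_def by (subst integral_mult_right_zero[symmetric])
      (simp add: power2_eq_square algebra_simps)
  then show ?thesis by (simp add: L2_norm_def real_sqrt_mult)
qed

lemma L2_norm_triangle:
  assumes f: "f \<in> L2 \<Omega>" and g: "g \<in> L2 \<Omega>"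
  shows "L2_norm \<Omega> (\<lambda>x. f x + g x) \<le> L2_norm \<Omega> f + L2_norm \<Omega> g"
proof (rule power2_le_imp_le)
  have "(L2_norm \<Omega> (\<lambda>x. f x + g x))\<^sup>2 = L2_ip \<Omega> f f + 2 * L2_ip \<Omega> f g + L2_ip \<Omega> g g"
    using L2_ip_self_lincomb[OF f g, of 1 1] by (simp add: L2_norm_power2)
  also have "\<dots> \<le> (L2_norm \<Omega> f)\<^sup>2 + 2 * (L2_norm \<Omega> f * L2_norm \<Omega> g) + (L2_norm \<Omega> g)\<^sup>2"
    using L2_Cauchy_Schwarz[OF f g] by (simp add: L2_norm_power2)
  finally show "(L2_norm \<Omega> (\<lambda>x. f x + g x))\<^sup>2 \<le> (L2_norm \<Omega> f + L2_norm \<Omega> g)\<^sup>2"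
    by (simp add: power2_sum)
qed simp

lemma L2_norm_lincomb_le:
  assumes "f \<in> L2 \<Omega>" "g \<in> L2 \<Omega>"
  shows "L2_norm \<Omega> (\<lambda>x. a * f x + b * g x) \<le> \<bar>a\<bar> * L2_norm \<Omega> f + \<bar>b\<bar> * L2_norm \<Omega> g"
  using L2_norm_triangle[OF L2_cmult[OF assms(1), of a] L2_cmult[OF assms(2), of b]]
  by (simp add: L2_norm_cmult)

lemma L2_norm_eq_0_AE:
  assumes f: "f \<in> L2 \<Omega>" and 0: "L2_norm \<Omega> f = 0"
  shows "AE x in lebesgue_on \<Omega>. f x = 0"
proof -
  have "(LINT x|lebesgue_on \<Omega>. (f x)\<^sup>2) = 0"
    using 0 L2_norm_power2[of \<Omega> f] by (simp add: L2_ip_def power2_eq_square)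
  then have "AE x in lebesgue_on \<Omega>. (f x)\<^sup>2 = 0"
    using integral_nonneg_eq_0_iff_AE[OF L2_square_integrable[OF f]] by simp
  then show ?thesis by eventually_elim simp
qed

lemma nn_integral_L2_norm:
  assumes f: "f \<in> L2 \<Omega>"
  shows "(\<integral>\<^sup>+x. ennreal ((f x)\<^sup>2) \<partial>lebesgue_on \<Omega>) = ennreal ((L2_norm \<Omega> f)\<^sup>2)"
  using nn_integral_eq_integral[OF L2_square_integrable[OF f]]
  by (simp add: L2_norm_power2) (simp add: L2_ip_def power2_eq_square)

lemma L2_I_nn_integral:
  assumes "f \<in> borel_measurable (lebesgue_on \<Omega>)" "(\<integral>\<^sup>+x. ennreal ((f x)\<^sup>2) \<partial>lebesgue_on \<Omega>) < \<infinity>"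
  shows "f \<in> L2 \<Omega>"
proof -
  have "(\<lambda>x. (f x)\<^sup>2) \<in> borel_measurable (lebesgue_on \<Omega>)"
    using assms(1) by measurable
  then have "integrable (lebesgue_on \<Omega>) (\<lambda>x. (f x)\<^sup>2)"
    using assms(2) by (intro integrableI_nonneg) auto
  then show ?thesis using assms(1) by (simp add: L2_def)
qed

lemma finite_measure_lebesgue_on_bounded_open:
  assumes "open \<Omega>" "bounded \<Omega>"
  shows "finite_measure (lebesgue_on (\<Omega> :: pt set))"
  using assms by (intro finite_measure_lebesgue_on bounded_set_imp_lmeasurable) (auto simp: borel_open)

lemma L2_imp_integrable:
  assumes fin: "finite_measure (lebesgue_on \<Omega>)" and f: "f \<in> L2 \<Omega>"
  shows "integrable (lebesgue_on \<Omega>) f"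
proof -
  interpret finite_measure "lebesgue_on \<Omega>" by fact
  have "(\<lambda>x. 1) \<in> L2 \<Omega>" by (simp add: L2_def)
  from L2_mult_integrable[OF f this] show ?thesis by simp
qed

lemma L2_norm_one_bound:
  assumes fin: "finite_measure (lebesgue_on \<Omega>)" and f: "f \<in> L2 \<Omega>"
  shows "(LINT x|lebesgue_on \<Omega>. \<bar>f x\<bar>) \<le> L2_norm \<Omega> (\<lambda>x. 1) * L2_norm \<Omega> f"
proof -
  interpret finite_measure "lebesgue_on \<Omega>" by fact
  have 1: "(\<lambda>x. 1) \<in> L2 \<Omega>" by (simp add: L2_def)
  have a: "(\<lambda>x. \<bar>f x\<bar>) \<in> L2 \<Omega>"
    using f by (auto simp: L2_def)
  have "L2_norm \<Omega> (\<lambda>x. \<bar>f x\<bar>) = L2_norm \<Omega> f"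
    by (simp add: L2_norm_def L2_ip_def)
  then show ?thesis using L2_Cauchy_Schwarz[OF 1 a] by (simp add: L2_ip_def)
qed

text \<open>Riesz-Fischer on the level of representatives. Finiteness of the measure turns the fast
  decay of successive differences in L2 into summability in L1, so a subsequence converges almost
  everywhere; Fatou's lemma then carries the Cauchy estimate of the full sequence over to the
  limit.\<close>

lemma L2_complete:
  assumes fin: "finite_measure (lebesgue_on \<Omega>)" and u: "\<And>n::nat. u n \<in> L2 \<Omega>"
    and Cauchy: "\<And>e. e > 0 \<Longrightarrow> \<exists>n0. \<forall>m\<ge>n0. \<forall>n\<ge>n0. L2_norm \<Omega> (\<lambda>x. u m x - u n x) < e"
  shows "\<exists>h\<in>L2 \<Omega>. (\<lambda>n. L2_norm \<Omega> (\<lambda>x. u n x - h x)) \<longlonglongrightarrow> 0"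
proof -
  interpret finite_measure "lebesgue_on \<Omega>" by fact
  let ?M = "lebesgue_on \<Omega>"
  have um: "u n \<in> borel_measurable ?M" for n by (rule L2_measurable[OF u])
  obtain N where N: "\<And>j m n. m \<ge> N j \<Longrightarrow> n \<ge> N j \<Longrightarrow> L2_norm \<Omega> (\<lambda>x. u m x - u n x) < (1/2) ^ j"
    using Cauchy[of "(1/2) ^ j" for j] by (metis zero_less_divide_1_iff zero_less_numeral zero_less_power)
  \<comment> \<open>Adding up all thresholds gives indices beyond both \<open>N j\<close> and
    \<open>N (j - 1)\<close> without assuming \<open>N\<close> monotone; the summand
    \<open>j\<close> makes the indices tend to infinity, as the Fatou step requires.\<close>
  define r where "r j = (\<Sum>i\<le>j. N i) + j" for j
  have rN: "r j \<ge> N j" for j unfolding r_def by (simp add: trans_le_add1 member_le_sum)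
  have rj: "r j \<ge> j" for j by (simp add: r_def)
  have rSuc: "r (Suc j) \<ge> N j" for j
    using rN[of j] by (simp add: r_def)
  define d where "d j x = u (r (Suc j)) x - u (r j) x" for j x
  have dL: "d j \<in> L2 \<Omega>" for j unfolding d_def by (intro L2_diff u)
  have dm [measurable]: "d j \<in> borel_measurable ?M" for j by (rule L2_measurable[OF dL])
  define K where "K = L2_norm \<Omega> (\<lambda>x. 1)"
  have K: "K \<ge> 0" by (simp add: K_def)
  have d1: "(\<integral>\<^sup>+x. ennreal \<bar>d j x\<bar> \<partial>?M) \<le> ennreal (K * (1/2) ^ j)" for j
  proof -
    have "(\<integral>\<^sup>+x. ennreal \<bar>d j x\<bar> \<partial>?M) = ennreal (LINT x|?M. \<bar>d j x\<bar>)"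
      by (intro nn_integral_eq_integral integrable_abs L2_imp_integrable[OF fin dL]) simp
    also have "\<dots> \<le> ennreal (K * (1/2) ^ j)"
    proof (rule ennreal_leI)
      have "L2_norm \<Omega> (d j) \<le> (1/2) ^ j"
        using N[OF rSuc rN, of j] unfolding d_def by simp
      then have "K * L2_norm \<Omega> (d j) \<le> K * (1/2) ^ j" using K by (intro mult_left_mono)
      then show "(LINT x|?M. \<bar>d j x\<bar>) \<le> K * (1/2) ^ j"
        using L2_norm_one_bound[OF fin dL, of j] by (simp add: K_def)
    qed
    finally show ?thesis .
  qed
  have "(\<integral>\<^sup>+x. (\<Sum>j. ennreal \<bar>d j x\<bar>) \<partial>?M) = (\<Sum>j. \<integral>\<^sup>+x. ennreal \<bar>d j x\<bar> \<partial>?M)"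
    by (intro nn_integral_suminf) measurable
  also have "\<dots> \<le> (\<Sum>j. ennreal (K * (1/2) ^ j))"
    by (intro suminf_le d1) auto
  also have "\<dots> < \<infinity>"
  proof -
    have "summable (\<lambda>j. K * (1/2) ^ j)" by (intro summable_mult summable_geometric) simp
    then show ?thesis using K by (subst suminf_ennreal2) auto
  qed
  finally have "(\<integral>\<^sup>+x. (\<Sum>j. ennreal \<bar>d j x\<bar>) \<partial>?M) \<noteq> \<infinity>" by simp
  then have "AE x in ?M. (\<Sum>j. ennreal \<bar>d j x\<bar>) \<noteq> \<infinity>"
    by (intro nn_integral_PInf_AE) measurable
  then have conv: "AE x in ?M. convergent (\<lambda>j. u (r j) x)"
  proof eventually_elim
    case (elim x)
    have "summable (\<lambda>j. \<bar>d j x\<bar>)"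
      by (rule summable_suminf_not_top) (use elim in auto)
    then have "summable (\<lambda>j. d j x)" by (rule summable_rabs_cancel)
    then have "convergent (\<lambda>n. \<Sum>j<n. d j x)" by (simp add: summable_iff_convergent)
    moreover have "(\<Sum>j<n. d j x) = u (r n) x - u (r 0) x" for n
      unfolding d_def by (rule sum_lessThan_telescope)
    ultimately have "convergent (\<lambda>n. u (r n) x - u (r 0) x)" by simp
    then have "convergent (\<lambda>n. (u (r n) x - u (r 0) x) + u (r 0) x)"
      by (intro convergent_add convergent_const)
    then show ?case by simp
  qed
  define h where "h x = lim (\<lambda>j. u (r j) x)" for x
  have hm: "h \<in> borel_measurable ?M"
    unfolding h_def using um by (intro borel_measurable_lim_metric)
  have tend: "AE x in ?M. (\<lambda>j. u (r j) x) \<longlonglongrightarrow> h x"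
    using conv by eventually_elim (simp add: h_def convergent_LIMSEQ_iff)
  have fatou: "(\<integral>\<^sup>+x. ennreal ((u n x - h x)\<^sup>2) \<partial>?M) \<le> ennreal (((1/2) ^ k)\<^sup>2)" if n: "n \<ge> N k" for n k
  proof -
    have "(\<integral>\<^sup>+x. ennreal ((u n x - h x)\<^sup>2) \<partial>?M)
        = (\<integral>\<^sup>+x. liminf (\<lambda>j. ennreal ((u n x - u (r j) x)\<^sup>2)) \<partial>?M)"
    proof (rule nn_integral_cong_AE, use tend in eventually_elim)
      case (elim x)
      then have "(\<lambda>j. ennreal ((u n x - u (r j) x)\<^sup>2)) \<longlonglongrightarrow> ennreal ((u n x - h x)\<^sup>2)"
        by (intro tendsto_intros)
      from lim_imp_Liminf[OF _ this] show ?case by simp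
    qed
    also have "\<dots> \<le> liminf (\<lambda>j. \<integral>\<^sup>+x. ennreal ((u n x - u (r j) x)\<^sup>2) \<partial>?M)"
      using um by (intro nn_integral_liminf) measurable
    also have "\<dots> \<le> liminf (\<lambda>j. ennreal (((1/2) ^ k)\<^sup>2))"
    proof (rule Liminf_mono, rule eventually_sequentiallyI[of "N k"])
      fix j assume "j \<ge> N k"
      then have j: "r j \<ge> N k" using rj[of j] by linarith
      show "(\<integral>\<^sup>+x. ennreal ((u n x - u (r j) x)\<^sup>2) \<partial>?M) \<le> ennreal (((1/2) ^ k)\<^sup>2)"
        unfolding nn_integral_L2_norm[OF L2_diff[OF u u]]
        using N[OF n j] by (intro ennreal_leI power_mono) auto
    qed
    also have "\<dots> = ennreal (((1/2) ^ k)\<^sup>2)" by (simp add: Liminf_const)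
    finally show ?thesis .
  qed
  have dh: "(\<lambda>x. u n x - h x) \<in> L2 \<Omega>" if n: "n \<ge> N k" for n k
  proof (rule L2_I_nn_integral)
    show "(\<lambda>x. u n x - h x) \<in> borel_measurable ?M" using um hm by measurable
    show "(\<integral>\<^sup>+x. ennreal ((u n x - h x)\<^sup>2) \<partial>?M) < \<infinity>"
      using fatou[OF n] by (auto intro: le_less_trans)
  qed
  \<comment> \<open>\<open>h\<close> is \<open>u (N 0)\<close> minus the difference
    \<open>u (N 0) - h\<close>, and both are square integrable.\<close>
  have "h \<in> L2 \<Omega>"
    using L2_diff[OF u[of "N 0"] dh[of 0 "N 0"]] by simp
  moreover have "(\<lambda>n. L2_norm \<Omega> (\<lambda>x. u n x - h x)) \<longlonglongrightarrow> 0"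
  proof (rule LIMSEQ_I)
    fix e :: real assume "e > 0"
    then obtain k where k: "(1/2) ^ k < e"
      using real_arch_pow_inv[of e "1/2"] by auto
    have "L2_norm \<Omega> (\<lambda>x. u n x - h x) < e" if n: "n \<ge> N k" for n
    proof -
      have "ennreal ((L2_norm \<Omega> (\<lambda>x. u n x - h x))\<^sup>2) \<le> ennreal (((1/2) ^ k)\<^sup>2)"
        using fatou[OF n] nn_integral_L2_norm[OF dh[OF n]] by simp
      then have "(L2_norm \<Omega> (\<lambda>x. u n x - h x))\<^sup>2 \<le> ((1/2) ^ k)\<^sup>2" by simp
      then have "L2_norm \<Omega> (\<lambda>x. u n x - h x) \<le> (1/2) ^ k" by (rule power2_le_imp_le) simp
      with k show ?thesis by simp
    qed
    then show "\<exists>no. \<forall>n\<ge>no. norm (L2_norm \<Omega> (\<lambda>x. u n x - h x) - 0) < e" by auto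
  qed
  ultimately show ?thesis by blast
qed

section \<open>Test functions\<close>

text \<open>With \<open>s = 1 / x\<close>, the derivative in \<open>x\<close> of
  \<open>p(s) * exp (- s)\<close> is \<open>s * s * (p(s) - p'(s)) * exp (- s)\<close>; the
  recursion records this polynomial factor.\<close>

primrec flat_poly :: "nat \<Rightarrow> real poly" where
  "flat_poly 0 = 1"
| "flat_poly (Suc n) = [:0, 0, 1:] * (flat_poly n - pderiv (flat_poly n))"

text \<open>The \<open>n\<close>-th derivative of the flat function \<open>exp (- 1 / x)\<close>.\<close>

definition flat :: "nat \<Rightarrow> real \<Rightarrow> real" where
  "flat n x = (if x > 0 then poly (flat_poly n) (inverse x) * exp (- inverse x) else 0)"

lemma poly_div_exp_tendsto_0: "((\<lambda>x. poly p x / exp x) \<longlongrightarrow> (0::real)) at_top"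
proof -
  have "((\<lambda>x. \<Sum>i\<le>degree p. coeff p i * (x ^ i / exp x)) \<longlongrightarrow> (\<Sum>i\<le>degree p. coeff p i * 0)) at_top"
    by (intro tendsto_intros tendsto_power_div_exp_0)
  then show ?thesis by (simp add: poly_altdef sum_divide_distrib)
qed

lemma flat_has_derivative: "(flat n has_real_derivative flat (Suc n) x) (at x)"
proof -
  consider "x > 0" | "x < 0" | "x = 0" by linarith
  then show ?thesis
  proof cases
    case 1
    have "((\<lambda>x. poly (flat_poly n) (inverse x) * exp (- inverse x)) has_real_derivative flat (Suc n) x) (at x)"
      using 1 by (auto intro!: derivative_eq_intros simp: flat_def field_simps power2_eq_square)
    then show ?thesis
      by (rule has_field_derivative_transform_within_open[where S = "{0<..}"])
        (use 1 in \<open>auto simp: flat_def\<close>)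
  next
    case 2
    have "((\<lambda>x. 0) has_real_derivative flat (Suc n) x) (at x)"
      using 2 by (simp add: flat_def)
    then show ?thesis
      by (rule has_field_derivative_transform_within_open[where S = "{..<0}"])
        (use 2 in \<open>auto simp: flat_def\<close>)
  next
    case 3
    \<comment> \<open>At the origin the difference quotient contributes one more factor
      \<open>inverse y\<close>; \<open>pCons 0\<close> multiplies the polynomial by it, and the
      exponential still wins.\<close>
    have "((\<lambda>y. poly (pCons 0 (flat_poly n)) (inverse y) / exp (inverse y)) \<longlongrightarrow> 0) (at_right 0)"
      by (rule filterlim_compose[OF poly_div_exp_tendsto_0 filterlim_inverse_at_top_right])
    then have "((\<lambda>y. flat n y / y) \<longlongrightarrow> 0) (at_right 0)"
      by (rule Lim_transform_eventually)
        (auto simp: eventually_at_right_field flat_def exp_minus field_simps intro!: exI[of _ 1])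
    moreover have "((\<lambda>y. flat n y / y) \<longlongrightarrow> 0) (at_left 0)"
      by (rule tendsto_eventually) (auto simp: eventually_at_left_field flat_def intro!: exI[of _ "-1"])
    ultimately have "((\<lambda>y. flat n y / y) \<longlongrightarrow> 0) (at 0)"
      by (simp add: filterlim_split_at)
    then show ?thesis using 3 by (simp add: has_field_derivative_iff flat_def)
  qed
qed

text \<open>The algebra generated by all derivatives of \<open>exp (- 1 / x)\<close> in affinely rescaled
  coordinates is closed under partial derivatives; hence its members are smooth.\<close>

inductive flat_algebra :: "fn \<Rightarrow> bool" where
  base: "flat_algebra (\<lambda>x. flat n (c * x $ i + d))"
| const: "flat_algebra (\<lambda>x. c)"
| add: "flat_algebra f \<Longrightarrow> flat_algebra g \<Longrightarrow> flat_algebra (\<lambda>x. f x + g x)"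
| mult: "flat_algebra f \<Longrightarrow> flat_algebra g \<Longrightarrow> flat_algebra (\<lambda>x. f x * g x)"

lemma partial_eqI: "(f has_derivative D) (at x) \<Longrightarrow> partial i f x = D (axis i 1)"
  unfolding partial_def by (metis frechet_derivative_at)

lemma flat_algebra_partial:
  assumes "flat_algebra f"
  shows "(\<forall>x. f differentiable (at x)) \<and> (\<forall>i. flat_algebra (partial i f))"
  using assms
proof induction
  case (base n c i d)
  have D: "((\<lambda>x. flat n (c * x $ i + d)) has_derivative
      (\<lambda>h. flat (Suc n) (c * x $ i + d) * (c * h $ i))) (at x)" for x :: pt
  proof -
    have "((\<lambda>x. c * x $ i + d) has_derivative (\<lambda>h. c * h $ i)) (at x)"
      by (auto intro!: derivative_eq_intros bounded_linear_imp_has_derivative)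
    from has_derivative_compose[OF this] flat_has_derivative[of n "c * x $ i + d"]
    show ?thesis unfolding has_field_derivative_def by blast
  qed
  have "flat_algebra (partial j (\<lambda>x. flat n (c * x $ i + d)))" for j
  proof -
    have "partial j (\<lambda>x. flat n (c * x $ i + d)) = (\<lambda>x. (c * axis j 1 $ i) * flat (Suc n) (c * x $ i + d))"
      by (rule ext) (simp add: partial_eqI[OF D])
    then show ?thesis by (auto intro!: flat_algebra.intros)
  qed
  with D show ?case by (auto simp: differentiable_def)
next
  case (const c)
  have "partial i (\<lambda>x. c) = (\<lambda>x. 0)" for i
    by (rule ext) (simp add: partial_def)
  then show ?case by (auto intro!: flat_algebra.const)
next
  case (add f g)
  have D: "(f has_derivative frechet_derivative f (at x)) (at x)"
    "(g has_derivative frechet_derivative g (at x)) (at x)" for x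
    using add by (auto simp: frechet_derivative_works)
  have "partial i (\<lambda>x. f x + g x) = (\<lambda>x. partial i f x + partial i g x)" for i
    by (rule ext, subst partial_eqI[OF has_derivative_add[OF D]]) (simp add: partial_def)
  then show ?case using add by (auto intro!: flat_algebra.add)
next
  case (mult f g)
  have D: "(f has_derivative frechet_derivative f (at x)) (at x)"
    "(g has_derivative frechet_derivative g (at x)) (at x)" for x
    using mult by (auto simp: frechet_derivative_works)
  have "partial i (\<lambda>x. f x * g x) = (\<lambda>x. f x * partial i g x + partial i f x * g x)" for i
    by (rule ext, subst partial_eqI[OF has_derivative_mult[OF D]]) (simp add: partial_def)
  then show ?case using mult by (auto intro!: flat_algebra.add flat_algebra.mult)
qed

lemma flat_algebra_Ck: "flat_algebra f \<Longrightarrow> Ck k UNIV f"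
proof (induction k arbitrary: f)
  case 0
  then have "\<forall>x. f differentiable (at x)" using flat_algebra_partial by blast
  then show ?case
    by (auto simp: continuous_on_eq_continuous_at intro!: differentiable_imp_continuous_within)
next
  case (Suc k)
  then show ?case using flat_algebra_partial by auto
qed

text \<open>Each coordinate contributes one flat function switching on at \<open>a\<close> and one
  switching off at \<open>b\<close>. The parameter \<open>c\<close> is the steepness, sent to
  infinity later. The arguments have the affine form that \<open>flat_algebra.base\<close> expects,
  so smoothness comes from the algebra.\<close>

definition box_bump :: "real \<Rightarrow> pt \<Rightarrow> pt \<Rightarrow> fn" where
  "box_bump c a b x = (\<Prod>i\<in>UNIV. flat 0 (c * x $ i + - (c * a $ i)) * flat 0 (- c * x $ i + c * b $ i))"

lemma flat_algebra_prod:
  "(\<And>i. i \<in> I \<Longrightarrow> flat_algebra (f i)) \<Longrightarrow> flat_algebra (\<lambda>x. \<Prod>i\<in>I. f i x)"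
  by (induction I rule: infinite_finite_induct) (auto intro: flat_algebra.intros)

lemma flat_0_bounds: "0 \<le> flat 0 x" "flat 0 x \<le> 1"
  by (auto simp: flat_def)

lemma box_bump_bounds: "0 \<le> box_bump c a b x" "box_bump c a b x \<le> 1"
  unfolding box_bump_def by (auto intro!: prod_nonneg prod_le_1 mult_le_one simp: flat_0_bounds)

lemma box_bump_nonzero:
  assumes "c > 0"
  shows "box_bump c a b x \<noteq> 0 \<longleftrightarrow> x \<in> box a b"
proof -
  have "c * y + - (c * z) > 0 \<longleftrightarrow> y > z" "- c * y + c * z > 0 \<longleftrightarrow> y < z" for y z
    using assms by (auto simp: mult_less_cancel_left_pos)
  then show ?thesis
    using assms by (auto simp: box_bump_def mem_box_cart flat_def)
qed

lemma test_function_box_bump: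
  assumes "c > 0" "cbox a b \<subseteq> \<Omega>"
  shows "test_function \<Omega> (box_bump c a b)"
proof -
  have "flat_algebra (box_bump c a b)"
    unfolding box_bump_def[abs_def] by (intro flat_algebra_prod flat_algebra.mult flat_algebra.base)
  moreover have "closure {x. box_bump c a b x \<noteq> 0} \<subseteq> cbox a b"
    using box_bump_nonzero[OF assms(1), of a b] box_subset_cbox[of a b]
    by (intro closure_minimal) auto
  ultimately show ?thesis
    using assms(2) bounded_subset[OF bounded_cbox[of a b]]
    by (auto simp: test_function_def flat_algebra_Ck compact_eq_bounded_closed)
qed

lemma flat_0_scaled_tendsto:
  assumes "y > 0"
  shows "(\<lambda>n. flat 0 (real (Suc n) * y)) \<longlonglongrightarrow> 1"
proof -
  have "(\<lambda>n. exp (- (inverse (real (Suc n)) * inverse y))) \<longlonglongrightarrow> exp (- (0 * inverse y))"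
    by (intro tendsto_intros LIMSEQ_inverse_real_of_nat)
  moreover have "flat 0 (real (Suc n) * y) = exp (- (inverse (real (Suc n)) * inverse y))" for n
    using assms by (simp add: flat_def zero_less_mult_iff)
  ultimately show ?thesis by simp
qed

text \<open>This takes the role of mollification: together with the bound by 1, it lets identities
  tested on smooth functions pass to indicators of boxes by dominated convergence.\<close>

lemma box_bump_tendsto_indicator: "(\<lambda>n. box_bump (real (Suc n)) a b x) \<longlonglongrightarrow> indicator (box a b) x"
proof (cases "x \<in> box a b")
  case True
  then have i: "a $ i < x $ i" "x $ i < b $ i" for i by (auto simp: mem_box_cart)
  have "(\<lambda>n. \<Prod>i\<in>UNIV. flat 0 (real (Suc n) * (x $ i - a $ i)) * flat 0 (real (Suc n) * (b $ i - x $ i)))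
      \<longlonglongrightarrow> (\<Prod>i\<in>(UNIV::3 set). 1 * 1)"
    by (intro tendsto_prod tendsto_mult flat_0_scaled_tendsto) (simp_all add: i)
  then show ?thesis using True by (simp add: box_bump_def algebra_simps)
next
  case False
  then have "box_bump (real (Suc n)) a b x = 0" for n
    using box_bump_nonzero[of "real (Suc n)" a b x] by auto
  then show ?thesis using False by simp
qed

section \<open>The fundamental lemma of the calculus of variations\<close>

text \<open>Boxes form an intersection-stable generator of the Borel sets, so vanishing integrals
  spread to all Borel sets by a Dynkin argument, and from there to Lebesgue sets up to null
  sets.\<close>

lemma lebesgue_integral_zero_on_boxes:
  fixes F :: fn
  assumes F: "integrable lebesgue F" and supp: "\<And>x. x \<notin> box a b \<Longrightarrow> F x = 0"
    and box: "\<And>c d. (LINT x|lebesgue. indicator (box c d) x * F x) = 0"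
  shows "AE x in lebesgue. F x = 0"
proof -
  have int: "integrable lebesgue (\<lambda>x. indicator A x * F x)" if "A \<in> sets lebesgue" for A
    using integrable_real_mult_indicator[OF that F] by (simp add: mult.commute)
  \<comment> \<open>Complements in the Dynkin argument require the integral over the whole space;
    the support condition makes it an integral over one box.\<close>
  have whole: "(LINT x|lebesgue. F x) = 0"
  proof -
    have "(\<lambda>x. indicator (box a b) x * F x) = F"
      using supp by (auto simp: indicator_def fun_eq_iff)
    then show ?thesis using box[of a b] by simp
  qed
  have stable: "Int_stable (range (\<lambda>(a, b). box a b::pt set))"
    by (auto simp: Int_stable_def box_Int_box)
  have borel_sets: "sigma_sets UNIV (range (\<lambda>(a, b). box a b::pt set)) = sets borel"
    by (simp add: borel_eq_box)
  have borel: "(LINT x|lebesgue. indicator A x * F x) = 0" if "A \<in> sets borel" for A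
  proof -
    have pow: "range (\<lambda>(a, b). box a b) \<subseteq> Pow (UNIV :: pt set)" by simp
    have "A \<in> sigma_sets UNIV (range (\<lambda>(a, b). box a b))"
      using that by (simp add: borel_sets)
    with stable pow show ?thesis
    proof (induction rule: sigma_sets_induct_disjoint)
      case (compl A)
      then have A: "A \<in> sets lebesgue" by (simp add: borel_sets)
      have "(\<lambda>x. indicator (UNIV - A) x * F x) = (\<lambda>x. F x - indicator A x * F x)"
        by (auto simp: indicator_def)
      then show ?case using compl int[OF A] F whole by simp
    next
      case (union A)
      then have A: "A i \<in> sets lebesgue" for i using borel_sets by auto
      have "(LINT x:(\<Union>i. A i)|lebesgue. F x) = (\<Sum>i. (LINT x:A i|lebesgue. F x))"
        using A union(1) int[of "\<Union>i. A i"]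
        by (intro lebesgue_integral_countable_add) (auto simp: disjoint_family_on_def set_integrable_def)
      then show ?case using union by (simp add: set_lebesgue_integral_def)
    qed (use box in auto)
  qed
  show ?thesis
  proof (rule density_unique_real[OF F, of "\<lambda>x. 0"])
    \<comment> \<open>A Lebesgue set is a Borel set plus a subset of a Borel null set, so its
      integral equals that over the Borel part \<open>S\<close>.\<close>
    fix A :: "pt set" assume A: "A \<in> sets lebesgue"
    then obtain S N N' where S: "A = S \<union> N" "N \<subseteq> N'" "N' \<in> null_sets lborel" "S \<in> sets lborel"
      by (rule sets_completionE)
    have "AE x in lebesgue. x \<notin> N'"
      using S(3) by (intro AE_not_in null_sets_completionI)
    then have "AE x in lebesgue. indicator A x * F x = indicator S x * F x"
      by eventually_elim (use S in \<open>auto simp: indicator_def\<close>)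
    then have "(LINT x|lebesgue. indicator A x * F x) = (LINT x|lebesgue. indicator S x * F x)"
      using int[OF A] int[of S] S(4) by (intro integral_cong_AE) auto
    then show "(LINT x:A|lebesgue. F x) = (LINT x:A|lebesgue. 0)"
      using borel[of S] S(4) by (simp add: set_lebesgue_integral_def)
  qed simp
qed

lemma fundamental_lemma_box:
  assumes \<Omega>: "open \<Omega>" and g: "integrable (lebesgue_on \<Omega>) g"
    and test: "\<And>\<psi>. test_function \<Omega> \<psi> \<Longrightarrow> L2_ip \<Omega> g \<psi> = 0"
    and ab: "cbox a b \<subseteq> \<Omega>"
  shows "(LINT x|lebesgue_on \<Omega>. indicator (box a b) x * g x) = 0"
proof -
  have lim: "(\<lambda>n. LINT x|lebesgue_on \<Omega>. box_bump (real (Suc n)) a b x * g x)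
      \<longlonglongrightarrow> (LINT x|lebesgue_on \<Omega>. indicator (box a b) x * g x)"
  proof (rule integral_dominated_convergence[where w = "\<lambda>x. \<bar>g x\<bar>"])
    have gm: "g \<in> borel_measurable (lebesgue_on \<Omega>)" using g by simp
    have "indicator (box a b) \<in> borel_measurable (lebesgue_on \<Omega>)"
      by (intro measurable_restrict_space1 borel_measurable_indicator) simp
    with gm show "(\<lambda>x. indicator (box a b) x * g x) \<in> borel_measurable (lebesgue_on \<Omega>)"
      by measurable
    show "(\<lambda>x. box_bump (real (Suc n)) a b x * g x) \<in> borel_measurable (lebesgue_on \<Omega>)" for n
    proof -
      have "flat_algebra (box_bump (real (Suc n)) a b)"
        unfolding box_bump_def[abs_def] by (intro flat_algebra_prod flat_algebra.mult flat_algebra.base)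
      from flat_algebra_Ck[OF this, of 0]
      have "box_bump (real (Suc n)) a b \<in> borel_measurable borel"
        by (auto intro: borel_measurable_continuous_onI)
      then have "box_bump (real (Suc n)) a b \<in> borel_measurable (lebesgue_on \<Omega>)"
        by (intro measurable_restrict_space1 measurable_completion) simp
      with gm show ?thesis by measurable
    qed
    show "AE x in lebesgue_on \<Omega>. (\<lambda>n. box_bump (real (Suc n)) a b x * g x) \<longlonglongrightarrow> indicator (box a b) x * g x"
      by (intro AE_I2 tendsto_mult_right box_bump_tendsto_indicator)
    show "AE x in lebesgue_on \<Omega>. norm (box_bump (real (Suc n)) a b x * g x) \<le> \<bar>g x\<bar>" for n
      using box_bump_bounds by (auto simp: abs_mult intro!: mult_left_le_one_le)
  qed (use g in auto)
  have "(LINT x|lebesgue_on \<Omega>. box_bump (real (Suc n)) a b x * g x) = 0" for n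
    using test[OF test_function_box_bump[OF _ ab], of "real (Suc n)"]
    by (simp add: L2_ip_def mult.commute)
  then show ?thesis using LIMSEQ_unique[OF lim] by simp
qed

text \<open>After extension by zero the claim is local: on a box whose closure lies in the domain,
  intersections with other boxes are again such boxes, where bumps are admissible tests.\<close>

lemma fundamental_lemma:
  assumes \<Omega>: "open \<Omega>" and g: "integrable (lebesgue_on \<Omega>) g"
    and test: "\<And>\<psi>. test_function \<Omega> \<psi> \<Longrightarrow> L2_ip \<Omega> g \<psi> = 0"
  shows "AE x in lebesgue_on \<Omega>. g x = 0"
proof -
  have \<Omega>m: "\<Omega> \<in> sets lebesgue" using \<Omega> by simp
  define G where "G x = indicator \<Omega> x * g x" for x
  have G: "integrable lebesgue G"
    using g \<Omega>m by (simp add: G_def[abs_def] integrable_restrict_space)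
  have G_eq: "(LINT x|lebesgue. indicator A x * G x) = (LINT x|lebesgue_on \<Omega>. indicator A x * g x)" for A
    using \<Omega>m by (simp add: G_def integral_restrict_space algebra_simps)
  have box: "AE x in lebesgue. x \<in> box a b \<longrightarrow> G x = 0" if ab: "cbox a b \<subseteq> \<Omega>" for a b
  proof -
    have "AE x in lebesgue. indicator (box a b) x * G x = 0"
    proof (rule lebesgue_integral_zero_on_boxes)
      show "integrable lebesgue (\<lambda>x. indicator (box a b) x * G x)"
        using integrable_real_mult_indicator[OF _ G, of "box a b"] by (simp add: mult.commute)
      fix c d :: pt
      define p q :: pt where "p = (\<chi> i. max (c $ i) (a $ i))" and "q = (\<chi> i. min (d $ i) (b $ i))"
      have pq: "box c d \<inter> box a b = box p q"
        by (auto simp: p_def q_def mem_box_cart)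
      have "cbox p q \<subseteq> \<Omega>"
        using ab by (auto simp: p_def q_def mem_box_cart)
      then have "(LINT x|lebesgue. indicator (box p q) x * G x) = 0"
        unfolding G_eq by (intro fundamental_lemma_box[OF \<Omega> g test]) auto
      then show "(LINT x|lebesgue. indicator (box c d) x * (indicator (box a b) x * G x)) = 0"
        by (simp add: indicator_inter_arith mult.assoc flip: pq)
    qed (auto simp: indicator_def)
    then show ?thesis by eventually_elim (auto simp: indicator_def)
  qed
  define \<F> where "\<F> = {box a b | a b :: pt. cbox a b \<subseteq> \<Omega>}"
  have "\<Union>\<F> = \<Omega>"
  proof
    show "\<Union>\<F> \<subseteq> \<Omega>" using box_subset_cbox by (auto simp: \<F>_def)
    show "\<Omega> \<subseteq> \<Union>\<F>"
    proof
      fix x assume "x \<in> \<Omega>"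
      with \<Omega> obtain a b where "cbox a b \<subseteq> \<Omega>" "x \<in> box a b"
        by (meson open_contains_cbox)
      then show "x \<in> \<Union>\<F>" by (auto simp: \<F>_def)
    qed
  qed
  \<comment> \<open>Countability matters here: the exceptional null sets of the single boxes must
    have a null union.\<close>
  moreover obtain \<F>' where "\<F>' \<subseteq> \<F>" "countable \<F>'" "\<Union>\<F>' = \<Union>\<F>"
    using Lindelof[of \<F>] by (auto simp: \<F>_def)
  ultimately have \<F>': "\<F>' \<subseteq> \<F>" "countable \<F>'" "\<Union>\<F>' = \<Omega>" by auto
  have "AE x in lebesgue. \<forall>B\<in>\<F>'. x \<in> B \<longrightarrow> G x = 0"
    using \<F>' box by (subst AE_ball_countable) (auto simp: \<F>_def)
  then have "AE x in lebesgue. x \<in> \<Omega> \<longrightarrow> g x = 0"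
  proof eventually_elim
    case (elim x)
    show ?case
    proof
      assume x: "x \<in> \<Omega>"
      with elim \<F>'(3) have "G x = 0" by blast
      with x show "g x = 0" by (simp add: G_def)
    qed
  qed
  then show ?thesis using \<Omega>m by (simp add: AE_restrict_space_iff)
qed

section \<open>Weak derivatives and the Neumann domain\<close>

lemma test_function_partial:
  assumes "test_function \<Omega> \<psi>"
  shows "test_function \<Omega> (partial i \<psi>)"
proof -
  have "{x. partial i \<psi> x \<noteq> 0} \<subseteq> closure {x. \<psi> x \<noteq> 0}"
  proof
    fix x assume "x \<in> {x. partial i \<psi> x \<noteq> 0}"
    then have nz: "partial i \<psi> x \<noteq> 0" by simp
    show "x \<in> closure {x. \<psi> x \<noteq> 0}"
    proof (rule ccontr)
      assume x: "x \<notin> closure {x. \<psi> x \<noteq> 0}"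
      have "(\<psi> has_derivative (\<lambda>h. 0)) (at x)"
        by (rule has_derivative_transform_within_open[OF has_derivative_const[of 0],
              where s = "- closure {x. \<psi> x \<noteq> 0}"])
          (use x closure_subset[of "{x. \<psi> x \<noteq> 0}"] in auto)
      from partial_eqI[OF this] nz show False by simp
    qed
  qed
  then have "closure {x. partial i \<psi> x \<noteq> 0} \<subseteq> closure {x. \<psi> x \<noteq> 0}"
    by (intro closure_minimal) auto
  moreover have "Ck k UNIV (partial i \<psi>)" for k
  proof -
    have "Ck (Suc k) UNIV \<psi>" using assms unfolding test_function_def by blast
    then show ?thesis by simp
  qed
  moreover have "bounded (closure {x. \<psi> x \<noteq> 0})"
    using assms unfolding test_function_def compact_eq_bounded_closed by blast
  then have "bounded (closure {x. partial i \<psi> x \<noteq> 0})"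
    using calculation(1) by (rule bounded_subset)
  ultimately show ?thesis
    using assms unfolding test_function_def compact_eq_bounded_closed by blast
qed

lemma test_function_continuous: "test_function \<Omega> \<psi> \<Longrightarrow> continuous_on UNIV \<psi>"
  using Ck.simps(1)[of UNIV \<psi>] unfolding test_function_def by blast

lemma continuous_on_UNIV_imp_measurable_lebesgue_on:
  "continuous_on UNIV (f :: fn) \<Longrightarrow> f \<in> borel_measurable (lebesgue_on \<Omega>)"
  by (intro measurable_restrict_space1 measurable_completion) (simp add: borel_measurable_continuous_onI)

lemma test_function_bounded:
  assumes "test_function \<Omega> \<psi>"
  obtains C where "\<And>x. \<bar>\<psi> x\<bar> \<le> C"
proof -
  have "compact (\<psi> ` closure {x. \<psi> x \<noteq> 0})"
    using assms continuous_on_subset[OF test_function_continuous[OF assms] subset_UNIV]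
    by (intro compact_continuous_image) (simp_all add: test_function_def)
  then have "bounded (\<psi> ` closure {x. \<psi> x \<noteq> 0})" by (rule compact_imp_bounded)
  then obtain C where C: "\<And>x. x \<in> closure {x. \<psi> x \<noteq> 0} \<Longrightarrow> \<bar>\<psi> x\<bar> \<le> C"
    unfolding bounded_iff real_norm_def by blast
  have "\<bar>\<psi> x\<bar> \<le> max C 0" for x
    using C[of x] closure_subset[of "{x. \<psi> x \<noteq> 0}"] by (cases "\<psi> x = 0") auto
  with that show ?thesis by blast
qed

locale bounded_open =
  fixes \<Omega> :: "pt set"
  assumes open_domain: "open \<Omega>" and bounded_domain: "bounded \<Omega>"
begin

lemma finite_measure_domain: "finite_measure (lebesgue_on \<Omega>)"
  using open_domain bounded_domain by (rule finite_measure_lebesgue_on_bounded_open)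

lemma test_function_L2:
  assumes "test_function \<Omega> \<psi>"
  shows "\<psi> \<in> L2 \<Omega>"
proof -
  interpret finite_measure "lebesgue_on \<Omega>" by (rule finite_measure_domain)
  obtain C where C: "\<And>x. \<bar>\<psi> x\<bar> \<le> C" using test_function_bounded[OF assms] by blast
  have m: "\<psi> \<in> borel_measurable (lebesgue_on \<Omega>)"
    by (intro continuous_on_UNIV_imp_measurable_lebesgue_on test_function_continuous[OF assms])
  have "integrable (lebesgue_on \<Omega>) (\<lambda>x. (\<psi> x)\<^sup>2)"
  proof (rule Bochner_Integration.integrable_bound)
    show "integrable (lebesgue_on \<Omega>) (\<lambda>x. C\<^sup>2)" by simp
    show "AE x in lebesgue_on \<Omega>. norm ((\<psi> x)\<^sup>2) \<le> norm (C\<^sup>2)"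
      using order_trans[OF C abs_ge_self] by (simp add: abs_le_square_iff)
  qed (use m in measurable)
  with m show ?thesis by (simp add: L2_def)
qed

text \<open>Since \<open>weak_partial\<close> is an arbitrary choice, every computation with it
  rests on this uniqueness up to null sets.\<close>

lemma has_weak_partial_unique:
  assumes g: "has_weak_partial \<Omega> i u g" and g': "has_weak_partial \<Omega> i u g'"
  shows "AE x in lebesgue_on \<Omega>. g x = g' x"
proof -
  have L2: "g \<in> L2 \<Omega>" "g' \<in> L2 \<Omega>" using g g' by (auto simp: has_weak_partial_def)
  have "AE x in lebesgue_on \<Omega>. 1 * g x + (-1) * g' x = 0"
  proof (rule fundamental_lemma[OF open_domain])
    show "integrable (lebesgue_on \<Omega>) (\<lambda>x. 1 * g x + (-1) * g' x)"
      by (intro L2_imp_integrable finite_measure_domain L2_lincomb L2)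
    fix \<psi> assume \<psi>: "test_function \<Omega> \<psi>"
    show "L2_ip \<Omega> (\<lambda>x. 1 * g x + (-1) * g' x) \<psi> = 0"
      unfolding L2_ip_lincomb_left[OF L2 test_function_L2[OF \<psi>]]
      using g g' \<psi> by (simp add: has_weak_partial_def)
  qed
  then show ?thesis by eventually_elim simp
qed

lemma has_weak_partial_lincomb:
  assumes "has_weak_partial \<Omega> i u g" "has_weak_partial \<Omega> i w h"
  shows "has_weak_partial \<Omega> i (\<lambda>x. a * u x + b * w x) (\<lambda>x. a * g x + b * h x)"
  using assms test_function_L2 test_function_L2[OF test_function_partial]
  by (auto simp: has_weak_partial_def L2_lincomb L2_ip_lincomb_left)

lemma has_weak_partial_cong:
  assumes "u \<in> L2 \<Omega>" "u' \<in> L2 \<Omega>" "AE x in lebesgue_on \<Omega>. u x = u' x"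
  shows "has_weak_partial \<Omega> i u = has_weak_partial \<Omega> i u'"
proof -
  have "L2_ip \<Omega> u (partial i \<psi>) = L2_ip \<Omega> u' (partial i \<psi>)" if "test_function \<Omega> \<psi>" for \<psi>
    using test_function_L2[OF test_function_partial[OF that]] assms by (intro L2_ip_cong_AE) auto
  with assms(1,2) show ?thesis by (auto simp: has_weak_partial_def fun_eq_iff)
qed

text \<open>The predicates from which \<open>SOME\<close> selects coincide for the two functions, so
  the selected derivatives are the same function, not merely equal almost everywhere. This makes
  iterated weak derivatives manageable.\<close>

lemma weak_partial_cong:
  assumes "u \<in> L2 \<Omega>" "u' \<in> L2 \<Omega>" "AE x in lebesgue_on \<Omega>. u x = u' x"
  shows "weak_partial \<Omega> i u = weak_partial \<Omega> i u'"
  using has_weak_partial_cong[OF assms] by (simp add: weak_partial_def)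

lemma H1_cong:
  assumes "u \<in> H1 \<Omega>" "u' \<in> L2 \<Omega>" "AE x in lebesgue_on \<Omega>. u x = u' x"
  shows "u' \<in> H1 \<Omega>"
  using has_weak_partial_cong[OF _ assms(2,3)] assms(1,2) by (simp add: H1_def)

lemma has_weak_partial_weak_partial:
  "u \<in> H1 \<Omega> \<Longrightarrow> has_weak_partial \<Omega> i u (weak_partial \<Omega> i u)"
  unfolding weak_partial_def by (rule someI_ex[of "has_weak_partial \<Omega> i u"]) (simp add: H1_def)

lemma weak_partial_L2: "u \<in> H1 \<Omega> \<Longrightarrow> weak_partial \<Omega> i u \<in> L2 \<Omega>"
  using has_weak_partial_weak_partial by (auto simp: has_weak_partial_def)

lemma weak_partial_AE_eq:
  assumes "has_weak_partial \<Omega> i u g"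
  shows "AE x in lebesgue_on \<Omega>. weak_partial \<Omega> i u x = g x"
  using someI[of "has_weak_partial \<Omega> i u", OF assms] assms
  by (intro has_weak_partial_unique) (auto simp: weak_partial_def)

lemma H1_lincomb: "u \<in> H1 \<Omega> \<Longrightarrow> w \<in> H1 \<Omega> \<Longrightarrow> (\<lambda>x. a * u x + b * w x) \<in> H1 \<Omega>"
  using has_weak_partial_lincomb unfolding H1_def by (blast intro: L2_lincomb)

lemma weak_partial_lincomb:
  assumes "u \<in> H1 \<Omega>" "w \<in> H1 \<Omega>"
  shows "AE x in lebesgue_on \<Omega>. weak_partial \<Omega> i (\<lambda>x. a * u x + b * w x) x
    = a * weak_partial \<Omega> i u x + b * weak_partial \<Omega> i w x"
  by (intro weak_partial_AE_eq has_weak_partial_lincomb has_weak_partial_weak_partial assms)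

lemma H2_imp_H1: "u \<in> H2 \<Omega> \<Longrightarrow> u \<in> H1 \<Omega>" "u \<in> H2 \<Omega> \<Longrightarrow> weak_partial \<Omega> i u \<in> H1 \<Omega>"
  by (auto simp: H2_def)

lemma H1_imp_L2: "u \<in> H1 \<Omega> \<Longrightarrow> u \<in> L2 \<Omega>"
  by (auto simp: H1_def)

lemma weak_partial2_lincomb:
  assumes u: "u \<in> H2 \<Omega>" and w: "w \<in> H2 \<Omega>"
  shows "AE x in lebesgue_on \<Omega>. weak_partial \<Omega> i (weak_partial \<Omega> i (\<lambda>x. a * u x + b * w x)) x
    = a * weak_partial \<Omega> i (weak_partial \<Omega> i u) x + b * weak_partial \<Omega> i (weak_partial \<Omega> i w) x"
proof -
  note H1 = H2_imp_H1[OF u] H2_imp_H1[OF w]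
  \<comment> \<open>The inner derivative is linear only almost everywhere; under the outer
    \<open>weak_partial\<close> this becomes a genuine equality.\<close>
  have "weak_partial \<Omega> i (weak_partial \<Omega> i (\<lambda>x. a * u x + b * w x))
      = weak_partial \<Omega> i (\<lambda>x. a * weak_partial \<Omega> i u x + b * weak_partial \<Omega> i w x)"
    by (intro weak_partial_cong weak_partial_lincomb weak_partial_L2 L2_lincomb H1_lincomb H1)
  with weak_partial_lincomb[of "weak_partial \<Omega> i u" "weak_partial \<Omega> i w" i a b] H1 show ?thesis
    by simp
qed

lemma laplacian_L2: "u \<in> H2 \<Omega> \<Longrightarrow> laplacian \<Omega> u \<in> L2 \<Omega>"
  unfolding laplacian_def[abs_def] by (intro L2_sum weak_partial_L2 H2_imp_H1)

lemma laplacian_lincomb: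
  assumes u: "u \<in> H2 \<Omega>" and w: "w \<in> H2 \<Omega>"
  shows "AE x in lebesgue_on \<Omega>. laplacian \<Omega> (\<lambda>x. a * u x + b * w x) x
    = a * laplacian \<Omega> u x + b * laplacian \<Omega> w x"
proof -
  have "AE x in lebesgue_on \<Omega>. \<forall>i. weak_partial \<Omega> i (weak_partial \<Omega> i (\<lambda>x. a * u x + b * w x)) x
    = a * weak_partial \<Omega> i (weak_partial \<Omega> i u) x + b * weak_partial \<Omega> i (weak_partial \<Omega> i w) x"
    using weak_partial2_lincomb[OF assms] by (simp add: AE_all_countable)
  then show ?thesis
    by eventually_elim (simp add: laplacian_def sum.distrib sum_distrib_left)
qed

lemma neumann_dom_H2: "u \<in> neumann_dom \<Omega> \<Longrightarrow> u \<in> H2 \<Omega>"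
  by (simp add: neumann_dom_def)

lemma neumann_dom_L2: "u \<in> neumann_dom \<Omega> \<Longrightarrow> u \<in> L2 \<Omega>"
  by (simp add: neumann_dom_H2 H1_imp_L2 H2_imp_H1)

lemma A0_L2: "u \<in> neumann_dom \<Omega> \<Longrightarrow> A0 \<Omega> \<kappa> u \<in> L2 \<Omega>"
  unfolding A0_def by (intro L2_cmult laplacian_L2 neumann_dom_H2)

lemma Aop_L2: "u \<in> neumann_dom \<Omega> \<Longrightarrow> Aop \<Omega> \<kappa> u \<in> L2 \<Omega>"
  unfolding Aop_def by (intro L2_diff A0_L2 neumann_dom_L2)

lemma Aop_lincomb:
  assumes "u \<in> neumann_dom \<Omega>" "w \<in> neumann_dom \<Omega>"
  shows "AE x in lebesgue_on \<Omega>. Aop \<Omega> \<kappa> (\<lambda>x. a * u x + b * w x) x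
    = a * Aop \<Omega> \<kappa> u x + b * Aop \<Omega> \<kappa> w x"
  using laplacian_lincomb[OF neumann_dom_H2 neumann_dom_H2, OF assms, of a b]
  by eventually_elim (simp add: Aop_def A0_def algebra_simps)

text \<open>The boundary condition sees a function only through its weak derivatives, and these do
  not change with the representative.\<close>

lemma neumann_dom_cong:
  assumes "u \<in> neumann_dom \<Omega>" "u' \<in> L2 \<Omega>" "AE x in lebesgue_on \<Omega>. u x = u' x"
  shows "u' \<in> neumann_dom \<Omega>"
proof -
  have "weak_partial \<Omega> i u' = weak_partial \<Omega> i u" for i
    using weak_partial_cong[OF neumann_dom_L2 assms(2,3)] assms(1) by simp
  moreover have "u' \<in> H1 \<Omega>"
    using H1_cong[OF H2_imp_H1(1) assms(2,3)] neumann_dom_H2[OF assms(1)] by simp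
  ultimately show ?thesis
    using assms(1) by (simp add: neumann_dom_def H2_def neumann_bc_def)
qed

text \<open>The chosen weak derivative \<open>w i\<close> of zero need not be identically zero, only
  almost everywhere. Its trace is still zero, with the constant sequence zero as smooth
  approximation: the error \<open>0 - w i\<close> vanishes almost everywhere, so its chosen
  derivatives are again the functions \<open>w j\<close>, of norm 0.\<close>

lemma zero_neumann_dom: "(\<lambda>x. 0) \<in> neumann_dom \<Omega>"
proof -
  have hz: "has_weak_partial \<Omega> i (\<lambda>x. 0) (\<lambda>x. 0)" for i
    by (simp add: has_weak_partial_def L2_ip_def)
  then have z1: "(\<lambda>x. 0) \<in> H1 \<Omega>" by (auto simp: H1_def)
  define w where "w i = weak_partial \<Omega> i (\<lambda>x. 0)" for i
  have wL2: "w i \<in> L2 \<Omega>" for i unfolding w_def by (rule weak_partial_L2[OF z1])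
  have w0: "AE x in lebesgue_on \<Omega>. w i x = 0" for i
    unfolding w_def by (rule weak_partial_AE_eq[OF hz])
  have wH1: "w i \<in> H1 \<Omega>" for i
    using w0[of i] by (intro H1_cong[OF z1 wL2]) (auto elim: eventually_mono)
  have norm_w: "L2_norm \<Omega> (w i) = 0" for i
    using L2_norm_cong_AE[OF wL2 L2_zero w0, of i] by (simp add: L2_norm_def L2_ip_def)
  have "H1_norm \<Omega> (\<lambda>x. 0 - w i x) = 0" for i
  proof -
    have mw: "(\<lambda>x. 0 - w i x) \<in> L2 \<Omega>" by (intro L2_diff wL2) simp
    have mw0: "AE x in lebesgue_on \<Omega>. 0 - w i x = 0" using w0[of i] by eventually_elim simp
    have "L2_norm \<Omega> (\<lambda>x. 0 - w i x) = 0"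
      using L2_norm_cong_AE[OF mw L2_zero mw0] by (simp add: L2_norm_def L2_ip_def)
    moreover have "weak_partial \<Omega> j (\<lambda>x. 0 - w i x) = w j" for j
      unfolding w_def[of j] using weak_partial_cong[OF mw L2_zero mw0] .
    ultimately show ?thesis by (simp add: H1_norm_def norm_w)
  qed
  then have "has_trace \<Omega> (w i) (\<lambda>x. 0)" for i
    unfolding has_trace_def using wH1 flat_algebra_Ck[OF flat_algebra.const[of 0]] z1
    by (intro conjI exI[of _ "\<lambda>(n::nat) x. 0"]) simp_all
  then have "neumann_bc \<Omega> (\<lambda>x. 0)"
    unfolding neumann_bc_def w_def by (intro exI[of _ "\<lambda>i x. 0"]) simp
  then show ?thesis using z1 wH1 by (auto simp: neumann_dom_def H2_def w_def)
qed

text \<open>No boundary terms appear since \<open>\<psi>\<close> has compact support in \<open>\<Omega>\<close>.\<close>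

lemma test_function_laplacian_ip:
  assumes \<psi>: "test_function \<Omega> \<psi>" and v: "v \<in> H2 \<Omega>"
  shows "L2_ip \<Omega> \<psi> (laplacian \<Omega> v) = L2_ip \<Omega> (\<lambda>x. \<Sum>i\<in>UNIV. partial i (partial i \<psi>) x) v"
proof -
  have p: "test_function \<Omega> (partial i \<psi>)" "test_function \<Omega> (partial i (partial i \<psi>))" for i
    using \<psi> by (auto intro: test_function_partial)
  have eq: "L2_ip \<Omega> \<psi> (weak_partial \<Omega> i (weak_partial \<Omega> i v)) = L2_ip \<Omega> (partial i (partial i \<psi>)) v" for i
  proof -
    have "L2_ip \<Omega> (weak_partial \<Omega> i v) (partial i \<psi>)
        = - L2_ip \<Omega> (weak_partial \<Omega> i (weak_partial \<Omega> i v)) \<psi>"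
      using has_weak_partial_weak_partial[OF H2_imp_H1(2)[OF v], of i i] \<psi>
      unfolding has_weak_partial_def by blast
    moreover have "L2_ip \<Omega> v (partial i (partial i \<psi>)) = - L2_ip \<Omega> (weak_partial \<Omega> i v) (partial i \<psi>)"
      using has_weak_partial_weak_partial[OF H2_imp_H1(1)[OF v], of i] p(1)[of i]
      unfolding has_weak_partial_def by blast
    ultimately show ?thesis
      by (subst (1 2) L2_ip_commute) simp
  qed
  have "L2_ip \<Omega> \<psi> (laplacian \<Omega> v)
      = (\<Sum>i\<in>UNIV. 1 * L2_ip \<Omega> \<psi> (weak_partial \<Omega> i (weak_partial \<Omega> i v)))"
    using L2_ip_sum_right[of UNIV "\<lambda>i. weak_partial \<Omega> i (weak_partial \<Omega> i v)" \<Omega> \<psi> "\<lambda>_. 1"]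
      weak_partial_L2[OF H2_imp_H1(2)[OF v]] test_function_L2[OF \<psi>]
    by (simp add: laplacian_def[abs_def])
  also have "\<dots> = L2_ip \<Omega> (\<lambda>x. \<Sum>i\<in>UNIV. partial i (partial i \<psi>) x) v"
    using L2_ip_sum_left[of UNIV "\<lambda>i. partial i (partial i \<psi>)" \<Omega> v "\<lambda>_. 1"]
      test_function_L2[OF p(2)] H1_imp_L2[OF H2_imp_H1(1)[OF v]]
    by (simp add: eq)
  finally show ?thesis .
qed

end

section \<open>Representation of functionals on the Neumann domain\<close>

locale closed_loop = bounded_open +
  fixes \<kappa> lam :: real and ev :: "nat \<Rightarrow> real" and \<phi> :: "nat \<Rightarrow> fn"
    and xs :: "'m::finite \<Rightarrow> pt" and S :: "real \<Rightarrow> fnl \<Rightarrow> fnl"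
  assumes kappa_pos: "\<kappa> > 0" and lam_pos: "lam > 0"
    and eigenbasis: "neumann_eigenbasis \<Omega> ev \<phi>"
    and points: "\<And>j. xs j \<in> \<Omega>"
    and semigroup: "closed_loop_semigroup \<Omega> \<kappa> lam xs S"
begin

abbreviation "D \<equiv> neumann_dom \<Omega>"
abbreviation "A \<equiv> Aop \<Omega> \<kappa>"
abbreviation "X \<equiv> Xsp \<Omega> \<kappa>"
abbreviation "nrm \<equiv> Xnorm \<Omega> \<kappa>"

text \<open>The generator on \<open>D(A)'\<close> is assumed to be defined on all of \<open>L\<^sup>2\<close> and to take values in \<open>D(A)'\<close>.
  This supplies without regularity theory that \<open>D(A)\<close> is a subspace and (below) that point
  evaluations are bounded on \<open>D(A)\<close>.\<close>

lemma emb_Acl_in_X: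
  assumes "z \<in> L2 \<Omega>"
  shows "emb \<Omega> z \<in> X" "Acl \<Omega> \<kappa> lam xs z \<in> X"
proof -
  have "(emb \<Omega> z, Acl \<Omega> \<kappa> lam xs z) \<in> generator X nrm S"
    using semigroup assms unfolding closed_loop_semigroup_def by blast
  then show "emb \<Omega> z \<in> X" "Acl \<Omega> \<kappa> lam xs z \<in> X" by (auto simp: generator_def)
qed

lemma X_outside: "\<eta> \<in> X \<Longrightarrow> v \<notin> D \<Longrightarrow> \<eta> v = 0"
  by (simp add: Xsp_def)

lemma X_lincomb: "\<eta> \<in> X \<Longrightarrow> v \<in> D \<Longrightarrow> w \<in> D \<Longrightarrow> \<eta> (\<lambda>x. a * v x + b * w x) = a * \<eta> v + b * \<eta> w"
  unfolding Xsp_def by blast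

text \<open>Members of \<open>X\<close> are linear on combinations of domain elements whether or not
  the combination is in \<open>D\<close>, yet vanish outside \<open>D\<close>. If \<open>?u\<close>
  were outside, applying \<open>emb \<Omega> ?u\<close> to \<open>?u\<close> itself would give both
  the squared norm of \<open>?u\<close> and 0; then \<open>?u\<close> is zero almost everywhere and
  lies in \<open>D\<close> after all.\<close>

lemma neumann_dom_lincomb:
  assumes v: "v \<in> D" and w: "w \<in> D"
  shows "(\<lambda>x. a * v x + b * w x) \<in> D"
proof (rule ccontr)
  let ?u = "\<lambda>x. a * v x + b * w x"
  assume u: "?u \<notin> D"
  note L = neumann_dom_L2[OF v] neumann_dom_L2[OF w]
  have uL: "?u \<in> L2 \<Omega>" using L by (rule L2_lincomb)
  have "L2_ip \<Omega> ?u ?u = a * L2_ip \<Omega> ?u v + b * L2_ip \<Omega> ?u w"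
    by (rule L2_ip_lincomb_right[OF L uL])
  also have "\<dots> = emb \<Omega> ?u ?u"
    using X_lincomb[OF emb_Acl_in_X(1)[OF uL] v w, of a b] v w by (simp add: emb_def)
  also have "\<dots> = 0" using u by (simp add: emb_def)
  finally have "AE x in lebesgue_on \<Omega>. ?u x = 0"
    by (intro L2_norm_eq_0_AE uL) (simp add: L2_norm_def)
  then have "?u \<in> D"
    by (intro neumann_dom_cong[OF zero_neumann_dom uL]) (auto elim: eventually_mono)
  with u show False by blast
qed

lemma neumann_dom_sum:
  assumes "\<And>i. i \<in> I \<Longrightarrow> f i \<in> D"
  shows "(\<lambda>x. \<Sum>i\<in>I. c i * f i x) \<in> D"
  using assms
proof (induction I rule: infinite_finite_induct)
  case (insert i I)
  then show ?case using neumann_dom_lincomb[of "f i" "\<lambda>x. \<Sum>i\<in>I. c i * f i x" "c i" 1] by simp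
qed (simp_all add: zero_neumann_dom)

lemma X_sum:
  assumes "\<eta> \<in> X" "\<And>i. i \<in> I \<Longrightarrow> f i \<in> D"
  shows "\<eta> (\<lambda>x. \<Sum>i\<in>I. c i * f i x) = (\<Sum>i\<in>I. c i * \<eta> (f i))"
  using assms(2)
proof (induction I rule: infinite_finite_induct)
  case (insert i I)
  then show ?case
    using X_lincomb[OF assms(1), of "f i" "\<lambda>x. \<Sum>i\<in>I. c i * f i x" "c i" 1] neumann_dom_sum[of I f c] by simp
qed (use X_lincomb[OF assms(1) zero_neumann_dom zero_neumann_dom, of 0 0] in simp_all)

lemma Aop_sum:
  assumes "\<And>i. i \<in> I \<Longrightarrow> f i \<in> D"
  shows "AE x in lebesgue_on \<Omega>. A (\<lambda>x. \<Sum>i\<in>I. c i * f i x) x = (\<Sum>i\<in>I. c i * A (f i) x)"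
  using assms
proof (induction I rule: infinite_finite_induct)
  case (insert i I)
  have "AE x in lebesgue_on \<Omega>. A (\<lambda>x. c i * f i x + 1 * (\<Sum>i\<in>I. c i * f i x)) x
      = c i * A (f i) x + 1 * A (\<lambda>x. \<Sum>i\<in>I. c i * f i x) x"
    using insert by (intro Aop_lincomb neumann_dom_sum) auto
  moreover have "AE x in lebesgue_on \<Omega>. A (\<lambda>x. \<Sum>i\<in>I. c i * f i x) x = (\<Sum>i\<in>I. c i * A (f i) x)"
    using insert by blast
  ultimately show ?case
    by eventually_elim (use insert.hyps in simp)
qed (use Aop_lincomb[OF zero_neumann_dom zero_neumann_dom, of \<kappa> 0 0] in simp_all)

section \<open>Spectral expansions and the representation theorem\<close>

text \<open>The eigenvalue of \<open>A\<close> belonging to \<open>\<phi> k\<close>.\<close>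

definition \<mu> :: "nat \<Rightarrow> real" where "\<mu> k = 1 + \<kappa> * ev k"

lemma mu_pos:
  assumes "k \<ge> 1"
  shows "\<mu> k > 0"
proof -
  have "ev k \<ge> 0" using assms
  proof (induction k rule: dec_induct)
    case (step k)
    then show ?case using eigenbasis unfolding neumann_eigenbasis_def by (meson order_trans)
  qed (use eigenbasis in \<open>simp add: neumann_eigenbasis_def\<close>)
  with kappa_pos show ?thesis by (simp add: \<mu>_def add_pos_nonneg)
qed

lemma phi_D: "k \<ge> 1 \<Longrightarrow> \<phi> k \<in> D"
  using eigenbasis unfolding neumann_eigenbasis_def by blast

lemma phi_L2: "k \<ge> 1 \<Longrightarrow> \<phi> k \<in> L2 \<Omega>"
  by (intro neumann_dom_L2 phi_D)

lemma phi_ortho: "k \<ge> 1 \<Longrightarrow> l \<ge> 1 \<Longrightarrow> L2_ip \<Omega> (\<phi> k) (\<phi> l) = (if k = l then 1 else 0)"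
  using eigenbasis unfolding neumann_eigenbasis_def by blast

lemma phi_complete:
  "f \<in> L2 \<Omega> \<Longrightarrow> (\<lambda>n. L2_norm \<Omega> (\<lambda>x. f x - (\<Sum>k=1..n. L2_ip \<Omega> f (\<phi> k) * \<phi> k x))) \<longlonglongrightarrow> 0"
  using eigenbasis unfolding neumann_eigenbasis_def by blast

lemma Aop_phi:
  assumes "k \<ge> 1"
  shows "AE x in lebesgue_on \<Omega>. A (\<phi> k) x = \<mu> k * \<phi> k x"
proof -
  have "AE x in lebesgue_on \<Omega>. - laplacian \<Omega> (\<phi> k) x = ev k * \<phi> k x"
    using eigenbasis assms unfolding neumann_eigenbasis_def by blast
  then show ?thesis
  proof eventually_elim
    case (elim x)
    then have "laplacian \<Omega> (\<phi> k) x = - (ev k * \<phi> k x)" by simp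
    then show ?case by (simp add: Aop_def A0_def \<mu>_def algebra_simps)
  qed
qed

lemma phi_sum_L2: "I \<subseteq> {1..} \<Longrightarrow> (\<lambda>x. \<Sum>k\<in>I. c k * \<phi> k x) \<in> L2 \<Omega>"
  by (intro L2_sum L2_cmult phi_L2) auto

lemma phi_sum_ip:
  assumes "finite I" "I \<subseteq> {1..}" "j \<ge> 1"
  shows "L2_ip \<Omega> (\<lambda>x. \<Sum>k\<in>I. c k * \<phi> k x) (\<phi> j) = (if j \<in> I then c j else 0)"
proof -
  have "L2_ip \<Omega> (\<lambda>x. \<Sum>k\<in>I. c k * \<phi> k x) (\<phi> j) = (\<Sum>k\<in>I. c k * L2_ip \<Omega> (\<phi> k) (\<phi> j))"
    using assms by (intro L2_ip_sum_left phi_L2) auto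
  also have "\<dots> = (\<Sum>k\<in>I. if k = j then c j else 0)"
    using assms by (intro sum.cong) (auto simp: phi_ortho)
  finally show ?thesis using assms(1) by simp
qed

lemma phi_sum_norm:
  assumes "finite I" "I \<subseteq> {1..}"
  shows "(L2_norm \<Omega> (\<lambda>x. \<Sum>k\<in>I. c k * \<phi> k x))\<^sup>2 = (\<Sum>k\<in>I. (c k)\<^sup>2)"
proof -
  have "(L2_norm \<Omega> (\<lambda>x. \<Sum>k\<in>I. c k * \<phi> k x))\<^sup>2
      = (\<Sum>j\<in>I. c j * L2_ip \<Omega> (\<lambda>x. \<Sum>k\<in>I. c k * \<phi> k x) (\<phi> j))"
    unfolding L2_norm_power2 using assms by (intro L2_ip_sum_right phi_L2 phi_sum_L2) auto
  also have "\<dots> = (\<Sum>k\<in>I. (c k)\<^sup>2)"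
    using assms by (intro sum.cong) (auto simp: phi_sum_ip[OF assms] power2_eq_square)
  finally show ?thesis .
qed

text \<open>The partial sums of the expansion of \<open>A\<^sup>-\<^sup>1 f\<close>.\<close>

definition resolvent_sum :: "fn \<Rightarrow> nat \<Rightarrow> fn" where
  "resolvent_sum f n = (\<lambda>x. \<Sum>k=1..n. (L2_ip \<Omega> f (\<phi> k) / \<mu> k) * \<phi> k x)"

lemma resolvent_sum_D: "resolvent_sum f n \<in> D"
  unfolding resolvent_sum_def by (intro neumann_dom_sum phi_D) simp

lemma Aop_phi_sum:
  assumes "finite I" "I \<subseteq> {1..}"
  shows "AE x in lebesgue_on \<Omega>. A (\<lambda>x. \<Sum>k\<in>I. c k / \<mu> k * \<phi> k x) x = (\<Sum>k\<in>I. c k * \<phi> k x)"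
proof -
  have "AE x in lebesgue_on \<Omega>. A (\<lambda>x. \<Sum>k\<in>I. c k / \<mu> k * \<phi> k x) x = (\<Sum>k\<in>I. c k / \<mu> k * A (\<phi> k) x)"
    using assms by (intro Aop_sum phi_D) auto
  moreover have "AE x in lebesgue_on \<Omega>. \<forall>k\<in>I. A (\<phi> k) x = \<mu> k * \<phi> k x"
    using assms Aop_phi by (intro AE_finite_allI) auto
  ultimately show ?thesis
  proof eventually_elim
    case (elim x)
    have "c k / \<mu> k * A (\<phi> k) x = c k * \<phi> k x" if "k \<in> I" for k
      using elim(2) that assms(2) mu_pos[of k] by auto
    with elim(1) show ?case by simp
  qed
qed

text \<open>Dividing the coefficients by \<open>\<mu> k\<close> is undone by \<open>A\<close>, so
  \<open>A (resolvent_sum f n)\<close> is the \<open>n\<close>-th Fourier sum of \<open>f\<close>.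
  Hence \<open>A\<close> maps \<open>D\<close> onto a dense subset of L2.\<close>

lemma Aop_resolvent_sum:
  assumes "f \<in> L2 \<Omega>"
  shows "(\<lambda>n. L2_norm \<Omega> (\<lambda>x. f x - A (resolvent_sum f n) x)) \<longlonglongrightarrow> 0"
proof -
  have "L2_norm \<Omega> (\<lambda>x. f x - (\<Sum>k=1..n. L2_ip \<Omega> f (\<phi> k) * \<phi> k x))
      = L2_norm \<Omega> (\<lambda>x. f x - A (resolvent_sum f n) x)" for n
  proof (rule L2_norm_cong_AE)
    have "AE x in lebesgue_on \<Omega>. A (resolvent_sum f n) x = (\<Sum>k=1..n. L2_ip \<Omega> f (\<phi> k) * \<phi> k x)"
      unfolding resolvent_sum_def by (rule Aop_phi_sum) auto
    then show "AE x in lebesgue_on \<Omega>. f x - (\<Sum>k=1..n. L2_ip \<Omega> f (\<phi> k) * \<phi> k x)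
        = f x - A (resolvent_sum f n) x"
      by eventually_elim simp
  qed (use assms in \<open>auto intro!: L2_diff phi_sum_L2 Aop_L2 resolvent_sum_D\<close>)
  with phi_complete[OF assms] show ?thesis by simp
qed

lemma L2_ip_tendsto:
  assumes "\<And>n. u n \<in> L2 \<Omega>" "f \<in> L2 \<Omega>" "g \<in> L2 \<Omega>"
    and lim: "(\<lambda>n. L2_norm \<Omega> (\<lambda>x. f x - u n x)) \<longlonglongrightarrow> 0"
  shows "(\<lambda>n. L2_ip \<Omega> g (u n)) \<longlonglongrightarrow> L2_ip \<Omega> g f"
proof (rule LIM_zero_cancel, rule Lim_null_comparison)
  show "\<forall>\<^sub>F n in sequentially. norm (L2_ip \<Omega> g (u n) - L2_ip \<Omega> g f)
      \<le> L2_norm \<Omega> g * L2_norm \<Omega> (\<lambda>x. f x - u n x)"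
  proof (rule always_eventually, rule allI)
    fix n
    have "L2_ip \<Omega> g (\<lambda>x. f x - u n x) = L2_ip \<Omega> g f - L2_ip \<Omega> g (u n)"
      using L2_ip_lincomb_right[OF assms(2) assms(1)[of n] assms(3), of 1 "-1"] by simp
    then show "norm (L2_ip \<Omega> g (u n) - L2_ip \<Omega> g f) \<le> L2_norm \<Omega> g * L2_norm \<Omega> (\<lambda>x. f x - u n x)"
      using L2_Cauchy_Schwarz[OF assms(3) L2_diff[OF assms(2) assms(1)], of n] by simp
  qed
  show "(\<lambda>n. L2_norm \<Omega> g * L2_norm \<Omega> (\<lambda>x. f x - u n x)) \<longlonglongrightarrow> 0"
    using tendsto_mult_left[OF lim, of "L2_norm \<Omega> g"] by simp
qed

lemma X_bound:
  assumes "\<eta> \<in> X"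
  obtains C where "C \<ge> 0" "\<And>v. v \<in> D \<Longrightarrow> \<bar>\<eta> v\<bar> \<le> C * L2_norm \<Omega> (A v)"
proof -
  obtain C where C: "\<And>v. v \<in> D \<Longrightarrow> \<bar>\<eta> v\<bar> \<le> C * L2_norm \<Omega> (A v)"
    using assms unfolding Xsp_def by blast
  have "\<bar>\<eta> v\<bar> \<le> \<bar>C\<bar> * L2_norm \<Omega> (A v)" if "v \<in> D" for v
    using C[OF that] mult_right_mono[OF abs_ge_self L2_norm_nonneg, of C \<Omega> "A v"] by linarith
  then show ?thesis using that[of "\<bar>C\<bar>"] by simp
qed

text \<open>A Bessel inequality obtained by testing \<open>\<eta>\<close> against the element
  \<open>w\<close> whose image under \<open>A\<close> has the coefficients in question: then
  \<open>\<eta> w\<close> is the sum of squares \<open>s\<close> and \<open>A w\<close> has norm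
  \<open>sqrt s\<close>, so boundedness of \<open>\<eta>\<close> reads
  \<open>s \<le> C * sqrt s\<close>.\<close>

lemma X_coeffs_bounded:
  assumes "\<eta> \<in> X"
  shows "\<exists>C. \<forall>n. (\<Sum>k=1..n. (\<eta> (\<phi> k) / \<mu> k)\<^sup>2) \<le> C"
proof -
  obtain C where C: "C \<ge> 0" "\<And>v. v \<in> D \<Longrightarrow> \<bar>\<eta> v\<bar> \<le> C * L2_norm \<Omega> (A v)"
    using X_bound[OF assms] by blast
  have "(\<Sum>k=1..n. (\<eta> (\<phi> k) / \<mu> k)\<^sup>2) \<le> C\<^sup>2" for n
  proof -
    define c where "c k = \<eta> (\<phi> k) / \<mu> k" for k
    define s where "s = (\<Sum>k=1..n. (c k)\<^sup>2)"
    define w where "w = (\<lambda>x. \<Sum>k=1..n. c k / \<mu> k * \<phi> k x)"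
    have s0: "s \<ge> 0" by (simp add: s_def sum_nonneg)
    have wD: "w \<in> D" unfolding w_def by (intro neumann_dom_sum phi_D) simp
    have "\<eta> w = (\<Sum>k=1..n. c k / \<mu> k * \<eta> (\<phi> k))"
      unfolding w_def by (intro X_sum assms phi_D) simp
    also have "\<dots> = s" by (simp add: s_def c_def power2_eq_square)
    finally have "\<eta> w = s" .
    moreover have "L2_norm \<Omega> (A w) = sqrt s"
    proof -
      have "L2_norm \<Omega> (A w) = L2_norm \<Omega> (\<lambda>x. \<Sum>k=1..n. c k * \<phi> k x)"
        unfolding w_def
        by (intro L2_norm_cong_AE Aop_phi_sum Aop_L2 phi_sum_L2 neumann_dom_sum phi_D) auto
      then show ?thesis
        using phi_sum_norm[of "{1..n}" c] by (auto simp: s_def intro!: real_sqrt_unique[symmetric])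
    qed
    ultimately have "s \<le> C * sqrt s" using C(2)[OF wD] s0 by simp
    moreover have "s = sqrt s * sqrt s" using s0 by simp
    ultimately have sq: "sqrt s * sqrt s \<le> C * sqrt s" by linarith
    have "sqrt s \<le> C"
    proof (cases "s = 0")
      case False
      then have "sqrt s > 0" using s0 by simp
      with sq show ?thesis by (rule mult_right_le_imp_le)
    qed (use C(1) in simp)
    then have "(sqrt s)\<^sup>2 \<le> C\<^sup>2" using s0 by (intro power_mono) auto
    then show ?thesis using s0 by (simp add: s_def c_def)
  qed
  then show ?thesis by blast
qed

text \<open>By orthonormality, squared distances of partial sums of the series are differences of
  partial sums of squares, which are increasing and bounded; completeness of L2 does the
  rest.\<close>

lemma phi_series_converges:
  assumes bd: "\<And>n. (\<Sum>k=1..n. (c k)\<^sup>2) \<le> C"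
  shows "\<exists>h\<in>L2 \<Omega>. (\<lambda>n. L2_norm \<Omega> (\<lambda>x. h x - (\<Sum>k=1..n. c k * \<phi> k x))) \<longlonglongrightarrow> 0"
proof -
  define s where "s n = (\<Sum>k=1..n. (c k)\<^sup>2)" for n
  define u where "u n = (\<lambda>x. \<Sum>k=1..n. c k * \<phi> k x)" for n :: nat
  have uL: "u n \<in> L2 \<Omega>" for n unfolding u_def by (rule phi_sum_L2) auto
  have "mono s" unfolding s_def by (intro monoI sum_mono2) auto
  moreover have "bdd_above (range s)" using bd by (auto simp: s_def bdd_above_def)
  ultimately have "Cauchy s"
    using LIMSEQ_incseq_SUP LIMSEQ_imp_Cauchy by blast
  have dist: "(L2_norm \<Omega> (\<lambda>x. u m x - u n x))\<^sup>2 = \<bar>s m - s n\<bar>" for m n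
  proof -
    have le: "(L2_norm \<Omega> (\<lambda>x. u m x - u n x))\<^sup>2 = s m - s n" if "n \<le> m" for m n
    proof -
      have split: "{1..m} = {1..n} \<union> {n<..m}" "{1..n} \<inter> {n<..m} = {}" using that by auto
      have "(\<lambda>x. u m x - u n x) = (\<lambda>x. \<Sum>k\<in>{n<..m}. c k * \<phi> k x)"
        unfolding u_def split(1) by (subst sum.union_disjoint) auto
      moreover have "s m - s n = (\<Sum>k\<in>{n<..m}. (c k)\<^sup>2)"
        unfolding s_def split(1) by (subst sum.union_disjoint) auto
      ultimately show ?thesis using phi_sum_norm[of "{n<..m}" c] by (simp add: subset_eq)
    qed
    have sym: "L2_norm \<Omega> (\<lambda>x. u m x - u n x) = L2_norm \<Omega> (\<lambda>x. u n x - u m x)"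
      using L2_norm_cmult[of \<Omega> "-1" "\<lambda>x. u n x - u m x"] by simp
    show ?thesis
    proof (cases "n \<le> m")
      case True
      then show ?thesis using le[OF True] monoD[OF \<open>mono s\<close> True] by simp
    next
      case False
      then have "m \<le> n" by simp
      then show ?thesis using le[of m n] monoD[OF \<open>mono s\<close>, of m n] sym by simp
    qed
  qed
  have "\<exists>h\<in>L2 \<Omega>. (\<lambda>n. L2_norm \<Omega> (\<lambda>x. u n x - h x)) \<longlonglongrightarrow> 0"
  proof (rule L2_complete[OF finite_measure_domain uL])
    fix e :: real assume e: "e > 0"
    then obtain n0 where n0: "\<And>m n. m \<ge> n0 \<Longrightarrow> n \<ge> n0 \<Longrightarrow> \<bar>s m - s n\<bar> < e\<^sup>2"
      using \<open>Cauchy s\<close> unfolding Cauchy_def dist_real_def by (meson zero_less_power)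
    have "L2_norm \<Omega> (\<lambda>x. u m x - u n x) < e" if "m \<ge> n0" "n \<ge> n0" for m n
      using n0[OF that] dist[of m n] e by (intro power2_less_imp_less[of _ e]) auto
    then show "\<exists>n0. \<forall>m\<ge>n0. \<forall>n\<ge>n0. L2_norm \<Omega> (\<lambda>x. u m x - u n x) < e" by blast
  qed
  moreover have "L2_norm \<Omega> (\<lambda>x. u n x - h x) = L2_norm \<Omega> (\<lambda>x. h x - u n x)" for h n
    using L2_norm_cmult[of \<Omega> "-1" "\<lambda>x. h x - u n x"] by simp
  ultimately show ?thesis by (simp add: u_def)
qed

text \<open>The candidate \<open>h\<close> has the coefficients
  \<open>\<eta> (\<phi> k) / \<mu> k\<close>. For a general \<open>v\<close> the identity is
  obtained on the resolvent sums \<open>w n\<close> of \<open>A v\<close>: their images under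
  \<open>A\<close> converge to \<open>A v\<close>, which is exactly the convergence that
  \<open>\<eta>\<close> respects. It also shows that the choice in \<open>Ainv\<close> is never void
  on \<open>X\<close>.\<close>

lemma X_Riesz:
  assumes \<eta>: "\<eta> \<in> X"
  shows "\<exists>h. h \<in> L2 \<Omega> \<and> (\<forall>v\<in>D. \<eta> v = L2_ip \<Omega> h (A v))"
proof -
  define c where "c k = \<eta> (\<phi> k) / \<mu> k" for k
  define u where "u n = (\<lambda>x. \<Sum>k=1..n. c k * \<phi> k x)" for n :: nat
  have uL: "u n \<in> L2 \<Omega>" for n unfolding u_def by (rule phi_sum_L2) auto
  obtain h where h: "h \<in> L2 \<Omega>" "(\<lambda>n. L2_norm \<Omega> (\<lambda>x. h x - u n x)) \<longlonglongrightarrow> 0"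
    using phi_series_converges[of c] X_coeffs_bounded[OF \<eta>] unfolding u_def c_def by blast
  obtain C where C: "C \<ge> 0" "\<And>v. v \<in> D \<Longrightarrow> \<bar>\<eta> v\<bar> \<le> C * L2_norm \<Omega> (A v)"
    using X_bound[OF \<eta>] by blast
  have "\<eta> v = L2_ip \<Omega> h (A v)" if v: "v \<in> D" for v
  proof -
    define w where "w = resolvent_sum (A v)"
    have wD: "w n \<in> D" for n unfolding w_def by (rule resolvent_sum_D)
    have Av: "A v \<in> L2 \<Omega>" using v by (rule Aop_L2)
    have "(\<lambda>n. \<eta> (w n)) \<longlonglongrightarrow> \<eta> v"
    proof (rule LIM_zero_cancel, rule Lim_null_comparison)
      show "(\<lambda>n. C * L2_norm \<Omega> (\<lambda>x. A v x - A (w n) x)) \<longlonglongrightarrow> 0"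
        using tendsto_mult_left[OF Aop_resolvent_sum[OF Av], of C] by (simp add: w_def)
      show "\<forall>\<^sub>F n in sequentially. norm (\<eta> (w n) - \<eta> v) \<le> C * L2_norm \<Omega> (\<lambda>x. A v x - A (w n) x)"
      proof (rule always_eventually, rule allI)
        fix n
        let ?d = "\<lambda>x. 1 * v x + (-1) * w n x"
        have "AE x in lebesgue_on \<Omega>. A ?d x = 1 * A v x + (-1) * A (w n) x"
          by (intro Aop_lincomb v wD)
        then have "L2_norm \<Omega> (A ?d) = L2_norm \<Omega> (\<lambda>x. 1 * A v x + (-1) * A (w n) x)"
          by (intro L2_norm_cong_AE Aop_L2 neumann_dom_lincomb L2_lincomb v wD)
        moreover have "\<eta> ?d = 1 * \<eta> v + (-1) * \<eta> (w n)" by (intro X_lincomb \<eta> v wD)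
        ultimately show "norm (\<eta> (w n) - \<eta> v) \<le> C * L2_norm \<Omega> (\<lambda>x. A v x - A (w n) x)"
          using C(2)[OF neumann_dom_lincomb[OF v wD], of 1 "-1" n] by simp
      qed
    qed
    \<comment> \<open>The weight \<open>1 / \<mu> k\<close> is moved from the coefficient of
      \<open>A v\<close> to that of \<open>\<eta>\<close>.\<close>
    moreover have "\<eta> (w n) = L2_ip \<Omega> (A v) (u n)" for n
    proof -
      have "\<eta> (w n) = (\<Sum>k=1..n. L2_ip \<Omega> (A v) (\<phi> k) / \<mu> k * \<eta> (\<phi> k))"
        unfolding w_def resolvent_sum_def by (intro X_sum \<eta> phi_D) simp
      also have "\<dots> = (\<Sum>k=1..n. c k * L2_ip \<Omega> (A v) (\<phi> k))"
        by (simp add: c_def mult.commute)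
      also have "\<dots> = L2_ip \<Omega> (A v) (u n)"
        unfolding u_def by (intro L2_ip_sum_right[symmetric] phi_L2 Av) simp
      finally show ?thesis .
    qed
    ultimately have "(\<lambda>n. L2_ip \<Omega> (A v) (u n)) \<longlonglongrightarrow> \<eta> v" by simp
    moreover have "(\<lambda>n. L2_ip \<Omega> (A v) (u n)) \<longlonglongrightarrow> L2_ip \<Omega> (A v) h"
      by (intro L2_ip_tendsto uL h Av)
    ultimately show ?thesis by (metis LIMSEQ_unique L2_ip_commute)
  qed
  with h(1) show ?thesis by blast
qed

lemma Ainv_spec:
  assumes "\<eta> \<in> X"
  shows "Ainv \<Omega> \<kappa> \<eta> \<in> L2 \<Omega>" "v \<in> D \<Longrightarrow> \<eta> v = L2_ip \<Omega> (Ainv \<Omega> \<kappa> \<eta>) (A v)"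
  using someI_ex[OF X_Riesz[OF assms]] unfolding Ainv_def by blast+

text \<open>Density of the range of \<open>A\<close> allows \<open>A v\<close> to approach
  \<open>h\<close> itself, and the hypothesis then bounds the squared norm of \<open>h\<close> by
  \<open>C\<close> times its norm.\<close>

lemma L2_norm_le_by_range:
  assumes h: "h \<in> L2 \<Omega>" and "C \<ge> 0" and C: "\<And>v. v \<in> D \<Longrightarrow> \<bar>L2_ip \<Omega> h (A v)\<bar> \<le> C * L2_norm \<Omega> (A v)"
  shows "L2_norm \<Omega> h \<le> C"
proof -
  define r where "r n = A (resolvent_sum h n)" for n
  have rL: "r n \<in> L2 \<Omega>" for n unfolding r_def by (intro Aop_L2 resolvent_sum_D)
  have lim: "(\<lambda>n. L2_norm \<Omega> (\<lambda>x. h x - r n x)) \<longlonglongrightarrow> 0"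
    unfolding r_def by (rule Aop_resolvent_sum[OF h])
  have "(\<lambda>n. L2_ip \<Omega> h (r n)) \<longlonglongrightarrow> L2_ip \<Omega> h h"
    by (rule L2_ip_tendsto[OF rL h h lim])
  moreover have "(\<lambda>n. C * (L2_norm \<Omega> h + L2_norm \<Omega> (\<lambda>x. h x - r n x))) \<longlonglongrightarrow> C * (L2_norm \<Omega> h + 0)"
    by (intro tendsto_intros lim)
  moreover have "L2_ip \<Omega> h (r n) \<le> C * (L2_norm \<Omega> h + L2_norm \<Omega> (\<lambda>x. h x - r n x))" for n
  proof -
    have "L2_norm \<Omega> (r n) \<le> L2_norm \<Omega> h + L2_norm \<Omega> (\<lambda>x. h x - r n x)"
      using L2_norm_lincomb_le[OF h L2_diff[OF h rL, of n], of 1 "-1"] by simp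
    then have "C * L2_norm \<Omega> (r n) \<le> C * (L2_norm \<Omega> h + L2_norm \<Omega> (\<lambda>x. h x - r n x))"
      using \<open>C \<ge> 0\<close> by (rule mult_left_mono)
    then show ?thesis using C[OF resolvent_sum_D[of h n]] unfolding r_def by linarith
  qed
  ultimately have "L2_ip \<Omega> h h \<le> C * (L2_norm \<Omega> h + 0)"
    by (intro LIMSEQ_le) auto
  then have "L2_norm \<Omega> h * L2_norm \<Omega> h \<le> C * L2_norm \<Omega> h"
    by (simp add: power2_eq_square flip: L2_norm_power2)
  then show ?thesis
    using \<open>C \<ge> 0\<close> L2_norm_nonneg[of \<Omega> h]
    by (cases "L2_norm \<Omega> h = 0") (auto simp: less_le intro: mult_right_le_imp_le)
qed

lemma Xnorm_nonneg [simp]: "nrm \<eta> \<ge> 0"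
  by (simp add: Xnorm_def)

lemma Xnorm_bound: "\<eta> \<in> X \<Longrightarrow> v \<in> D \<Longrightarrow> \<bar>\<eta> v\<bar> \<le> nrm \<eta> * L2_norm \<Omega> (A v)"
  using Ainv_spec(1)[of \<eta>] Ainv_spec(2)[of \<eta> v] L2_Cauchy_Schwarz[OF _ Aop_L2] by (simp add: Xnorm_def)

text \<open>Together with \<open>Xnorm_bound\<close> this identifies \<open>nrm\<close> as the norm
  dual to that of \<open>A v\<close>; later norm estimates use these two facts without returning to
  \<open>Ainv\<close>.\<close>

lemma Xnorm_least:
  assumes "\<eta> \<in> X" "C \<ge> 0" "\<And>v. v \<in> D \<Longrightarrow> \<bar>\<eta> v\<bar> \<le> C * L2_norm \<Omega> (A v)"
  shows "nrm \<eta> \<le> C"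
  unfolding Xnorm_def using assms Ainv_spec[OF assms(1)]
  by (intro L2_norm_le_by_range) auto

text \<open>The difference of two representing functions annihilates the range of \<open>A\<close>,
  so the density bound applies with constant 0. This allows \<open>Ainv\<close> to be evaluated
  where a preimage is known explicitly.\<close>

lemma Ainv_unique:
  assumes "\<eta> \<in> X" "h \<in> L2 \<Omega>" "\<And>v. v \<in> D \<Longrightarrow> \<eta> v = L2_ip \<Omega> h (A v)"
  shows "AE x in lebesgue_on \<Omega>. Ainv \<Omega> \<kappa> \<eta> x = h x"
proof -
  let ?d = "\<lambda>x. 1 * Ainv \<Omega> \<kappa> \<eta> x + (-1) * h x"
  note L = Ainv_spec(1)[OF assms(1)] assms(2)
  have d: "?d \<in> L2 \<Omega>" by (intro L2_lincomb L)
  have "L2_norm \<Omega> ?d \<le> 0"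
  proof (rule L2_norm_le_by_range[OF d])
    fix v assume v: "v \<in> D"
    then show "\<bar>L2_ip \<Omega> ?d (A v)\<bar> \<le> 0 * L2_norm \<Omega> (A v)"
      unfolding L2_ip_lincomb_left[OF L Aop_L2[OF v]]
      using assms(3)[OF v] Ainv_spec(2)[OF assms(1) v] by simp
  qed simp
  then have "L2_norm \<Omega> ?d = 0" using L2_norm_nonneg[of \<Omega> ?d] by linarith
  from L2_norm_eq_0_AE[OF d this] show ?thesis by eventually_elim simp
qed

lemma X_combine:
  assumes \<eta>: "\<eta> \<in> X" and \<zeta>: "\<zeta> \<in> X"
  shows "(\<lambda>v. a * \<eta> v + b * \<zeta> v) \<in> X"
    and "nrm (\<lambda>v. a * \<eta> v + b * \<zeta> v) \<le> \<bar>a\<bar> * nrm \<eta> + \<bar>b\<bar> * nrm \<zeta>"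
proof -
  have bd: "\<bar>a * \<eta> v + b * \<zeta> v\<bar> \<le> (\<bar>a\<bar> * nrm \<eta> + \<bar>b\<bar> * nrm \<zeta>) * L2_norm \<Omega> (A v)" if v: "v \<in> D" for v
  proof -
    have "\<bar>a * \<eta> v + b * \<zeta> v\<bar> \<le> \<bar>a\<bar> * \<bar>\<eta> v\<bar> + \<bar>b\<bar> * \<bar>\<zeta> v\<bar>"
      by (metis abs_mult abs_triangle_ineq)
    also have "\<dots> \<le> \<bar>a\<bar> * (nrm \<eta> * L2_norm \<Omega> (A v)) + \<bar>b\<bar> * (nrm \<zeta> * L2_norm \<Omega> (A v))"
      using Xnorm_bound[OF \<eta> v] Xnorm_bound[OF \<zeta> v] by (intro add_mono mult_left_mono) auto
    finally show ?thesis by (simp add: algebra_simps)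
  qed
  moreover have "a * \<eta> (\<lambda>x. r * v x + s * w x) + b * \<zeta> (\<lambda>x. r * v x + s * w x)
      = r * (a * \<eta> v + b * \<zeta> v) + s * (a * \<eta> w + b * \<zeta> w)" if "v \<in> D" "w \<in> D" for v w r s
    using X_lincomb[OF \<eta> that] X_lincomb[OF \<zeta> that] by (simp add: algebra_simps)
  ultimately show in_X: "(\<lambda>v. a * \<eta> v + b * \<zeta> v) \<in> X"
    unfolding Xsp_def using X_outside[OF \<eta>] X_outside[OF \<zeta>] by auto
  show "nrm (\<lambda>v. a * \<eta> v + b * \<zeta> v) \<le> \<bar>a\<bar> * nrm \<eta> + \<bar>b\<bar> * nrm \<zeta>"
    by (rule Xnorm_least[OF in_X _ bd]) simp_all
qed

lemma X_diff: "\<eta> \<in> X \<Longrightarrow> \<zeta> \<in> X \<Longrightarrow> (\<lambda>v. \<eta> v - \<zeta> v) \<in> X"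
  using X_combine(1)[of \<eta> \<zeta> 1 "-1"] by simp

lemma X_cmult: "\<eta> \<in> X \<Longrightarrow> (\<lambda>v. a * \<eta> v) \<in> X"
  using X_combine(1)[of \<eta> \<eta> a 0] by simp

lemma X_zero: "(\<lambda>v. 0) \<in> X"
  using X_cmult[OF emb_Acl_in_X(1)[OF L2_zero], of 0] by simp

lemma Xnorm_zero: "nrm (\<lambda>v. 0) = 0"
  using Xnorm_least[OF X_zero, of 0] Xnorm_nonneg[of "\<lambda>v. 0"] by simp

text \<open>On \<open>D\<close> the dual-norm bound forces the value 0, and outside \<open>D\<close>
  the value is 0 by convention; hence the conclusion is equality of functions.\<close>

lemma Xnorm_eq_0: "\<eta> \<in> X \<Longrightarrow> nrm \<eta> = 0 \<Longrightarrow> \<eta> = (\<lambda>v. 0)"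
  using Xnorm_bound[of \<eta>] X_outside[of \<eta>] by (fastforce simp: fun_eq_iff)

lemma Xnorm_diff_commute:
  assumes "\<eta> \<in> X" "\<zeta> \<in> X"
  shows "nrm (\<lambda>v. \<eta> v - \<zeta> v) = nrm (\<lambda>v. \<zeta> v - \<eta> v)"
  using X_combine(2)[OF X_diff[OF assms] X_zero, of "-1" 0]
    X_combine(2)[OF X_diff[OF assms(2,1)] X_zero, of "-1" 0] by simp

lemma X_finite_sum:
  assumes "finite I" "\<And>i. i \<in> I \<Longrightarrow> \<eta> i \<in> X"
  shows "(\<lambda>v. \<Sum>i\<in>I. c i * \<eta> i v) \<in> X
    \<and> nrm (\<lambda>v. \<Sum>i\<in>I. c i * \<eta> i v) \<le> (\<Sum>i\<in>I. \<bar>c i\<bar> * nrm (\<eta> i))"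
  using assms
proof (induction I)
  case (insert i I)
  then show ?case
    using X_combine[of "\<eta> i" "\<lambda>v. \<Sum>i\<in>I. c i * \<eta> i v" "c i" 1] by simp
qed (simp add: X_zero Xnorm_zero)

end

section \<open>Dirac functionals and the closed-loop semigroup\<close>

text \<open>The set where the two functions differ is open and negligible, hence empty. This is the
  uniqueness demanded by the \<open>THE\<close> in \<open>pt_value\<close>.\<close>

lemma continuous_AE_eq_imp_eq:
  assumes "open \<Omega>" "continuous_on \<Omega> f" "continuous_on \<Omega> (g :: fn)"
    and ae: "AE x in lebesgue_on \<Omega>. f x = g x" and x: "x \<in> \<Omega>"
  shows "f x = g x"
proof (rule ccontr)
  assume ne: "f x \<noteq> g x"
  define V where "V = \<Omega> \<inter> (\<lambda>x. f x - g x) -` (- {0})"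
  have "open V"
    unfolding V_def using assms(1-3)
    by (intro continuous_open_preimage continuous_intros) auto
  moreover have "negligible V"
  proof -
    have "AE x in lebesgue. x \<in> \<Omega> \<longrightarrow> f x = g x"
      using ae assms(1) by (simp add: AE_restrict_space_iff)
    then have "AE x in lebesgue. x \<notin> V" by eventually_elim (auto simp: V_def)
    moreover have "V \<in> sets lebesgue" using \<open>open V\<close> by simp
    ultimately show ?thesis
      by (simp add: negligible_iff_null_sets AE_iff_null_sets)
  qed
  moreover have "x \<in> V" using ne x by (simp add: V_def)
  ultimately show False using open_not_negligible by blast
qed

lemma pt_value_eq:
  assumes "open \<Omega>" "continuous_on \<Omega> g" "AE y in lebesgue_on \<Omega>. f y = g y" "x \<in> \<Omega>"
  shows "pt_value \<Omega> f x = g x"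
  unfolding pt_value_def
proof (rule the_equality)
  have "AE y in lebesgue_on \<Omega>. g y = f y" using assms(3) by eventually_elim simp
  with assms(2) show "\<exists>g'. continuous_on \<Omega> g' \<and> (AE y in lebesgue_on \<Omega>. g' y = f y) \<and> g x = g' x"
    by blast
  fix c assume "\<exists>g'. continuous_on \<Omega> g' \<and> (AE y in lebesgue_on \<Omega>. g' y = f y) \<and> c = g' x"
  then obtain g' where g': "continuous_on \<Omega> g'" "AE y in lebesgue_on \<Omega>. g' y = f y" "c = g' x" by blast
  have "AE y in lebesgue_on \<Omega>. g' y = g y" using g'(2) assms(3) by eventually_elim simp
  from continuous_AE_eq_imp_eq[OF assms(1) g'(1) assms(2) this assms(4)] g'(3) show "c = g x" by simp
qed

context closed_loop
begin

text \<open>This functional is \<open>A h\<close> in the sense of transposition, for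
  \<open>h\<close> possibly outside \<open>D\<close>. It expresses the term of \<open>Acl\<close>
  that comes from \<open>A0\<close>.\<close>

lemma X_of_L2:
  assumes h: "h \<in> L2 \<Omega>"
  shows "(\<lambda>v. if v \<in> D then L2_ip \<Omega> h (A v) else 0) \<in> X"
proof -
  have "L2_ip \<Omega> h (A (\<lambda>x. a * v x + b * w x)) = a * L2_ip \<Omega> h (A v) + b * L2_ip \<Omega> h (A w)"
    if vw: "v \<in> D" "w \<in> D" for v w a b
  proof -
    have "L2_ip \<Omega> h (A (\<lambda>x. a * v x + b * w x)) = L2_ip \<Omega> h (\<lambda>x. a * A v x + b * A w x)"
      using vw by (intro L2_ip_cong_AE h Aop_L2 L2_lincomb neumann_dom_lincomb Aop_lincomb) simp_all
    then show ?thesis using vw by (simp add: L2_ip_lincomb_right Aop_L2 h)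
  qed
  moreover have "\<bar>L2_ip \<Omega> h (A v)\<bar> \<le> L2_norm \<Omega> h * L2_norm \<Omega> (A v)" if "v \<in> D" for v
    by (rule L2_Cauchy_Schwarz[OF h Aop_L2[OF that]])
  ultimately show ?thesis
    unfolding Xsp_def by (auto simp: neumann_dom_lincomb intro!: exI[of _ "L2_norm \<Omega> h"])
qed

text \<open>Every test function is \<open>A\<^sup>-\<^sup>1 z\<close> for some \<open>z \<in> L\<^sup>2\<close>, so \<open>A\<^sub>c\<^sub>l z \<in> D(A)'\<close> puts this combination
  of Dirac functionals into \<open>D(A)'\<close>.\<close>

lemma test_function_delta_sum_X:
  assumes \<psi>: "test_function \<Omega> \<psi>"
  shows "(\<lambda>v. \<Sum>j\<in>UNIV. \<psi> (xs j) * delta \<Omega> (xs j) v) \<in> X"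
proof -
  \<comment> \<open>\<open>z\<close> is \<open>A \<psi>\<close> with classical derivatives; the
    factors \<open>1\<close> and \<open>- \<kappa>\<close> fit the lemmas on linear
    combinations.\<close>
  define z where "z x = 1 * \<psi> x + (- \<kappa>) * (\<Sum>i\<in>UNIV. partial i (partial i \<psi>) x)" for x
  note \<psi>L = test_function_L2[OF \<psi>]
  have lapL: "(\<lambda>x. \<Sum>i\<in>UNIV. partial i (partial i \<psi>) x) \<in> L2 \<Omega>"
    using \<psi> by (intro L2_sum test_function_L2 test_function_partial)
  have zL: "z \<in> L2 \<Omega>" unfolding z_def[abs_def] by (rule L2_lincomb[OF \<psi>L lapL])
  have z_ip: "L2_ip \<Omega> z v = L2_ip \<Omega> \<psi> (A v)" if v: "v \<in> D" for v
  proof -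
    have "L2_ip \<Omega> z v = L2_ip \<Omega> \<psi> v - \<kappa> * L2_ip \<Omega> \<psi> (laplacian \<Omega> v)"
      unfolding z_def[abs_def] L2_ip_lincomb_left[OF \<psi>L lapL neumann_dom_L2[OF v]]
      using test_function_laplacian_ip[OF \<psi> neumann_dom_H2[OF v]] by simp
    also have "\<dots> = L2_ip \<Omega> \<psi> (\<lambda>x. 1 * v x + (- \<kappa>) * laplacian \<Omega> v x)"
      by (subst L2_ip_lincomb_right[OF neumann_dom_L2[OF v] laplacian_L2[OF neumann_dom_H2[OF v]] \<psi>L]) simp
    finally show ?thesis by (simp add: Aop_def[abs_def] A0_def)
  qed
  have "AE x in lebesgue_on \<Omega>. Ainv \<Omega> \<kappa> (emb \<Omega> z) x = \<psi> x"
    using z_ip by (intro Ainv_unique emb_Acl_in_X zL \<psi>L) (simp add: emb_def)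
  \<comment> \<open>\<open>Ainv\<close> is known only almost everywhere; its point value is that of
    the continuous representative \<open>\<psi>\<close>.\<close>
  then have pv: "pt_value \<Omega> (Ainv \<Omega> \<kappa> (emb \<Omega> z)) (xs j) = \<psi> (xs j)" for j
    by (intro pt_value_eq open_domain points continuous_on_subset[OF test_function_continuous[OF \<psi>]]) auto
  define G where "G v = (if v \<in> D then L2_ip \<Omega> z (A v) else 0)" for v
  have GX: "G \<in> X" unfolding G_def[abs_def] by (rule X_of_L2[OF zL])
  \<comment> \<open>The definition of \<open>Acl\<close> is solved for its Dirac part: the
    transposed \<open>A0 z\<close> equals \<open>emb \<Omega> z - G\<close>, and positivity of
    \<open>lam\<close> permits the division.\<close>
  have "(\<lambda>v. (1 / lam) * (emb \<Omega> z v - G v) + (- 1 / lam) * Acl \<Omega> \<kappa> lam xs z v) \<in> X"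
    by (intro X_combine X_diff emb_Acl_in_X zL GX)
  moreover have "(\<lambda>v. (1 / lam) * (emb \<Omega> z v - G v) + (- 1 / lam) * Acl \<Omega> \<kappa> lam xs z v)
      = (\<lambda>v. \<Sum>j\<in>UNIV. \<psi> (xs j) * delta \<Omega> (xs j) v)"
  proof
    fix v
    show "(1 / lam) * (emb \<Omega> z v - G v) + (- 1 / lam) * Acl \<Omega> \<kappa> lam xs z v
        = (\<Sum>j\<in>UNIV. \<psi> (xs j) * delta \<Omega> (xs j) v)"
    proof (cases "v \<in> D")
      case True
      have "L2_ip \<Omega> z (A0 \<Omega> \<kappa> v) = L2_ip \<Omega> z v - L2_ip \<Omega> z (A v)"
        using L2_ip_lincomb_right[OF neumann_dom_L2[OF True] A0_L2[OF True] zL, where a = 1 and b = "-1"]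
        by (simp add: Aop_def[abs_def])
      then have "Acl \<Omega> \<kappa> lam xs z v
          = emb \<Omega> z v - G v - lam * (\<Sum>j\<in>UNIV. \<psi> (xs j) * delta \<Omega> (xs j) v)"
        using True unfolding Acl_def pv by (simp add: emb_def G_def)
      then have "emb \<Omega> z v - G v = Acl \<Omega> \<kappa> lam xs z v
          + lam * (\<Sum>j\<in>UNIV. \<psi> (xs j) * delta \<Omega> (xs j) v)" by simp
      then show ?thesis using lam_pos by (simp add: distrib_left)
    next
      case False
      then show ?thesis by (simp add: emb_def G_def Acl_def delta_def)
    qed
  qed
  ultimately show ?thesis by simp
qed

text \<open>A bump supported in a box around \<open>xs j\<close> that avoids the finitely many other
  point locations kills all other terms of the weighted Dirac sum.\<close>

lemma delta_X: "delta \<Omega> (xs j) \<in> X"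
proof -
  define F where "F = xs ` {i. xs i \<noteq> xs j}"
  have "open (\<Omega> - F)" "xs j \<in> \<Omega> - F"
    using open_domain points[of j] open_Diff[OF open_domain finite_imp_closed[of F]]
    by (auto simp: F_def)
  then obtain a b where ab: "cbox a b \<subseteq> \<Omega> - F" "xs j \<in> box a b"
    by (meson open_contains_cbox)
  define \<psi> where "\<psi> = box_bump 1 a b"
  have "test_function \<Omega> \<psi>" unfolding \<psi>_def using ab by (intro test_function_box_bump) auto
  then have in_X: "(\<lambda>v. \<Sum>i\<in>UNIV. \<psi> (xs i) * delta \<Omega> (xs i) v) \<in> X"
    by (rule test_function_delta_sum_X)
  have \<psi>j: "\<psi> (xs j) \<noteq> 0" unfolding \<psi>_def using ab by (subst box_bump_nonzero) auto
  have \<psi>0: "\<psi> (xs i) = 0" if "xs i \<noteq> xs j" for i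
  proof -
    have "xs i \<notin> box a b" using ab(1) box_subset_cbox[of a b] that by (auto simp: F_def)
    then show ?thesis unfolding \<psi>_def using box_bump_nonzero[of 1 a b "xs i"] by auto
  qed
  \<comment> \<open>Different indices may carry the same point, and no bump separates them;
    \<open>m\<close> is the resulting multiplicity, to be divided out.\<close>
  define m where "m = real (card {i. xs i = xs j})"
  have "card {i. xs i = xs j} > 0" by (auto simp: card_gt_0_iff)
  then have m: "m > 0" by (simp add: m_def)
  have "(\<Sum>i\<in>UNIV. \<psi> (xs i) * delta \<Omega> (xs i) v) = m * \<psi> (xs j) * delta \<Omega> (xs j) v" for v
  proof -
    have "(\<Sum>i\<in>UNIV. \<psi> (xs i) * delta \<Omega> (xs i) v)
        = (\<Sum>i\<in>{i. xs i = xs j}. \<psi> (xs j) * delta \<Omega> (xs j) v)"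
      using \<psi>0 by (intro sum.mono_neutral_cong_right) auto
    then show ?thesis by (simp add: m_def)
  qed
  with X_cmult[OF in_X, of "1 / (m * \<psi> (xs j))"] m \<psi>j show ?thesis by simp
qed

lemma Bop_X: "Bop \<Omega> xs u \<in> X"
  and Bop_bound: "nrm (Bop \<Omega> xs u) \<le> (\<Sum>j\<in>UNIV. nrm (delta \<Omega> (xs j))) * norm u"
proof -
  have B: "Bop \<Omega> xs u \<in> X \<and> nrm (Bop \<Omega> xs u) \<le> (\<Sum>j\<in>UNIV. \<bar>u $ j\<bar> * nrm (delta \<Omega> (xs j)))"
    unfolding Bop_def by (intro X_finite_sum delta_X) simp
  then show "Bop \<Omega> xs u \<in> X" by blast
  have "(\<Sum>j\<in>UNIV. \<bar>u $ j\<bar> * nrm (delta \<Omega> (xs j))) \<le> (\<Sum>j\<in>UNIV. norm u * nrm (delta \<Omega> (xs j)))"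
    by (intro sum_mono mult_right_mono component_le_norm_cart) simp
  also have "\<dots> = (\<Sum>j\<in>UNIV. nrm (delta \<Omega> (xs j))) * norm u"
    by (simp add: sum_distrib_left mult.commute)
  finally show "nrm (Bop \<Omega> xs u) \<le> (\<Sum>j\<in>UNIV. nrm (delta \<Omega> (xs j))) * norm u"
    using B by linarith
qed

section \<open>Orbits of the semigroup and their time integral\<close>

lemma C0_semigroup_S: "C0_semigroup X nrm S"
  using semigroup unfolding closed_loop_semigroup_def by (elim conjE)

lemma exp_stable_S: "exp_stable X nrm S"
  using semigroup unfolding closed_loop_semigroup_def by (elim conjE)

lemma S_X: "t \<ge> 0 \<Longrightarrow> \<eta> \<in> X \<Longrightarrow> S t \<eta> \<in> X"
  using C0_semigroup_S unfolding C0_semigroup_def by (elim conjE) blast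

lemma S_lincomb:
  assumes "t \<ge> 0" "\<eta> \<in> X" "\<zeta> \<in> X"
  shows "S t (\<lambda>v. a * \<eta> v + b * \<zeta> v) = (\<lambda>v. a * S t \<eta> v + b * S t \<zeta> v)"
proof -
  have "lin_on X (S t)" using C0_semigroup_S assms(1) unfolding C0_semigroup_def by (elim conjE) simp
  then show ?thesis using assms(2,3) by (simp add: lin_on_def)
qed

lemma S_diff:
  "t \<ge> 0 \<Longrightarrow> \<eta> \<in> X \<Longrightarrow> \<zeta> \<in> X \<Longrightarrow> S t (\<lambda>v. \<eta> v - \<zeta> v) = (\<lambda>v. S t \<eta> v - S t \<zeta> v)"
  using S_lincomb[of t \<eta> \<zeta> 1 "-1"] by simp

lemma S_add: "s \<ge> 0 \<Longrightarrow> t \<ge> 0 \<Longrightarrow> \<eta> \<in> X \<Longrightarrow> S (s + t) \<eta> = S s (S t \<eta>)"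
  using C0_semigroup_S unfolding C0_semigroup_def by (elim conjE) simp

lemma S_tendsto: "\<eta> \<in> X \<Longrightarrow> ((\<lambda>t. nrm (\<lambda>v. S t \<eta> v - \<eta> v)) \<longlongrightarrow> 0) (at_right 0)"
  using C0_semigroup_S unfolding C0_semigroup_def by (elim conjE) simp

lemma S_stable:
  obtains K \<omega> where "K \<ge> 0" "\<omega> > 0"
    "\<And>t \<eta>. t \<ge> 0 \<Longrightarrow> \<eta> \<in> X \<Longrightarrow> nrm (S t \<eta>) \<le> K * exp (- \<omega> * t) * nrm \<eta>"
proof -
  obtain K \<omega> where K: "\<omega> > 0" "\<And>t \<eta>. t \<ge> 0 \<Longrightarrow> \<eta> \<in> X \<Longrightarrow> nrm (S t \<eta>) \<le> K * exp (- \<omega> * t) * nrm \<eta>"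
    using exp_stable_S unfolding exp_stable_def by blast
  have "nrm (S t \<eta>) \<le> \<bar>K\<bar> * exp (- \<omega> * t) * nrm \<eta>" if "t \<ge> 0" "\<eta> \<in> X" for t \<eta>
  proof -
    have "K * exp (- \<omega> * t) * nrm \<eta> \<le> \<bar>K\<bar> * exp (- \<omega> * t) * nrm \<eta>"
      by (intro mult_right_mono) simp_all
    with K(2)[OF that] show ?thesis by linarith
  qed
  with K(1) show ?thesis by (intro that[of "\<bar>K\<bar>" \<omega>]) simp_all
qed

text \<open>Strong continuity is given only at time 0 from the right. Factoring out the earlier time
  \<open>s\<close> writes an increment as \<open>S s\<close> applied to an increment starting at 0;
  as \<open>S s\<close> is bounded by \<open>K\<close> uniformly, the estimate depends only on the
  distance of the two times and covers both sides. Continuity provides measurability of the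
  integrand of \<open>Rcl\<close>.\<close>

lemma S_continuous:
  assumes \<eta>: "\<eta> \<in> X" and v: "v \<in> D"
  shows "continuous_on {0..} (\<lambda>t. S t \<eta> v)"
proof -
  obtain K \<omega> where K: "K \<ge> 0" "\<omega> > 0"
    "\<And>t \<eta>. t \<ge> 0 \<Longrightarrow> \<eta> \<in> X \<Longrightarrow> nrm (S t \<eta>) \<le> K * exp (- \<omega> * t) * nrm \<eta>"
    using S_stable by blast
  define m where "m h = nrm (\<lambda>v. S h \<eta> v - \<eta> v)" for h
  have le: "\<bar>S t \<eta> v - S s \<eta> v\<bar> \<le> K * m (t - s) * L2_norm \<Omega> (A v)" if st: "0 \<le> s" "s \<le> t" for s t
  proof -
    have d: "(\<lambda>v. S (t - s) \<eta> v - \<eta> v) \<in> X" using st by (intro X_diff S_X \<eta>) simp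
    have "S t \<eta> = S s (S (t - s) \<eta>)" using S_add[of s "t - s" \<eta>] st \<eta> by simp
    then have eq: "S t \<eta> v - S s \<eta> v = S s (\<lambda>v. S (t - s) \<eta> v - \<eta> v) v"
      using st by (simp add: S_diff S_X \<eta>)
    have "\<bar>S t \<eta> v - S s \<eta> v\<bar> \<le> nrm (S s (\<lambda>v. S (t - s) \<eta> v - \<eta> v)) * L2_norm \<Omega> (A v)"
      unfolding eq using st by (intro Xnorm_bound S_X d v)
    also have "nrm (S s (\<lambda>v. S (t - s) \<eta> v - \<eta> v)) \<le> K * exp (- \<omega> * s) * m (t - s)"
      using K(3)[OF st(1) d] by (simp add: m_def)
    also have "\<dots> \<le> K * 1 * m (t - s)"
      using K st by (intro mult_right_mono mult_left_mono) (auto simp: m_def)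
    finally show ?thesis by (simp add: mult_right_mono)
  qed
  show ?thesis
    unfolding continuous_on_iff dist_real_def
  proof (intro ballI allI impI)
    fix s e :: real assume s: "s \<in> {0..}" and e: "e > 0"
    have "((\<lambda>h. K * m h * L2_norm \<Omega> (A v)) \<longlongrightarrow> K * 0 * L2_norm \<Omega> (A v)) (at_right 0)"
      unfolding m_def by (intro tendsto_intros S_tendsto \<eta>)
    then have "\<forall>\<^sub>F h in at_right 0. K * m h * L2_norm \<Omega> (A v) < e"
      using e by (intro order_tendstoD(2)) auto
    then obtain d where d: "d > 0" "\<And>h. 0 < h \<Longrightarrow> h < d \<Longrightarrow> K * m h * L2_norm \<Omega> (A v) < e"
      unfolding eventually_at_right_field by auto
    have "\<bar>S t \<eta> v - S s \<eta> v\<bar> < e" if t: "t \<in> {0..}" "\<bar>t - s\<bar> < d" for t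
    proof -
      consider "t = s" | "s < t" | "t < s" by linarith
      then show ?thesis
      proof cases
        case 2
        then show ?thesis using le[of s t] d(2)[of "t - s"] s t by auto
      next
        case 3
        then show ?thesis using le[of t s] d(2)[of "s - t"] s t by auto
      qed (use e in simp)
    qed
    with d(1) show "\<exists>d>0. \<forall>t\<in>{0..}. \<bar>t - s\<bar> < d \<longrightarrow> \<bar>S t \<eta> v - S s \<eta> v\<bar> < e" by blast
  qed
qed

end

lemma set_integrable_exp_decay:
  assumes "\<omega> > 0"
  shows "set_integrable lborel {0..} (\<lambda>t::real. exp (- \<omega> * t))"
proof -
  have lim: "((\<lambda>t. - exp (- \<omega> * t) / \<omega>) \<longlongrightarrow> 0) at_top"
  proof -
    have "filterlim (\<lambda>t. - \<omega> * t) at_bot at_top"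
      using assms by (intro filterlim_tendsto_neg_mult_at_bot[OF tendsto_const])
        (simp_all add: filterlim_ident)
    then have "((\<lambda>t. exp (- \<omega> * t)) \<longlongrightarrow> 0) at_top"
      by (rule filterlim_compose[OF exp_at_bot])
    from tendsto_divide[OF tendsto_minus[OF this] tendsto_const[of \<omega>]] assms show ?thesis by simp
  qed
  have "(\<integral>\<^sup>+t. ennreal (exp (- \<omega> * t)) * indicator {0..} t \<partial>lborel) = ennreal (0 - (- exp (- \<omega> * 0) / \<omega>))"
  proof (rule nn_integral_FTC_atLeast[OF _ _ _ lim])
    fix t :: real
    show "((\<lambda>t. - exp (- \<omega> * t) / \<omega>) has_real_derivative exp (- \<omega> * t)) (at t)"
      using assms by (auto intro!: derivative_eq_intros)
  qed auto
  then have fin: "(\<integral>\<^sup>+t. ennreal (indicator {0..} t * exp (- \<omega> * t)) \<partial>lborel) < \<infinity>"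
    by (subst nn_integral_cong[of _ _ "\<lambda>t. ennreal (exp (- \<omega> * t)) * indicator {0..} t"])
      (simp_all add: indicator_def)
  show ?thesis
    unfolding set_integrable_def real_scaleR_def
    using fin by (intro integrableI_nonneg) simp_all
qed

context closed_loop
begin

text \<open>The integral of a nonintegrable function defaults to 0, so linearity of
  \<open>Rcl\<close>, in its argument and in \<open>v\<close>, depends on this fact.\<close>

lemma S_decay_integrable:
  assumes \<eta>: "\<eta> \<in> X" and v: "v \<in> D"
  shows "set_integrable lborel {0..} (\<lambda>t. S t \<eta> v)"
proof -
  obtain K \<omega> where K: "K \<ge> 0" "\<omega> > 0"
    "\<And>t \<eta>. t \<ge> 0 \<Longrightarrow> \<eta> \<in> X \<Longrightarrow> nrm (S t \<eta>) \<le> K * exp (- \<omega> * t) * nrm \<eta>"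
    using S_stable by blast
  define c where "c = K * nrm \<eta> * L2_norm \<Omega> (A v)"
  show ?thesis
  proof (rule set_integrable_bound)
    show "set_integrable lborel {0..} (\<lambda>t. c * exp (- \<omega> * t))"
      using set_integrable_exp_decay[OF K(2)] by simp
    show "set_borel_measurable lborel {0..} (\<lambda>t. S t \<eta> v)"
      unfolding set_borel_measurable_def
      using borel_measurable_continuous_on_indicator[OF _ S_continuous[OF \<eta> v]] by simp
    have "\<bar>S t \<eta> v\<bar> \<le> c * exp (- \<omega> * t)" if t: "t \<ge> 0" for t
      using Xnorm_bound[OF S_X[OF t \<eta>] v] mult_right_mono[OF K(3)[OF t \<eta>], of "L2_norm \<Omega> (A v)"]
      by (simp add: c_def algebra_simps)
    then have "\<bar>S t \<eta> v\<bar> \<le> \<bar>c * exp (- \<omega> * t)\<bar>" if "t \<ge> 0" for t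
      using order_trans[OF _ abs_ge_self] that by blast
    then show "AE t in lborel. t \<in> {0..} \<longrightarrow> norm (S t \<eta> v) \<le> norm (c * exp (- \<omega> * t))"
      by simp
  qed
qed

lemma Rcl_outside: "\<eta> \<in> X \<Longrightarrow> v \<notin> D \<Longrightarrow> Rcl S \<eta> v = 0"
  unfolding Rcl_def set_lebesgue_integral_def
  by (rule integral_eq_zero_AE, rule AE_I2) (simp add: indicator_def X_outside[OF S_X])

text \<open>For fixed \<open>v\<close> the orbit is a scalar function dominated by an exponential;
  integrating gives a bound in terms of \<open>A v\<close>, which the dual-norm characterisation
  converts into the constant \<open>K * E\<close>.\<close>

lemma Rcl_X_bound:
  obtains C where "C \<ge> 0" "\<And>\<eta>. \<eta> \<in> X \<Longrightarrow> Rcl S \<eta> \<in> X" "\<And>\<eta>. \<eta> \<in> X \<Longrightarrow> nrm (Rcl S \<eta>) \<le> C * nrm \<eta>"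
proof -
  obtain K \<omega> where K: "K \<ge> 0" "\<omega> > 0"
    "\<And>t \<eta>. t \<ge> 0 \<Longrightarrow> \<eta> \<in> X \<Longrightarrow> nrm (S t \<eta>) \<le> K * exp (- \<omega> * t) * nrm \<eta>"
    using S_stable by blast
  define E where "E = (LINT t:{0..}|lborel. exp (- \<omega> * t))"
  have E: "E \<ge> 0" unfolding E_def set_lebesgue_integral_def by (intro integral_nonneg_AE) auto
  have bd: "\<bar>Rcl S \<eta> v\<bar> \<le> (K * E * nrm \<eta>) * L2_norm \<Omega> (A v)" if \<eta>: "\<eta> \<in> X" and v: "v \<in> D" for \<eta> v
  proof -
    define c where "c = K * nrm \<eta> * L2_norm \<Omega> (A v)"
    have le: "\<bar>S t \<eta> v\<bar> \<le> c * exp (- \<omega> * t)" if t: "t \<ge> 0" for t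
      using Xnorm_bound[OF S_X[OF t \<eta>] v] mult_right_mono[OF K(3)[OF t \<eta>], of "L2_norm \<Omega> (A v)"]
      by (simp add: c_def algebra_simps)
    have "\<bar>Rcl S \<eta> v\<bar> \<le> (LINT t:{0..}|lborel. \<bar>S t \<eta> v\<bar>)"
      unfolding Rcl_def using set_integral_norm_bound[OF S_decay_integrable[OF \<eta> v]] by simp
    also have "\<dots> \<le> (LINT t:{0..}|lborel. c * exp (- \<omega> * t))"
    proof (rule set_integral_mono)
      show "set_integrable lborel {0..} (\<lambda>t. \<bar>S t \<eta> v\<bar>)"
        by (rule set_integrable_abs[OF S_decay_integrable[OF \<eta> v]])
      show "set_integrable lborel {0..} (\<lambda>t. c * exp (- \<omega> * t))"
        using set_integrable_exp_decay[OF K(2)] by simp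
    qed (use le in simp)
    also have "\<dots> = c * E" by (simp add: E_def)
    finally show ?thesis by (simp add: c_def algebra_simps)
  qed
  have in_X: "Rcl S \<eta> \<in> X" if \<eta>: "\<eta> \<in> X" for \<eta>
  proof -
    have "Rcl S \<eta> (\<lambda>x. a * v x + b * w x) = a * Rcl S \<eta> v + b * Rcl S \<eta> w"
      if v: "v \<in> D" and w: "w \<in> D" for v w a b
    proof -
      have "Rcl S \<eta> (\<lambda>x. a * v x + b * w x) = (LINT t:{0..}|lborel. a * S t \<eta> v + b * S t \<eta> w)"
        unfolding Rcl_def
        by (rule set_lebesgue_integral_cong) (auto simp: X_lincomb[OF S_X[OF _ \<eta>] v w])
      then show ?thesis
        using S_decay_integrable[OF \<eta> v] S_decay_integrable[OF \<eta> w]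
        by (simp add: Rcl_def set_integral_add)
    qed
    then show ?thesis unfolding Xsp_def using Rcl_outside[OF \<eta>] bd[OF \<eta>] by blast
  qed
  have "nrm (Rcl S \<eta>) \<le> (K * E) * nrm \<eta>" if "\<eta> \<in> X" for \<eta>
    using K E bd[OF that] by (intro Xnorm_least in_X that) simp_all
  with in_X K E show ?thesis by (intro that[of "K * E"]) simp_all
qed

lemma Rcl_lincomb:
  assumes \<eta>: "\<eta> \<in> X" and \<zeta>: "\<zeta> \<in> X"
  shows "Rcl S (\<lambda>v. a * \<eta> v + b * \<zeta> v) = (\<lambda>v. a * Rcl S \<eta> v + b * Rcl S \<zeta> v)"
proof
  fix v
  show "Rcl S (\<lambda>v. a * \<eta> v + b * \<zeta> v) v = a * Rcl S \<eta> v + b * Rcl S \<zeta> v"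
  proof (cases "v \<in> D")
    case True
    have "Rcl S (\<lambda>v. a * \<eta> v + b * \<zeta> v) v = (LINT t:{0..}|lborel. a * S t \<eta> v + b * S t \<zeta> v)"
      unfolding Rcl_def
      by (rule set_lebesgue_integral_cong) (auto simp: S_lincomb[OF _ \<eta> \<zeta>])
    then show ?thesis
      using S_decay_integrable[OF \<eta> True] S_decay_integrable[OF \<zeta> True]
      by (simp add: Rcl_def set_integral_add)
  qed (simp add: Rcl_outside \<eta> \<zeta> X_combine)
qed

end

section \<open>Contraction on the modal subspace\<close>

text \<open>Any a priori constant \<open>C\<close>, however crude, bounds the set of quotients, and
  only then is the real supremum meaningful.\<close>

lemma opnorm_upper:
  assumes bd: "\<And>v. v \<in> V \<Longrightarrow> f (T v) \<le> C * g v" and g: "\<And>v. v \<in> V \<Longrightarrow> g v \<ge> 0" and v: "v \<in> V"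
  shows "f (T v) / g v \<le> opnorm V g f T"
proof -
  \<comment> \<open>\<open>C\<close> may be negative, while a vector with \<open>g w = 0\<close>
    contributes the quotient 0.\<close>
  have "f (T w) / g w \<le> max C 0" if w: "w \<in> V" for w
  proof (cases "g w = 0")
    case False
    then have "g w > 0" using g[OF w] by simp
    then have "f (T w) / g w \<le> C" using bd[OF w] by (simp add: divide_le_eq)
    then show ?thesis by simp
  qed simp
  then have "bdd_above ((\<lambda>v. f (T v) / g v) ` V)" by (auto simp: bdd_above_def)
  then show ?thesis unfolding opnorm_def using v by (rule cSUP_upper2) simp
qed

lemma opnorm_bound:
  assumes bd: "\<And>v. v \<in> V \<Longrightarrow> f (T v) \<le> C * g v" and g: "\<And>v. v \<in> V \<Longrightarrow> g v \<ge> 0" and v: "v \<in> V"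
  shows "f (T v) \<le> opnorm V g f T * g v"
proof (cases "g v = 0")
  \<comment> \<open>The quotient is 0 whatever \<open>f (T v)\<close> is, so the a priori bound has
    to supply \<open>f (T v) \<le> 0\<close>.\<close>
  case True
  then show ?thesis using bd[OF v] by simp
next
  case False
  then have "g v > 0" using g[OF v] by simp
  with opnorm_upper[of V f T C g, OF bd g v] show ?thesis by (simp add: divide_le_eq)
qed

text \<open>Division by zero yields 0, so the vector \<open>w\<close> puts 0 among the quotients;
  this works on the trivial space too.\<close>

lemma opnorm_nonneg:
  assumes bd: "\<And>v. v \<in> V \<Longrightarrow> f (T v) \<le> C * g v" and g: "\<And>v. v \<in> V \<Longrightarrow> g v \<ge> 0"
    and w: "w \<in> V" "g w = 0"
  shows "opnorm V g f T \<ge> 0"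
  using opnorm_upper[of V f T C g, OF bd g w(1)] w(2) by simp

lemma opnorm_least:
  assumes bd: "\<And>v. v \<in> V \<Longrightarrow> f (T v) \<le> C * g v" and g: "\<And>v. v \<in> V \<Longrightarrow> g v \<ge> 0"
    and V: "V \<noteq> {}" and C: "C \<ge> 0"
  shows "opnorm V g f T \<le> C"
  unfolding opnorm_def
proof (rule cSUP_least[OF V])
  fix v assume v: "v \<in> V"
  show "f (T v) / g v \<le> C"
    using bd[OF v] g[OF v] C by (cases "g v = 0") (auto simp: divide_le_eq)
qed

context closed_loop
begin

section \<open>The modal subspace and its projectors\<close>

lemma emb_phi_X: "k \<ge> 1 \<Longrightarrow> emb \<Omega> (\<phi> k) \<in> X"
  by (intro emb_Acl_in_X phi_L2)

lemma emb_phi_sum: "emb \<Omega> (\<lambda>x. \<Sum>k=1..N. c k * \<phi> k x) = (\<lambda>v. \<Sum>k=1..N. c k * emb \<Omega> (\<phi> k) v)"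
proof
  fix v
  show "emb \<Omega> (\<lambda>x. \<Sum>k=1..N. c k * \<phi> k x) v = (\<Sum>k=1..N. c k * emb \<Omega> (\<phi> k) v)"
    using L2_ip_sum_left[of "{1..N}" \<phi> \<Omega> v c] phi_L2 neumann_dom_L2 by (simp add: emb_def)
qed

lemma phi_comb_XN: "(\<lambda>v. \<Sum>k=1..N. c k * emb \<Omega> (\<phi> k) v) \<in> XN \<Omega> \<phi> N"
  unfolding XN_def mode_fns_def emb_phi_sum[symmetric] by blast

lemma phi_comb_coeff:
  assumes "j \<in> {1..N}"
  shows "(\<Sum>k=1..N. c k * emb \<Omega> (\<phi> k) (\<phi> j)) = c j"
proof -
  have "(\<Sum>k=1..N. c k * emb \<Omega> (\<phi> k) (\<phi> j)) = (\<Sum>k=1..N. if k = j then c j else 0)"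
    using assms by (intro sum.cong) (auto simp: emb_def phi_D phi_ortho)
  then show ?thesis using assms by simp
qed

text \<open>Orthonormality recovers the coefficients of \<open>y\<close> by evaluating it at the
  eigenfunctions. As such evaluations are bounded by \<open>nrm\<close>, the coordinates on the
  modal subspace are continuous.\<close>

lemma XN_expand:
  assumes "y \<in> XN \<Omega> \<phi> N"
  shows "y = (\<lambda>v. \<Sum>k=1..N. y (\<phi> k) * emb \<Omega> (\<phi> k) v)"
proof -
  obtain c where "y = emb \<Omega> (\<lambda>x. \<Sum>k=1..N. c k * \<phi> k x)"
    using assms unfolding XN_def mode_fns_def by blast
  then have c: "y = (\<lambda>v. \<Sum>k=1..N. c k * emb \<Omega> (\<phi> k) v)"
    by (simp only: emb_phi_sum)
  have "y (\<phi> j) = c j" if "j \<in> {1..N}" for j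
    unfolding c by (rule phi_comb_coeff[OF that])
  then have "(\<lambda>v. \<Sum>k=1..N. y (\<phi> k) * emb \<Omega> (\<phi> k) v) = (\<lambda>v. \<Sum>k=1..N. c k * emb \<Omega> (\<phi> k) v)"
    by (intro ext sum.cong) simp_all
  with c show ?thesis by (rule trans[OF _ sym])
qed

lemma XN_X:
  assumes "y \<in> XN \<Omega> \<phi> N"
  shows "y \<in> X"
proof -
  have "(\<lambda>v. \<Sum>k=1..N. y (\<phi> k) * emb \<Omega> (\<phi> k) v) \<in> X"
    by (rule X_finite_sum[THEN conjunct1]) (simp_all add: emb_phi_X)
  then show ?thesis by (rule ssubst[OF XN_expand[OF assms], of "\<lambda>y. y \<in> X"])
qed

lemma XN_lincomb:
  assumes "y \<in> XN \<Omega> \<phi> N" "z \<in> XN \<Omega> \<phi> N"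
  shows "(\<lambda>v. a * y v + b * z v) \<in> XN \<Omega> \<phi> N"
proof -
  have "(\<lambda>v. a * y v + b * z v)
      = (\<lambda>v. a * (\<Sum>k=1..N. y (\<phi> k) * emb \<Omega> (\<phi> k) v) + b * (\<Sum>k=1..N. z (\<phi> k) * emb \<Omega> (\<phi> k) v))"
    using XN_expand[OF assms(1)] XN_expand[OF assms(2)] by (metis (no_types, lifting))
  also have "\<dots> = (\<lambda>v. \<Sum>k=1..N. (a * y (\<phi> k) + b * z (\<phi> k)) * emb \<Omega> (\<phi> k) v)"
    by (simp add: sum.distrib sum_distrib_left distrib_right mult.assoc)
  finally show ?thesis
    using phi_comb_XN[where N = N and c = "\<lambda>k. a * y (\<phi> k) + b * z (\<phi> k)"] by simp
qed

lemma XN_diff: "y \<in> XN \<Omega> \<phi> N \<Longrightarrow> z \<in> XN \<Omega> \<phi> N \<Longrightarrow> (\<lambda>v. y v - z v) \<in> XN \<Omega> \<phi> N"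
  using XN_lincomb[of y N z 1 "-1"] by simp

lemma XN_add: "y \<in> XN \<Omega> \<phi> N \<Longrightarrow> z \<in> XN \<Omega> \<phi> N \<Longrightarrow> (\<lambda>v. y v + z v) \<in> XN \<Omega> \<phi> N"
  using XN_lincomb[of y N z 1 1] by simp

lemma XN_zero: "(\<lambda>v. 0) \<in> XN \<Omega> \<phi> N"
  using phi_comb_XN[where c = "\<lambda>k. 0"] by simp

lemma PN_XN: "PN \<Omega> \<phi> N \<eta> \<in> XN \<Omega> \<phi> N"
  unfolding PN_def by (rule phi_comb_XN)

lemma phi_coeff_bound: "\<eta> \<in> X \<Longrightarrow> k \<ge> 1 \<Longrightarrow> \<bar>\<eta> (\<phi> k)\<bar> \<le> nrm \<eta> * L2_norm \<Omega> (A (\<phi> k))"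
  by (intro Xnorm_bound phi_D)

lemma PN_bound:
  assumes "\<eta> \<in> X"
  shows "nrm (PN \<Omega> \<phi> N \<eta>) \<le> (\<Sum>k=1..N. L2_norm \<Omega> (A (\<phi> k)) * nrm (emb \<Omega> (\<phi> k))) * nrm \<eta>"
proof -
  have "nrm (PN \<Omega> \<phi> N \<eta>) \<le> (\<Sum>k=1..N. \<bar>\<eta> (\<phi> k)\<bar> * nrm (emb \<Omega> (\<phi> k)))"
    unfolding PN_def using X_finite_sum[of "{1..N}"] emb_phi_X by simp
  also have "\<dots> \<le> (\<Sum>k=1..N. (nrm \<eta> * L2_norm \<Omega> (A (\<phi> k))) * nrm (emb \<Omega> (\<phi> k)))"
    using assms by (intro sum_mono mult_right_mono phi_coeff_bound) auto
  finally show ?thesis by (simp add: sum_distrib_left sum_distrib_right mult_ac)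
qed

lemma PN_lincomb: "PN \<Omega> \<phi> N (\<lambda>v. a * \<eta> v + b * \<zeta> v) = (\<lambda>v. a * PN \<Omega> \<phi> N \<eta> v + b * PN \<Omega> \<phi> N \<zeta> v)"
  by (simp add: PN_def sum.distrib sum_distrib_left algebra_simps)

lemma QN_lincomb: "QN \<Omega> \<phi> N (\<lambda>v. a * \<eta> v + b * \<zeta> v) = (\<lambda>v. a * QN \<Omega> \<phi> N \<eta> v + b * QN \<Omega> \<phi> N \<zeta> v)"
  by (simp add: QN_def PN_lincomb algebra_simps)

lemma QN_X: "\<eta> \<in> X \<Longrightarrow> QN \<Omega> \<phi> N \<eta> \<in> X"
  unfolding QN_def by (intro X_diff XN_X[OF PN_XN])

text \<open>The value of the constant is immaterial: its existence makes \<open>LN\<close> a true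
  operator norm.\<close>

lemma PRQ_bound: "\<exists>C. \<forall>\<eta>\<in>X. nrm ((PN \<Omega> \<phi> N \<circ> Rcl S \<circ> QN \<Omega> \<phi> N) \<eta>) \<le> C * nrm \<eta>"
proof -
  define P where "P = (\<Sum>k=1..N. L2_norm \<Omega> (A (\<phi> k)) * nrm (emb \<Omega> (\<phi> k)))"
  have P: "P \<ge> 0" unfolding P_def by (intro sum_nonneg) simp
  obtain R where R: "R \<ge> 0" "\<And>\<eta>. \<eta> \<in> X \<Longrightarrow> Rcl S \<eta> \<in> X" "\<And>\<eta>. \<eta> \<in> X \<Longrightarrow> nrm (Rcl S \<eta>) \<le> R * nrm \<eta>"
    using Rcl_X_bound by blast
  have "nrm (PN \<Omega> \<phi> N (Rcl S (QN \<Omega> \<phi> N \<eta>))) \<le> (P * (R * (1 + P))) * nrm \<eta>" if \<eta>: "\<eta> \<in> X" for \<eta>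
  proof -
    note Q = QN_X[OF \<eta>, of N]
    have "nrm (QN \<Omega> \<phi> N \<eta>) \<le> nrm \<eta> + nrm (PN \<Omega> \<phi> N \<eta>)"
      unfolding QN_def using X_combine(2)[OF \<eta> XN_X[OF PN_XN[of N \<eta>]], of 1 "-1"] by simp
    also have "\<dots> \<le> (1 + P) * nrm \<eta>"
      using PN_bound[OF \<eta>, of N] by (simp add: P_def algebra_simps)
    finally have q: "nrm (QN \<Omega> \<phi> N \<eta>) \<le> (1 + P) * nrm \<eta>" .
    have "nrm (PN \<Omega> \<phi> N (Rcl S (QN \<Omega> \<phi> N \<eta>))) \<le> P * nrm (Rcl S (QN \<Omega> \<phi> N \<eta>))"
      using PN_bound[OF R(2)[OF Q], of N] by (simp add: P_def)
    also have "\<dots> \<le> P * (R * nrm (QN \<Omega> \<phi> N \<eta>))" by (intro mult_left_mono R(3) Q P)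
    also have "\<dots> \<le> P * (R * ((1 + P) * nrm \<eta>))" by (intro mult_left_mono q P R(1))
    finally show ?thesis by (simp add: mult_ac)
  qed
  then show ?thesis by auto
qed

lemma PRQ_lincomb:
  assumes "\<eta> \<in> X" "\<zeta> \<in> X"
  shows "PN \<Omega> \<phi> N (Rcl S (QN \<Omega> \<phi> N (\<lambda>v. a * \<eta> v + b * \<zeta> v)))
    = (\<lambda>v. a * PN \<Omega> \<phi> N (Rcl S (QN \<Omega> \<phi> N \<eta>)) v + b * PN \<Omega> \<phi> N (Rcl S (QN \<Omega> \<phi> N \<zeta>)) v)"
  unfolding QN_lincomb Rcl_lincomb[OF QN_X[OF assms(1)] QN_X[OF assms(2)]] PN_lincomb ..

text \<open>Boundedness of linear maps on a finite-dimensional space, via the bounded coordinates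
  \<open>y (\<phi> k)\<close>. As linearity is available only inside the modal subspace, the
  expansion of \<open>U y\<close> is built by induction with membership carried along.\<close>

lemma linear_on_XN_bounded:
  fixes U :: "fnl \<Rightarrow> 'b::real_normed_vector"
  assumes lin: "\<forall>y\<in>XN \<Omega> \<phi> N. \<forall>z\<in>XN \<Omega> \<phi> N. \<forall>a b. U (\<lambda>v. a * y v + b * z v) = a *\<^sub>R U y + b *\<^sub>R U z"
  shows "\<exists>C. \<forall>y\<in>XN \<Omega> \<phi> N. norm (U y) \<le> C * nrm y"
proof -
  let ?e = "\<lambda>k. emb \<Omega> (\<phi> k)"
  have U0: "U (\<lambda>v. 0) = 0"
    using lin[rule_format, OF XN_zero XN_zero, of 0 0] by simp
  have e: "?e k \<in> XN \<Omega> \<phi> N" if "k \<in> {1..N}" for k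
  proof -
    have "(\<lambda>v. \<Sum>j=1..N. (if j = k then 1 else 0) * ?e j v) = ?e k"
      using that by (simp add: if_distrib[of "\<lambda>c. c * _"] cong: if_cong)
    with phi_comb_XN[where N = N and c = "\<lambda>j. if j = k then 1 else 0"] show ?thesis by simp
  qed
  have comb: "(\<lambda>v. \<Sum>k\<in>I. c k * ?e k v) \<in> XN \<Omega> \<phi> N
      \<and> U (\<lambda>v. \<Sum>k\<in>I. c k * ?e k v) = (\<Sum>k\<in>I. c k *\<^sub>R U (?e k))" if "finite I" "I \<subseteq> {1..N}" for I c
    using that
  proof (induction I)
    case (insert i I)
    let ?s = "\<lambda>v. \<Sum>k\<in>I. c k * ?e k v"
    have s: "?s \<in> XN \<Omega> \<phi> N" "U ?s = (\<Sum>k\<in>I. c k *\<^sub>R U (?e k))" and i: "?e i \<in> XN \<Omega> \<phi> N"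
      using insert e by auto
    have "U (\<lambda>v. c i * ?e i v + 1 * ?s v) = c i *\<^sub>R U (?e i) + 1 *\<^sub>R U ?s"
      by (rule lin[rule_format, OF i s(1)])
    with XN_lincomb[OF i s(1), of "c i" 1] s(2) insert.hyps show ?case by simp
  qed (simp add: XN_zero U0)
  have "norm (U y) \<le> (\<Sum>k=1..N. L2_norm \<Omega> (A (\<phi> k)) * norm (U (?e k))) * nrm y" if y: "y \<in> XN \<Omega> \<phi> N" for y
  proof -
    have "U y = (\<Sum>k=1..N. y (\<phi> k) *\<^sub>R U (?e k))"
      using comb[of "{1..N}" "\<lambda>k. y (\<phi> k)"] arg_cong[OF XN_expand[OF y], of U] by simp
    then have "norm (U y) \<le> (\<Sum>k=1..N. \<bar>y (\<phi> k)\<bar> * norm (U (?e k)))"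
      using norm_sum[of "\<lambda>k. y (\<phi> k) *\<^sub>R U (?e k)" "{1..N}"] by simp
    also have "\<dots> \<le> (\<Sum>k=1..N. (nrm y * L2_norm \<Omega> (A (\<phi> k))) * norm (U (?e k)))"
      using XN_X[OF y] by (intro sum_mono mult_right_mono phi_coeff_bound) auto
    finally show ?thesis by (simp add: sum_distrib_left sum_distrib_right mult_ac)
  qed
  then show ?thesis by blast
qed

text \<open>\<open>X\<^sub>N\<close> is complete, since convergence there is convergence of the finitely many coefficients.\<close>

lemma XN_complete:
  assumes y: "\<And>n::nat. y n \<in> XN \<Omega> \<phi> N" and q: "0 \<le> q" "q < 1"
    and step: "\<And>n. nrm (\<lambda>v. y (Suc n) v - y n v) \<le> C * q ^ n"
  obtains z where "z \<in> XN \<Omega> \<phi> N" "(\<lambda>n. nrm (\<lambda>v. y n v - z v)) \<longlonglongrightarrow> 0"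
proof -
  let ?e = "\<lambda>k. emb \<Omega> (\<phi> k)"
  have conv: "convergent (\<lambda>n. y n (\<phi> k))" if k: "k \<in> {1..N}" for k
  proof -
    have "summable (\<lambda>n. y (Suc n) (\<phi> k) - y n (\<phi> k))"
    proof (rule summable_comparison_test)
      show "summable (\<lambda>n. (C * L2_norm \<Omega> (A (\<phi> k))) * q ^ n)"
        using q by (intro summable_mult summable_geometric) simp
      have "norm (y (Suc n) (\<phi> k) - y n (\<phi> k)) \<le> (C * L2_norm \<Omega> (A (\<phi> k))) * q ^ n" for n
      proof -
        have "norm (y (Suc n) (\<phi> k) - y n (\<phi> k)) \<le> nrm (\<lambda>v. y (Suc n) v - y n v) * L2_norm \<Omega> (A (\<phi> k))"
          using phi_coeff_bound[OF X_diff[OF XN_X[OF y] XN_X[OF y]]] k by simp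
        also have "\<dots> \<le> (C * q ^ n) * L2_norm \<Omega> (A (\<phi> k))"
          by (intro mult_right_mono step) simp
        finally show ?thesis by (simp add: mult_ac)
      qed
      then show "\<exists>n0. \<forall>n\<ge>n0. norm (y (Suc n) (\<phi> k) - y n (\<phi> k)) \<le> (C * L2_norm \<Omega> (A (\<phi> k))) * q ^ n"
        by blast
    qed
    then have "convergent (\<lambda>m. \<Sum>n<m. y (Suc n) (\<phi> k) - y n (\<phi> k))"
      by (simp add: summable_iff_convergent)
    moreover have "(\<Sum>n<m. y (Suc n) (\<phi> k) - y n (\<phi> k)) = y m (\<phi> k) - y 0 (\<phi> k)" for m
      by (rule sum_lessThan_telescope)
    ultimately have "convergent (\<lambda>m. (y m (\<phi> k) - y 0 (\<phi> k)) + y 0 (\<phi> k))"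
      by (intro convergent_add convergent_const) simp
    then show ?thesis by simp
  qed
  define c where "c k = lim (\<lambda>n. y n (\<phi> k))" for k
  define z where "z = (\<lambda>v. \<Sum>k=1..N. c k * ?e k v)"
  have "(\<lambda>n. nrm (\<lambda>v. y n v - z v)) \<longlonglongrightarrow> 0"
  proof (rule Lim_null_comparison)
    have "(\<lambda>n. \<Sum>k=1..N. \<bar>y n (\<phi> k) - c k\<bar> * nrm (?e k)) \<longlonglongrightarrow> (\<Sum>k=1..N. \<bar>c k - c k\<bar> * nrm (?e k))"
      using conv by (intro tendsto_intros) (auto simp: c_def convergent_LIMSEQ_iff)
    then show "(\<lambda>n. \<Sum>k=1..N. \<bar>y n (\<phi> k) - c k\<bar> * nrm (?e k)) \<longlonglongrightarrow> 0" by simp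
    have "nrm (\<lambda>v. y n v - z v) \<le> (\<Sum>k=1..N. \<bar>y n (\<phi> k) - c k\<bar> * nrm (?e k))" for n
    proof -
      have "(\<lambda>v. y n v - z v) = (\<lambda>v. \<Sum>k=1..N. (y n (\<phi> k) - c k) * ?e k v)"
      proof
        fix v
        show "y n v - z v = (\<Sum>k=1..N. (y n (\<phi> k) - c k) * ?e k v)"
          using fun_cong[OF XN_expand[OF y[of n]], of v]
          by (simp add: z_def sum_subtractf left_diff_distrib)
      qed
      then show ?thesis
        using X_finite_sum[of "{1..N}" ?e "\<lambda>k. y n (\<phi> k) - c k"] emb_phi_X by simp
    qed
    then show "\<forall>\<^sub>F n in sequentially. norm (nrm (\<lambda>v. y n v - z v)) \<le> (\<Sum>k=1..N. \<bar>y n (\<phi> k) - c k\<bar> * nrm (?e k))"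
      by simp
  qed
  moreover have "z \<in> XN \<Omega> \<phi> N" unfolding z_def by (rule phi_comb_XN)
  ultimately show ?thesis using that by blast
qed

section \<open>Fixed points by Picard iteration\<close>

text \<open>Banach's argument for the map \<open>y \<mapsto> r - T y\<close> on a carrier set with a
  norm function. The iterates start at 0, their steps shrink geometrically, and uniqueness comes
  from the Lipschitz bound with \<open>q < 1\<close>.\<close>

lemma contraction_solvable:
  assumes T: "\<And>y. y \<in> XN \<Omega> \<phi> N \<Longrightarrow> T y \<in> XN \<Omega> \<phi> N"
    and lip: "\<And>y z. y \<in> XN \<Omega> \<phi> N \<Longrightarrow> z \<in> XN \<Omega> \<phi> N \<Longrightarrow>
      nrm (\<lambda>v. T y v - T z v) \<le> q * nrm (\<lambda>v. y v - z v)"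
    and q: "0 \<le> q" "q < 1" and r: "r \<in> XN \<Omega> \<phi> N"
  shows "\<exists>!y. y \<in> XN \<Omega> \<phi> N \<and> (\<lambda>v. y v + T y v) = r"
proof (rule ex_ex1I)
  define F where "F y = (\<lambda>v. r v - T y v)" for y
  define y where "y n = (F ^^ n) (\<lambda>v. 0)" for n
  have ySuc: "y (Suc n) = F (y n)" for n by (simp add: y_def)
  have yX: "y n \<in> XN \<Omega> \<phi> N" for n
    by (induction n) (auto simp: ySuc F_def XN_diff r T XN_zero, simp add: y_def XN_zero)
  have step: "nrm (\<lambda>v. y (Suc n) v - y n v) \<le> nrm (\<lambda>v. y 1 v - y 0 v) * q ^ n" for n
  proof (induction n)
    case (Suc n)
    have "(\<lambda>v. y (Suc (Suc n)) v - y (Suc n) v) = (\<lambda>v. T (y n) v - T (y (Suc n)) v)"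
      by (simp add: ySuc[of "Suc n"] ySuc[of n] F_def)
    then have "nrm (\<lambda>v. y (Suc (Suc n)) v - y (Suc n) v) \<le> q * nrm (\<lambda>v. y n v - y (Suc n) v)"
      using lip[OF yX yX, of n "Suc n"] by simp
    also have "nrm (\<lambda>v. y n v - y (Suc n) v) = nrm (\<lambda>v. y (Suc n) v - y n v)"
      by (rule Xnorm_diff_commute[OF XN_X[OF yX] XN_X[OF yX]])
    also have "q * \<dots> \<le> q * (nrm (\<lambda>v. y 1 v - y 0 v) * q ^ n)" by (intro mult_left_mono Suc q)
    finally show ?case by (simp add: mult_ac)
  qed simp
  obtain z where z: "z \<in> XN \<Omega> \<phi> N" "(\<lambda>n. nrm (\<lambda>v. y n v - z v)) \<longlonglongrightarrow> 0"
    using XN_complete[OF yX q step] by blast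
  have wX: "(\<lambda>v. z v + T z v - r v) \<in> XN \<Omega> \<phi> N" by (intro XN_diff XN_add z T r)
  have "(\<lambda>n. nrm (\<lambda>v. y (Suc n) v - z v) + q * nrm (\<lambda>v. y n v - z v)) \<longlonglongrightarrow> 0 + q * 0"
    by (intro tendsto_intros z LIMSEQ_Suc[OF z(2)])
  \<comment> \<open>Inserting the definition of the next iterate, the residual of the limit splits
    into the error of iterate \<open>Suc n\<close> and the image under \<open>T\<close> of that of
    iterate \<open>n\<close>; both tend to 0.\<close>
  moreover have "nrm (\<lambda>v. z v + T z v - r v) \<le> nrm (\<lambda>v. y (Suc n) v - z v) + q * nrm (\<lambda>v. y n v - z v)" for n
  proof -
    have "(\<lambda>v. z v + T z v - r v) = (\<lambda>v. (-1) * (y (Suc n) v - z v) + (-1) * (T (y n) v - T z v))"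
      by (simp add: ySuc F_def algebra_simps)
    then have "nrm (\<lambda>v. z v + T z v - r v) \<le> nrm (\<lambda>v. y (Suc n) v - z v) + nrm (\<lambda>v. T (y n) v - T z v)"
      using X_combine(2)[OF XN_X[OF XN_diff[OF yX[of "Suc n"] z(1)]] XN_X[OF XN_diff[OF T[OF yX[of n]] T[OF z(1)]]],
          where a = "-1" and b = "-1"] by simp
    with lip[OF yX z(1), of n] show ?thesis by simp
  qed
  ultimately have "nrm (\<lambda>v. z v + T z v - r v) \<le> 0"
    by (intro LIMSEQ_le_const[where X = "\<lambda>n. nrm (\<lambda>v. y (Suc n) v - z v) + q * nrm (\<lambda>v. y n v - z v)"]) auto
  then have "(\<lambda>v. z v + T z v - r v) = (\<lambda>v. 0)"
    using Xnorm_nonneg[of "\<lambda>v. z v + T z v - r v"] by (intro Xnorm_eq_0 XN_X[OF wX]) linarith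
  then have "(\<lambda>v. z v + T z v) = r" by (auto simp: fun_eq_iff)
  with z(1) show "\<exists>y. y \<in> XN \<Omega> \<phi> N \<and> (\<lambda>v. y v + T y v) = r" by blast
next
  fix y z assume "y \<in> XN \<Omega> \<phi> N \<and> (\<lambda>v. y v + T y v) = r" "z \<in> XN \<Omega> \<phi> N \<and> (\<lambda>v. z v + T z v) = r"
  then have y: "y \<in> XN \<Omega> \<phi> N" and z: "z \<in> XN \<Omega> \<phi> N" and eq: "(\<lambda>v. y v + T y v) = (\<lambda>v. z v + T z v)"
    by auto
  have "y v - z v = T z v - T y v" for v using fun_cong[OF eq, of v] by simp
  then have "nrm (\<lambda>v. y v - z v) \<le> q * nrm (\<lambda>v. z v - y v)" using lip[OF z y] by simp
  then have "nrm (\<lambda>v. y v - z v) \<le> q * nrm (\<lambda>v. y v - z v)"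
    using Xnorm_diff_commute[OF XN_X[OF y] XN_X[OF z]] by simp
  then have "(1 - q) * nrm (\<lambda>v. y v - z v) \<le> 0" by (simp add: algebra_simps)
  then have "nrm (\<lambda>v. y v - z v) = 0"
    using q(2) Xnorm_nonneg[of "\<lambda>v. y v - z v"] by (simp add: mult_le_0_iff)
  then have "(\<lambda>v. y v - z v) = (\<lambda>v. 0)" by (intro Xnorm_eq_0 XN_X[OF XN_diff[OF y z]])
  then show "y = z" by (auto simp: fun_eq_iff)
qed

text \<open>Subtracting the equation for \<open>z\<close> from the iteration turns the new error
  into a difference of values of \<open>T\<close>, so each step gains a factor \<open>q\<close>; the
  constant is the initial error.\<close>

lemma Picard_error:
  assumes T: "\<And>y. y \<in> XN \<Omega> \<phi> N \<Longrightarrow> T y \<in> XN \<Omega> \<phi> N"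
    and lip: "\<And>y z. y \<in> XN \<Omega> \<phi> N \<Longrightarrow> z \<in> XN \<Omega> \<phi> N \<Longrightarrow>
      nrm (\<lambda>v. T y v - T z v) \<le> q * nrm (\<lambda>v. y v - z v)"
    and q: "0 \<le> q" and r: "r \<in> XN \<Omega> \<phi> N" and y0: "y0 \<in> XN \<Omega> \<phi> N"
    and z: "z \<in> XN \<Omega> \<phi> N" "(\<lambda>v. z v + T z v) = r"
  shows "nrm (\<lambda>v. ((\<lambda>y v. r v - T y v) ^^ l) y0 v - z v) \<le> nrm (\<lambda>v. y0 v - z v) * q ^ l"
proof -
  define y where "y l = ((\<lambda>y v. r v - T y v) ^^ l) y0" for l
  have ySuc: "y (Suc l) = (\<lambda>v. r v - T (y l) v)" for l by (simp add: y_def)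
  have y0': "y 0 = y0" by (simp add: y_def)
  have yX: "y l \<in> XN \<Omega> \<phi> N" for l
  proof (induction l)
    case (Suc l)
    then show ?case unfolding ySuc by (intro XN_diff r T)
  qed (simp add: y0' y0)
  have "nrm (\<lambda>v. y l v - z v) \<le> nrm (\<lambda>v. y0 v - z v) * q ^ l"
  proof (induction l)
    case (Suc l)
    have "y (Suc l) v - z v = T z v - T (y l) v" for v
      using fun_cong[OF z(2), of v] by (simp add: ySuc)
    then have "nrm (\<lambda>v. y (Suc l) v - z v) \<le> q * nrm (\<lambda>v. z v - y l v)"
      using lip[OF z(1) yX, of l] by simp
    also have "nrm (\<lambda>v. z v - y l v) = nrm (\<lambda>v. y l v - z v)"
      by (rule Xnorm_diff_commute[OF XN_X[OF z(1)] XN_X[OF yX]])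
    also have "q * \<dots> \<le> q * (nrm (\<lambda>v. y0 v - z v) * q ^ l)" by (intro mult_left_mono Suc q)
    finally show ?case by (simp add: mult_ac)
  qed (simp add: y0')
  then show ?thesis by (simp add: y_def)
qed

end

theorem proposition10p13:
  fixes \<Omega> :: "pt set" and \<kappa> lam :: real
    and ev :: "nat \<Rightarrow> real" and \<phi> :: "nat \<Rightarrow> fn" and N :: nat
    and xs :: "'m::finite \<Rightarrow> pt"
    and S :: "real \<Rightarrow> fnl \<Rightarrow> fnl" and U :: "fnl \<Rightarrow> real ^ 'm" and yr :: fnl
  defines "T \<equiv> TN \<Omega> \<phi> N xs S U"
    and "X \<equiv> XN \<Omega> \<phi> N"
    and "nrm \<equiv> Xnorm \<Omega> \<kappa>"
  defines "normT \<equiv> opnorm X nrm nrm T"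
  assumes "C2_domain \<Omega>" and "\<kappa> > 0"
    and "neumann_eigenbasis \<Omega> ev \<phi>"
    and "\<forall>j. xs j \<in> \<Omega>"
    and "lam > 0" and "closed_loop_semigroup \<Omega> \<kappa> lam xs S"
    and U_linear: "\<forall>y\<in>X. \<forall>z\<in>X. \<forall>a b. U (\<lambda>v. a * y v + b * z v) = a *\<^sub>R U y + b *\<^sub>R U z"
    and U_steady: "\<forall>f\<in>mode_fns \<phi> N.
        PN \<Omega> \<phi> N (\<lambda>v. emb \<Omega> (A0 \<Omega> \<kappa> f) v + Bop \<Omega> xs (U (emb \<Omega> f)) v) = (\<lambda>v. 0)"
    and "yr \<in> X"
    and small: "LN \<Omega> \<kappa> \<phi> N S * opnorm UNIV norm nrm (Bop \<Omega> xs) * opnorm X nrm norm U < 1"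
  shows "bij_betw (\<lambda>y v. y v + T y v) X X \<and>
    (\<exists>!ystar. ystar \<in> X \<and> (\<lambda>v. ystar v + T ystar v) = yr) \<and>
    (\<forall>ystar. ystar \<in> X \<and> (\<lambda>v. ystar v + T ystar v) = yr \<longrightarrow>
       (\<exists>q. 0 \<le> q \<and> q < 1 \<and>
          (\<forall>y0\<in>X. \<exists>C. \<forall>l. nrm (\<lambda>v. ((\<lambda>y v. yr v - T y v) ^^ l) y0 v - ystar v) \<le> C * q ^ l)) \<and>
       normT < 1 \<and>
       nrm ystar \<le> 1 / (1 - normT) * nrm yr)"
proof -
  interpret cl: closed_loop \<Omega> \<kappa> lam ev \<phi> xs S
    using assms(5-10) by unfold_locales (simp_all add: C2_domain_def)
  let ?R = "PN \<Omega> \<phi> N \<circ> Rcl S \<circ> QN \<Omega> \<phi> N"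
  have nrm0: "nrm y \<ge> 0" for y by (simp add: nrm_def)
  have zero: "(\<lambda>v. 0) \<in> X" "nrm (\<lambda>v. 0) = 0" "(\<lambda>v. 0) \<in> Xsp \<Omega> \<kappa>"
    by (simp_all add: X_def nrm_def cl.XN_zero cl.Xnorm_zero cl.X_zero)
  define a where "a = LN \<Omega> \<kappa> \<phi> N S"
  define b where "b = opnorm UNIV norm nrm (Bop \<Omega> xs)"
  define c where "c = opnorm X nrm norm U"
  \<comment> \<open>For each of the three maps some crude constant is obtained first; the operator
    norm lemmas then replace it by the supremum in the smallness condition.\<close>
  obtain Ca where Ca: "\<And>\<eta>. \<eta> \<in> Xsp \<Omega> \<kappa> \<Longrightarrow> nrm (?R \<eta>) \<le> Ca * nrm \<eta>"
    using cl.PRQ_bound unfolding nrm_def by blast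
  have a: "a \<ge> 0" "\<And>\<eta>. \<eta> \<in> Xsp \<Omega> \<kappa> \<Longrightarrow> nrm (?R \<eta>) \<le> a * nrm \<eta>"
    unfolding a_def LN_def nrm_def[symmetric]
    by - (rule opnorm_nonneg[of "Xsp \<Omega> \<kappa>" nrm ?R Ca nrm, OF Ca nrm0 zero(3,2)], assumption,
        rule opnorm_bound[of "Xsp \<Omega> \<kappa>" nrm ?R Ca nrm, OF Ca nrm0])
  obtain Cb where Cb: "\<And>u. nrm (Bop \<Omega> xs u) \<le> Cb * norm u"
    using cl.Bop_bound unfolding nrm_def by blast
  have b: "b \<ge> 0" "\<And>u. nrm (Bop \<Omega> xs u) \<le> b * norm u"
    unfolding b_def
    by - (rule opnorm_nonneg[of UNIV nrm "Bop \<Omega> xs" Cb norm 0, OF Cb norm_ge_zero UNIV_I norm_zero],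
        rule opnorm_bound[of UNIV nrm "Bop \<Omega> xs" Cb norm, OF Cb norm_ge_zero UNIV_I])
  obtain Cc where Cc: "\<And>y. y \<in> X \<Longrightarrow> norm (U y) \<le> Cc * nrm y"
    using cl.linear_on_XN_bounded[OF U_linear[unfolded X_def]] unfolding X_def nrm_def by blast
  have c: "c \<ge> 0" "\<And>y. y \<in> X \<Longrightarrow> norm (U y) \<le> c * nrm y"
    unfolding c_def
    by - (rule opnorm_nonneg[of X norm U Cc nrm, OF Cc nrm0 zero(1,2)], assumption,
        rule opnorm_bound[of X norm U Cc nrm, OF Cc nrm0])
  \<comment> \<open>\<open>q\<close> serves as contraction factor, as convergence rate, and as upper
    bound of \<open>normT\<close>.\<close>
  define q where "q = a * b * c"
  have q: "0 \<le> q" "q < 1"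
    using a(1) b(1) c(1) small by (simp_all add: q_def a_def b_def c_def)
  have T_eq: "T y = ?R (Bop \<Omega> xs (U y))" for y by (simp add: T_def TN_def)
  have TX: "T y \<in> X" for y by (simp add: T_eq X_def cl.PN_XN)
  have T_bound: "nrm (T y) \<le> q * nrm y" if y: "y \<in> X" for y
  proof -
    have "nrm (T y) \<le> a * nrm (Bop \<Omega> xs (U y))" unfolding T_eq by (intro a(2) cl.Bop_X)
    also have "\<dots> \<le> a * (b * norm (U y))" by (intro mult_left_mono b a)
    also have "\<dots> \<le> a * (b * (c * nrm y))" by (intro mult_left_mono b a c y)
    finally show ?thesis by (simp add: q_def mult_ac)
  qed
  have T_diff: "(\<lambda>v. T y v - T z v) = T (\<lambda>v. y v - z v)" if y: "y \<in> X" and z: "z \<in> X" for y z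
  proof -
    \<comment> \<open>Linearity of \<open>U\<close> is given only for two-term combinations of modal
      elements, hence the explicit coefficients.\<close>
    have "U (\<lambda>v. 1 * y v + (-1) * z v) = 1 *\<^sub>R U y + (-1) *\<^sub>R U z"
      by (rule U_linear[rule_format, OF y z])
    then have "Bop \<Omega> xs (U (\<lambda>v. y v - z v)) = (\<lambda>v. 1 * Bop \<Omega> xs (U y) v + (-1) * Bop \<Omega> xs (U z) v)"
      by (simp add: Bop_def left_diff_distrib sum_subtractf)
    then show ?thesis
      unfolding T_eq comp_def by (simp only: cl.PRQ_lincomb[OF cl.Bop_X cl.Bop_X]) simp
  qed
  have lip: "nrm (\<lambda>v. T y v - T z v) \<le> q * nrm (\<lambda>v. y v - z v)" if "y \<in> X" "z \<in> X" for y z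
    unfolding T_diff[OF that] using that by (intro T_bound) (simp add: X_def cl.XN_diff)
  note facts = TX[unfolded X_def] lip[unfolded X_def nrm_def]
  \<comment> \<open>Solving for every right-hand side \<open>r\<close>, not just \<open>yr\<close>,
    yields injectivity and surjectivity of the operator at once.\<close>
  have ex1: "\<exists>!y. y \<in> X \<and> (\<lambda>v. y v + T y v) = r" if "r \<in> X" for r
    unfolding X_def using that
    by (intro cl.contraction_solvable[where T = T and q = q] facts q) (simp_all add: X_def)
  have bij: "bij_betw (\<lambda>y v. y v + T y v) X X"
  proof (rule bij_betwI')
    show "((\<lambda>v. y v + T y v) = (\<lambda>v. z v + T z v)) = (y = z)" if "y \<in> X" "z \<in> X" for y z
    proof
      assume eq: "(\<lambda>v. y v + T y v) = (\<lambda>v. z v + T z v)"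
      have "(\<lambda>v. z v + T z v) \<in> X" using that TX by (simp add: X_def cl.XN_add)
      from ex1[OF this] show "y = z" by (rule ex1E) (use eq that in metis)
    qed simp
    show "(\<lambda>v. y v + T y v) \<in> X" if "y \<in> X" for y
      using that TX by (simp add: X_def cl.XN_add)
    show "\<exists>y\<in>X. r = (\<lambda>v. y v + T y v)" if "r \<in> X" for r
      using ex1[OF that] by blast
  qed
  have normT: "normT < 1" "nrm (T y) \<le> normT * nrm y" if "y \<in> X" for y
  proof -
    have "normT \<le> q" unfolding normT_def
      by (rule opnorm_least[of X nrm T q nrm, OF T_bound nrm0 _ q(1)]) (use zero(1) in auto)
    with q(2) show "normT < 1" by simp
    show "nrm (T y) \<le> normT * nrm y" unfolding normT_def
      by (rule opnorm_bound[of X nrm T q nrm, OF T_bound nrm0 that])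
  qed
  have bound: "nrm ystar \<le> 1 / (1 - normT) * nrm yr"
    if ys: "ystar \<in> X" "(\<lambda>v. ystar v + T ystar v) = yr" for ystar
  proof -
    have "ystar v = 1 * yr v + (-1) * T ystar v" for v using fun_cong[OF ys(2), of v] by simp
    then have eq: "ystar = (\<lambda>v. 1 * yr v + (-1) * T ystar v)" by (rule ext)
    have "yr \<in> Xsp \<Omega> \<kappa>" "T ystar \<in> Xsp \<Omega> \<kappa>"
      using \<open>yr \<in> X\<close> TX cl.XN_X by (auto simp: X_def)
    then have "nrm (\<lambda>v. 1 * yr v + (-1) * T ystar v) \<le> nrm yr + nrm (T ystar)"
      using cl.X_combine(2)[of yr "T ystar" 1 "-1"] by (simp add: nrm_def)
    then have "nrm ystar \<le> nrm yr + nrm (T ystar)" using arg_cong[OF eq, of nrm] by linarith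
    also have "\<dots> \<le> nrm yr + normT * nrm ystar" using normT(2)[OF ys(1)] by simp
    finally have "(1 - normT) * nrm ystar \<le> nrm yr" by (simp add: algebra_simps)
    with normT(1)[OF ys(1)] show ?thesis by (simp add: field_simps)
  qed
  \<comment> \<open>The rate is the same for all starting points; only the constant depends on
    \<open>y0\<close>.\<close>
  have error: "\<exists>C. \<forall>l. nrm (\<lambda>v. ((\<lambda>y v. yr v - T y v) ^^ l) y0 v - ystar v) \<le> C * q ^ l"
    if "ystar \<in> X" "(\<lambda>v. ystar v + T ystar v) = yr" "y0 \<in> X" for ystar y0
  proof (rule exI, rule allI)
    show "nrm (\<lambda>v. ((\<lambda>y v. yr v - T y v) ^^ l) y0 v - ystar v) \<le> nrm (\<lambda>v. y0 v - ystar v) * q ^ l" for l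
      unfolding nrm_def
      by (rule cl.Picard_error[where T = T and N = N and r = yr]) (use facts q(1) that \<open>yr \<in> X\<close> in \<open>simp_all add: X_def\<close>)
  qed
  have Picard: "\<exists>q. 0 \<le> q \<and> q < 1 \<and> (\<forall>y0\<in>X. \<exists>C. \<forall>l.
      nrm (\<lambda>v. ((\<lambda>y v. yr v - T y v) ^^ l) y0 v - ystar v) \<le> C * q ^ l)"
    if "ystar \<in> X" "(\<lambda>v. ystar v + T ystar v) = yr" for ystar
    using q error[OF that] by blast
  show ?thesis
    using bij ex1[OF \<open>yr \<in> X\<close>] Picard normT(1)[OF zero(1)] bound by blast
qed

end
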